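(* Let $R$ be a nonzero commutative ring, fix two scalars $[2]_s,[2]_t\in R$, and let $n\ge 1$ be an integer. The two-colored Jones--Wenzl projector $\mathrm{JW}_R({}_s n)\in 2\mathrm{TL}_R({}_s n)$ exists if and only if the two-colored quantum binomial coefficient $\genfrac{[}{]}{0pt}{}{n}{k}_s$ is invertible in $R$ for each integer $0\le k\le n$.
   Context: Two-colored Temperley--Lieb algebra: $2\mathrm{TL}_R({}_s n)=2\mathrm{TL}_R({}_s n;[2]_s,[2]_t)$ is the $R$-algebra with generators $e_1,\dots,e_{n-1}$ and relations $e_i^2=-[2]_s e_i$ for $i$ odd; $e_i^2=-[2]_t e_i$ for $i$ even; $e_ie_j=e_je_i$ for $|i-j|>1$; $e_ie_{i\pm1}e_i=e_i$. It is a free $R$-module with basis the reduced monomials in the $e_i$ (monomials that cannot be rewritten, using the relations, as a shorter monomial, up to scalar), including the empty monomial $1$; "coefficient" refers to this basis. A two-colored Jones--Wenzl projector $\mathrm{JW}_R({}_s n)$ is a nonzero idempotent of $2\mathrm{TL}_R({}_s n)$ such that $e_i\,\mathrm{JW}_R({}_s n)=0$ for all $1\le i\le n-1$ and the coefficient of $1$ in it is $1$. It is unique if it exists. Two-colored quantum numbers: in $A=\mathbb{Z}[x_s,x_t]$ put $[1]_s=[1]_t=1$, $[2]_s=x_s$, $[2]_t=x_t$ and, for $n>1$, $[n+1]_s=[2]_s[n]_t-[n-1]_s$, $[n+1]_t=[2]_t[n]_s-[n-1]_t$. Let $[n]_s!=[n]_s[n-1]_s\cdots[1]_s$ and, for $0\le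 k\le n$, $\genfrac{[}{]}{0pt}{}{n}{k}_s=\frac{[n]_s!}{[k]_s!\,[n-k]_s!}$, which is an element of $A$. In the ring $R$, these symbols denote the images under the ring homomorphism $A\to R$ sending $x_s,x_t$ to the fixed scalars $[2]_s,[2]_t\in R$. *)

theory Defs
  imports
    "HOL-Library.Poly_Mapping"
    "HOL-Computational_Algebra.Polynomial"
    "HOL-Algebra.QuotRing"
begin

section \<open>Two-colored quantum numbers\<close>

text \<open>
  The ring \<open>A = \<int>[x\<^sub>s, x\<^sub>t]\<close> is modelled as \<open>\<int>[x\<^sub>s][x\<^sub>t]\<close>: the coefficients of the outer
  polynomial are polynomials in \<open>x\<^sub>s\<close>.
\<close>

type_synonym zxy = "int poly poly"

definition x_s :: zxy where "x_s = [:[:0, 1:]:]"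
definition x_t :: zxy where "x_t = [:0, 1:]"

text \<open>
  With the convention \<open>[0] = 0\<close> the recursion also yields \<open>[2]\<^sub>s = x\<^sub>s\<close> and \<open>[2]\<^sub>t = x\<^sub>t\<close>.
\<close>

fun qnum_s :: "nat \<Rightarrow> zxy" and qnum_t :: "nat \<Rightarrow> zxy" where
  "qnum_s 0 = 0"
| "qnum_s (Suc 0) = 1"
| "qnum_s (Suc (Suc m)) = x_s * qnum_t (Suc m) - qnum_s m"
| "qnum_t 0 = 0"
| "qnum_t (Suc 0) = 1"
| "qnum_t (Suc (Suc m)) = x_t * qnum_s (Suc m) - qnum_t m"

definition qfact_s :: "nat \<Rightarrow> zxy" where
  "qfact_s n = (\<Prod>m = 1..n. qnum_s m)"

text \<open>The division in \<open>A\<close> is exact, so \<open>div\<close> is the quotient in the fraction field of \<open>A\<close>.\<close>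

definition qbinom_s :: "nat \<Rightarrow> nat \<Rightarrow> zxy" where
  "qbinom_s n k = qfact_s n div (qfact_s k * qfact_s (n - k))"

text \<open>The ring homomorphism \<open>A \<rightarrow> R\<close> sending \<open>x\<^sub>s\<close> to \<open>a\<close> and \<open>x\<^sub>t\<close> to \<open>b\<close>.\<close>

definition specialize :: "'r::comm_ring_1 \<Rightarrow> 'r \<Rightarrow> zxy \<Rightarrow> 'r" where
  "specialize a b p = poly (map_poly (\<lambda>q. poly (map_poly of_int q) a) p) b"


section \<open>The free algebra on \<open>e\<^sub>1, \<dots>, e\<^sub>n\<^sub>-\<^sub>1\<close>\<close>

text \<open>
  Words form a monoid under concatenation. With the additive notation used here,
  \<^typ>\<open>nat list \<Rightarrow>\<^sub>0 'r\<close> with its convolution product is the free algebra on generators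
  indexed by the natural numbers, and \<^term>\<open>Poly_Mapping.single w c\<close> is \<open>c\<close> times the word \<open>w\<close>.
\<close>

instantiation list :: (type) monoid_add
begin

definition zero_list :: "'a list" where "zero_list = []"
definition plus_list :: "'a list \<Rightarrow> 'a list \<Rightarrow> 'a list" where "plus_list u v = u @ v"

instance by standard (simp_all add: zero_list_def plus_list_def)

end

definition free_alg :: "nat \<Rightarrow> (nat list \<Rightarrow>\<^sub>0 'r::comm_ring_1) ring" where
  "free_alg n =
    \<lparr>carrier = {p. Poly_Mapping.keys p \<subseteq> lists {1..<n}},
     mult = (*), one = 1, zero = 0, add = (+)\<rparr>"

lemma ring_free_alg: "ring (free_alg n)"
proof (rule ringI)
  show "abelian_group (free_alg n)"
  proof (rule abelian_groupI, goal_cases)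
    case (6 p)
    then show ?case by (intro bexI[of _ "- p"]) (auto simp: free_alg_def)
  qed (auto simp: free_alg_def add_ac dest!: subsetD[OF keys_add])
  show "Group.monoid (free_alg n)"
  proof (rule monoidI, goal_cases)
    case (1 p q)
    then show ?case
      using keys_mult[of p q] by (fastforce simp: free_alg_def plus_list_def)
  qed (auto simp: free_alg_def mult.assoc zero_list_def)
qed (auto simp: free_alg_def algebra_simps)

abbreviation word :: "nat list \<Rightarrow> (nat list \<Rightarrow>\<^sub>0 'r::comm_ring_1)" where
  "word w \<equiv> Poly_Mapping.single w 1"


section \<open>The two-colored Temperley--Lieb algebra\<close>

text \<open>The relations \<open>u = v\<close>, written as differences \<open>u - v\<close>; here \<open>a = [2]\<^sub>s\<close> and \<open>b = [2]\<^sub>t\<close>.\<close>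

definition tl_relators :: "'r::comm_ring_1 \<Rightarrow> 'r \<Rightarrow> nat \<Rightarrow> (nat list \<Rightarrow>\<^sub>0 'r) set" where
  "tl_relators a b n =
     {word [i, i] - Poly_Mapping.single [i] (- a) | i. i \<in> {1..<n} \<and> odd i}
   \<union> {word [i, i] - Poly_Mapping.single [i] (- b) | i. i \<in> {1..<n} \<and> even i}
   \<union> {word [i, j] - word [j, i] | i j.
        i \<in> {1..<n} \<and> j \<in> {1..<n} \<and> (i + 1 < j \<or> j + 1 < i)}
   \<union> {word [i, j, i] - word [i] | i j.
        i \<in> {1..<n} \<and> j \<in> {1..<n} \<and> (j = i + 1 \<or> i = j + 1)}"

definition tl_ideal :: "'r::comm_ring_1 \<Rightarrow> 'r \<Rightarrow> nat \<Rightarrow> (nat list \<Rightarrow>\<^sub>0 'r) set" where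
  "tl_ideal a b n = Idl\<^bsub>free_alg n\<^esub> (tl_relators a b n)"

definition two_TL :: "'r::comm_ring_1 \<Rightarrow> 'r \<Rightarrow> nat \<Rightarrow> (nat list \<Rightarrow>\<^sub>0 'r) set ring" where
  "two_TL a b n = free_alg n Quot tl_ideal a b n"

lemma tl_relators_subset: "tl_relators a b n \<subseteq> carrier (free_alg n)"
  by (auto simp: tl_relators_def free_alg_def dest!: subsetD[OF keys_diff] split: if_splits)

lemma ideal_tl_ideal: "ideal (tl_ideal a b n) (free_alg n)"
  unfolding tl_ideal_def by (rule ring.genideal_ideal[OF ring_free_alg tl_relators_subset])

lemma ring_two_TL: "ring (two_TL a b n)"
  unfolding two_TL_def by (rule ideal.quotient_is_ring[OF ideal_tl_ideal])

text \<open>The class of \<open>c w\<close> for a scalar \<open>c\<close> and a word \<open>w\<close>. The algebra structure over \<open>R\<close> is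
  given by the scalars \<open>tl_mon a b n c []\<close>.\<close>

definition tl_mon :: "'r::comm_ring_1 \<Rightarrow> 'r \<Rightarrow> nat \<Rightarrow> 'r \<Rightarrow> nat list \<Rightarrow> (nat list \<Rightarrow>\<^sub>0 'r) set" where
  "tl_mon a b n c w = tl_ideal a b n +>\<^bsub>free_alg n\<^esub> Poly_Mapping.single w c"

definition tl_scale ::
  "'r::comm_ring_1 \<Rightarrow> 'r \<Rightarrow> nat \<Rightarrow> 'r \<Rightarrow> (nat list \<Rightarrow>\<^sub>0 'r) set \<Rightarrow> (nat list \<Rightarrow>\<^sub>0 'r) set" where
  "tl_scale a b n c X = tl_mon a b n c [] \<otimes>\<^bsub>two_TL a b n\<^esub> X"

definition tl_gen :: "'r::comm_ring_1 \<Rightarrow> 'r \<Rightarrow> nat \<Rightarrow> nat \<Rightarrow> (nat list \<Rightarrow>\<^sub>0 'r) set" where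
  "tl_gen a b n i = tl_mon a b n 1 [i]"

definition reduced :: "'r::comm_ring_1 \<Rightarrow> 'r \<Rightarrow> nat \<Rightarrow> nat list \<Rightarrow> bool" where
  "reduced a b n w \<longleftrightarrow>
     w \<in> lists {1..<n} \<and>
     \<not> (\<exists>v \<in> lists {1..<n}. \<exists>c. length v < length w \<and>
          tl_mon a b n 1 w = tl_scale a b n c (tl_mon a b n 1 v))"

text \<open>
  Reduced words that differ by commutations, such as \<open>e\<^sub>1 e\<^sub>3\<close> and \<open>e\<^sub>3 e\<^sub>1\<close>, give the same basis
  element; the basis is therefore a set of elements of the algebra rather than of words.
\<close>

definition tl_basis :: "'r::comm_ring_1 \<Rightarrow> 'r \<Rightarrow> nat \<Rightarrow> (nat list \<Rightarrow>\<^sub>0 'r) set set" where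
  "tl_basis a b n = tl_mon a b n 1 ` {w. reduced a b n w}"

text \<open>\<open>c\<close> is a coefficient family of \<open>X\<close> with respect to the basis of reduced monomials. As this is
  a basis, there is exactly one such family for every element \<open>X\<close> of the algebra.\<close>

definition tl_coeffs ::
  "'r::comm_ring_1 \<Rightarrow> 'r \<Rightarrow> nat \<Rightarrow> (nat list \<Rightarrow>\<^sub>0 'r) set \<Rightarrow> ((nat list \<Rightarrow>\<^sub>0 'r) set \<Rightarrow> 'r) \<Rightarrow> bool"
where
  "tl_coeffs a b n X c \<longleftrightarrow>
     {m. c m \<noteq> 0} \<subseteq> tl_basis a b n \<and> finite {m. c m \<noteq> 0} \<and>
     X = (\<Oplus>\<^bsub>two_TL a b n\<^esub> m \<in> {m. c m \<noteq> 0}. tl_scale a b n (c m) m)"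

definition is_JW :: "'r::comm_ring_1 \<Rightarrow> 'r \<Rightarrow> nat \<Rightarrow> (nat list \<Rightarrow>\<^sub>0 'r) set \<Rightarrow> bool" where
  "is_JW a b n J \<longleftrightarrow>
     J \<in> carrier (two_TL a b n) \<and>
     J \<noteq> \<zero>\<^bsub>two_TL a b n\<^esub> \<and>
     J \<otimes>\<^bsub>two_TL a b n\<^esub> J = J \<and>
     (\<forall>i \<in> {1..<n}. tl_gen a b n i \<otimes>\<^bsub>two_TL a b n\<^esub> J = \<zero>\<^bsub>two_TL a b n\<^esub>) \<and>
     (\<exists>c. tl_coeffs a b n J c \<and> c \<one>\<^bsub>two_TL a b n\<^esub> = 1)"

end

theory Submission
  imports Defs
begin

text \<open>
  The algebra acts on words of signs, a word being a cup diagram whose cups are the pairs \<open>+ -\<close>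
  matched like parentheses. Let \<open>M\<^sub>k\<close> be the span of the words of length \<open>n\<close> with \<open>k\<close> minus signs.
  Over \<open>\<int>[x\<^sub>s, x\<^sub>t]\<close> there is a vector \<open>v\<^sub>k\<close> in \<open>M\<^sub>k\<close> killed by all \<open>e\<^sub>i\<close>, with coordinate \<open>1\<close> at
  \<open>+ \<dots> + - \<dots> -\<close> and the quantum binomial coefficient at \<open>- \<dots> - + \<dots> +\<close>, and over every ring a
  vector killed by all \<open>e\<^sub>i\<close> is a multiple of the specialization of \<open>v\<^sub>k\<close>.

  A projector \<open>J\<close> has coordinate \<open>1\<close> at \<open>c = - \<dots> - + \<dots> +\<close> in \<open>J c\<close>, because every \<open>e\<^sub>i\<close> creates a pair
  \<open>+ -\<close>. Since \<open>J c\<close> is a multiple of \<open>v\<^sub>k\<close>, the binomial coefficient divides \<open>1\<close>.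

  Conversely, there is \<open>X\<close> over \<open>\<int>[x\<^sub>s, x\<^sub>t]\<close> with \<open>e\<^sub>i X = 0\<close> and coefficient \<open>g \<noteq> 0\<close> of \<open>1\<close>. Expand \<open>X\<close> in
  normal words \<open>D\<close>, one for each pair of cup diagrams with equally many cups. The same comparison
  of coordinates shows that \<open>g\<close> divides the \<open>k\<close>-th binomial coefficient times \<open>X\<close> on \<open>M\<^sub>k\<close>. The cap
  halves of normal words form a unitriangular system on \<open>M\<^sub>k\<close>, so \<open>g\<close> divides the product of the
  binomial coefficients times each coefficient of \<open>X\<close>; the quotient specializes to a multiple of the
  projector. The same triangularity shows that the action is faithful.
\<close>


section \<open>Flipping unmatched signs\<close>

text \<open>The vector \<open>v_k\<close> is built one strand at a time, as in the classical
  recursion for Jones--Wenzl projectors: put a minus in front of the vector for \<open>k - 1\<close>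
  on \<open>n - 1\<close> strands and apply the sum over \<open>j\<close> of
  \<open>[n - j] e_j ... e_1\<close>. These coefficients solve a three-term recurrence that makes
  the sum telescope under every \<open>e_i\<close>; a product of such sums gives \<open>X\<close>.
  What comes out is \<open>[k]\<close> times \<open>v_k\<close>. The division is exact because the
  equations of invariance are triangular with unit leading coefficients, so every coordinate is a
  multiple of a single one. Removing the first strand shifts the generators by one and exchanges the
  colours, so the recursion for the binomial coefficients has to cross between colours at each step.
  The scalar \<open>g\<close> may vanish in \<open>R\<close>, hence the division by it over the
  polynomial ring, before specialization. Both triangular arguments are stated as divisibility by an
  arbitrary modulus: modulus 0 gives uniqueness and faithfulness over any ring, other moduli give
  exact division.\<close>

text \<open>
  \<open>True\<close> stands for \<open>+\<close> and \<open>False\<close> for \<open>-\<close>. In a word, \<open>+\<close> and \<open>-\<close> are matched like opening and closing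
  parentheses, so that the unmatched signs read \<open>- \<dots> - + \<dots> +\<close>. The operation \<open>flip_minus h y\<close> flips the
  first \<open>-\<close> that is still unmatched when \<open>h\<close> plus signs are put in front of \<open>y\<close>; \<open>flip_plus\<close> is its
  mirror image.
\<close>

abbreviation minuses :: "bool list \<Rightarrow> nat" where
  "minuses w \<equiv> count_list w False"

fun flip_minus :: "nat \<Rightarrow> bool list \<Rightarrow> bool list option" where
  "flip_minus h [] = None"
| "flip_minus h (True # y) = map_option (Cons True) (flip_minus (Suc h) y)"
| "flip_minus 0 (False # y) = Some (True # y)"
| "flip_minus (Suc h) (False # y) = map_option (Cons False) (flip_minus h y)"

text \<open>Counts the plus signs still open at the end when \<open>h\<close> of them are put in
  front. The subtraction is truncated: a minus without a partner leaves the count at 0.\<close>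

fun height :: "nat \<Rightarrow> bool list \<Rightarrow> nat" where
  "height h [] = h"
| "height h (True # y) = height (Suc h) y"
| "height h (False # y) = height (h - 1) y"

text \<open>Reflection exchanges opening and closing parentheses, so facts about unmatched plus
  signs follow from those about minus signs.\<close>

definition mirror :: "bool list \<Rightarrow> bool list" where
  "mirror w = rev (map Not w)"

definition flip_plus :: "nat \<Rightarrow> bool list \<Rightarrow> bool list option" where
  "flip_plus h x = map_option mirror (flip_minus h (mirror x))"

definition balanced :: "bool list \<Rightarrow> bool" where
  "balanced v \<longleftrightarrow> flip_minus 0 v = None \<and> height 0 v = 0"

lemma mirror_mirror [simp]: "mirror (mirror w) = w"
  by (simp add: mirror_def rev_map o_def)

lemma mirror_simps [simp]:
  "mirror [] = []" "mirror (u @ v) = mirror v @ mirror u" "mirror (b # v) = mirror v @ [\<not> b]"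
  "length (mirror w) = length w"
  by (simp_all add: mirror_def)

lemma append_fun: "(@) [] = (\<lambda>z. z)" "(@) (b # u) = (\<lambda>z. b # u @ z)"
  by auto

lemma flip_minus_append:
  "flip_minus h (m @ z) = (case flip_minus h m of Some m' \<Rightarrow> Some (m' @ z)
     | None \<Rightarrow> map_option (\<lambda>z'. m @ z') (flip_minus (height h m) z))"
  by (induction h m rule: flip_minus.induct)
    (auto split: option.splits simp: option.map_comp o_def append_fun option.map_ident)

lemma height_append: "height h (m @ z) = height (height h m) z"
  by (induction h m rule: height.induct) auto

text \<open>\<open>flip_minus h\<close> flips the unmatched minus number \<open>h + 1\<close>.
  Flipping number \<open>g + 1\<close> turns it into the partner of number \<open>g + 2\<close>, so
  the later ones move down by two. This is why two distant caps that both flip a sign on their right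
  commute.\<close>

lemma flip_minus_flip_minus:
  "Option.bind (flip_minus g y) (flip_minus (g + h)) =
   Option.bind (flip_minus (Suc (Suc (g + h))) y) (flip_minus g)"
proof (induction g y arbitrary: h rule: flip_minus.induct)
  case (2 g y)
  from 2[of h] show ?case
    by (cases "flip_minus (Suc g) y"; cases "flip_minus (Suc (Suc (Suc (g + h)))) y") auto
next
  case (4 g y)
  from 4[of h] show ?case
    by (cases "flip_minus g y"; cases "flip_minus (Suc (Suc (g + h))) y") auto
qed (auto split: Option.bind_splits)

lemma flip_minus_shift:
  "flip_minus h v = None \<Longrightarrow> flip_minus (h + g) v = None \<and> height (h + g) v = height h v + g"
  by (induction h v rule: flip_minus.induct) auto

lemma balanced_flip_minus: "balanced v \<Longrightarrow> flip_minus h v = None"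
  and balanced_height: "balanced v \<Longrightarrow> height h v = h"
  using flip_minus_shift[of 0 v h] by (auto simp: balanced_def)

lemma flip_minus_None_iff:
  "flip_minus h v = None \<longleftrightarrow>
     (\<forall>t. minuses (take t v) \<le> h + count_list (take t v) True)"
proof (induction h v rule: flip_minus.induct)
  case (2 h y)
  show ?case unfolding flip_minus.simps option.map_disc_iff 2
    apply (rule iffI; rule allI)
    subgoal for t by (cases t) auto
    subgoal premises p for t using p[rule_format, of "Suc t"] by auto
    done
next
  case (3 y)
  then show ?case by (auto intro: exI[of _ 1])
next
  case (4 h y)
  show ?case unfolding flip_minus.simps option.map_disc_iff 4
    apply (rule iffI; rule allI)
    subgoal for t by (cases t) auto
    subgoal premises p for t using p[rule_format, of "Suc t"] by auto
    done
qed auto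

lemma height_None:
  "flip_minus h v = None \<Longrightarrow> height h v + minuses v = h + count_list v True"
  by (induction h v rule: flip_minus.induct) auto

lemma count_mirror [simp]: "count_list (mirror v) b = count_list v (\<not> b)"
  by (induction v) auto

text \<open>The ballot form of being completely matched. Reflection turns prefixes into suffixes,
  whose counts follow from the totals, so stability under \<open>mirror\<close> is visible here but
  not in the recursive form.\<close>

lemma balanced_iff:
  "balanced v \<longleftrightarrow> (\<forall>t. minuses (take t v) \<le> count_list (take t v) True)
     \<and> minuses v = count_list v True"
  using height_None[of 0 v] by (auto simp: balanced_def flip_minus_None_iff)

lemma balanced_mirror:
  assumes "balanced v" shows "balanced (mirror v)"
proof -
  have "minuses (take t (mirror v)) \<le> count_list (take t (mirror v)) True" for t
  proof -
    let ?s = "length v - t"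
    have "take t (mirror v) = mirror (drop ?s v)"
      by (simp add: mirror_def take_rev drop_map)
    moreover have *: "count_list (take ?s v) b + count_list (drop ?s v) b = count_list v b" for b
      using count_list_append[of "take ?s v" "drop ?s v" b] by simp
    have "minuses (take ?s v) \<le> count_list (take ?s v) True"
      "minuses v = count_list v True"
      using assms unfolding balanced_iff by blast+
    with *[of True] *[of False] have "count_list (drop ?s v) True \<le> minuses (drop ?s v)"
      by linarith
    ultimately show ?thesis by simp
  qed
  with assms show ?thesis unfolding balanced_iff by simp
qed

lemma balanced_even: "balanced v \<Longrightarrow> even (length v)"
proof -
  have "length v = count_list v True + minuses v" by (induction v) auto
  then show "balanced v \<Longrightarrow> even (length v)" by (simp add: balanced_iff)
qed

lemma balanced_flip_plus: "balanced v \<Longrightarrow> flip_plus h v = None"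
  by (simp add: flip_plus_def balanced_flip_minus balanced_mirror)

lemma flip_minus_split:
  "flip_minus h m = Some m' \<Longrightarrow>
     \<exists>u v. m = u @ False # v \<and> m' = u @ True # v \<and> flip_minus h u = None \<and> height h u = 0"
proof (induction h m arbitrary: m' rule: flip_minus.induct)
  case (2 h y)
  then obtain y' where "flip_minus (Suc h) y = Some y'" "m' = True # y'" by auto
  with 2 obtain u v where "y = u @ False # v" "y' = u @ True # v" "flip_minus (Suc h) u = None"
    "height (Suc h) u = 0" by blast
  then show ?case using \<open>m' = _\<close> by (intro exI[of _ "True # u"] exI[of _ v]) simp
next
  case (3 y)
  then show ?case by (intro exI[of _ "[]"] exI[of _ y]) simp
next
  case (4 h y)
  then obtain y' where "flip_minus h y = Some y'" "m' = False # y'" by auto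
  with 4 obtain u v where "y = u @ False # v" "y' = u @ True # v" "flip_minus h u = None"
    "height h u = 0" by blast
  then show ?case using \<open>m' = _\<close> by (intro exI[of _ "False # u"] exI[of _ v]) simp
qed auto

lemma flip_minus0_split:
  "flip_minus 0 m = Some m' \<Longrightarrow> \<exists>u v. m = u @ False # v \<and> m' = u @ True # v \<and> balanced u"
  using flip_minus_split[of 0] by (auto simp: balanced_def)

lemma flip_plus0_split:
  assumes "flip_plus 0 m = Some m'"
  shows "\<exists>u v. m = u @ True # v \<and> m' = u @ False # v \<and> balanced v"
proof -
  from assms obtain z where z: "flip_minus 0 (mirror m) = Some z" "m' = mirror z"
    by (auto simp: flip_plus_def)
  from flip_minus0_split[OF z(1)] obtain u v where
    uv: "mirror m = u @ False # v" "z = u @ True # v" "balanced u" by blast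
  then have "m = mirror (u @ False # v)" by (metis mirror_mirror)
  with uv z show ?thesis
    by (intro exI[of _ "mirror v"] exI[of _ "mirror u"]) (auto intro: balanced_mirror)
qed

lemma flip_plus_append:
  "flip_plus h (x @ m) = (case flip_plus h m of Some m' \<Rightarrow> Some (x @ m')
     | None \<Rightarrow> map_option (\<lambda>x'. x' @ m) (flip_plus (height h (mirror m)) x))"
  unfolding flip_plus_def mirror_simps flip_minus_append
  by (auto split: option.splits simp: option.map_comp o_def)

lemma flip_plus_Cons_balanced:
  "balanced v \<Longrightarrow> flip_plus h (u @ b # v) = map_option (\<lambda>x. x @ v) (flip_plus h (u @ [b]))"
  using flip_plus_append[of h "u @ [b]" v]
  by (simp add: balanced_flip_plus balanced_height balanced_mirror)

lemma flip_plus_snoc [simp]: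
  "flip_plus h [] = None"
  "flip_plus h (x @ [False]) = map_option (\<lambda>x'. x' @ [False]) (flip_plus (Suc h) x)"
  "flip_plus 0 (x @ [True]) = Some (x @ [False])"
  "flip_plus (Suc h) (x @ [True]) = map_option (\<lambda>x'. x' @ [True]) (flip_plus h x)"
  by (auto simp: flip_plus_def option.map_comp o_def)

lemma flip_plus_flip_plus:
  "Option.bind (flip_plus g y) (flip_plus (g + h)) =
   Option.bind (flip_plus (Suc (Suc (g + h))) y) (flip_plus g)"
proof -
  have *: "Option.bind (flip_plus a y) (flip_plus b) =
     map_option mirror (Option.bind (flip_minus a (mirror y)) (flip_minus b))" for a b
    by (auto simp: flip_plus_def split: Option.bind_splits)
  show ?thesis unfolding * flip_minus_flip_minus ..
qed

lemma flip_minus_length: "flip_minus h y = Some y' \<Longrightarrow> length y' = length y"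
  by (induction h y arbitrary: y' rule: flip_minus.induct) auto

lemma flip_plus_length: "flip_plus h y = Some y' \<Longrightarrow> length y' = length y"
  using flip_minus_length[of h "mirror y"] by (auto simp: flip_plus_def)

lemma flip_count:
  "flip_minus h y = Some y' \<Longrightarrow> minuses y = Suc (minuses y')"
  "flip_plus h y = Some y' \<Longrightarrow> minuses y' = Suc (minuses y)"
proof -
  show *: "flip_minus h y = Some y' \<Longrightarrow> minuses y = Suc (minuses y')" for h y y'
    using flip_minus_split[of h y y'] by auto
  assume "flip_plus h y = Some y'"
  then obtain z u v where z: "y' = mirror z" "mirror y = u @ False # v" "z = u @ True # v"
    using flip_minus_split[of h "mirror y"] by (auto simp: flip_plus_def)
  then have "y = mirror (u @ False # v)" by (metis mirror_mirror)
  with z show "minuses y' = Suc (minuses y)" by simp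
qed


section \<open>The action of the generators on words\<close>

definition opt :: "('a \<Rightarrow> 'r::zero) \<Rightarrow> 'a option \<Rightarrow> 'r" where
  "opt g x = (case x of None \<Rightarrow> 0 | Some y \<Rightarrow> g y)"

lemma opt_simps [simp]:
  "opt g None = 0" "opt g (Some y) = g y" "opt g (map_option h x) = opt (\<lambda>y. g (h y)) x"
  by (auto simp: opt_def split: option.splits)

lemma opt_mult: "c * opt f x = opt (\<lambda>y. c * f y) (x :: 'a option)" for f :: "'a \<Rightarrow> 'r::comm_ring_1"
  by (cases x) auto

text \<open>
  On cup diagrams \<open>e\<^sub>i\<close> is the cap at \<open>i\<close> followed by the cup at \<open>i\<close>. A cap joins the partners of the two signs it
  closes off, which flips one of them; it is \<open>0\<close> if it joins two unmatched equal signs. Linear maps act from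
  the right on functionals, so \<open>gen_act d i f\<close> is \<open>f \<circ> e\<^sub>i\<close>; the loop value of \<open>e\<^sub>i\<close> is \<open>d i\<close>.
\<close>

definition cap :: "(nat \<Rightarrow> 'r::comm_ring_1) \<Rightarrow> nat \<Rightarrow> (bool list \<Rightarrow> 'r) \<Rightarrow> bool list \<Rightarrow> 'r" where
  "cap d i g w = (case drop (i - 1) w of
      True # False # y \<Rightarrow> d i * g (take (i - 1) w @ y)
    | False # True # y \<Rightarrow> g (take (i - 1) w @ y)
    | True # True # y \<Rightarrow> opt (\<lambda>y'. g (take (i - 1) w @ y')) (flip_minus 0 y)
    | False # False # y \<Rightarrow> opt (\<lambda>x'. g (x' @ y)) (flip_plus 0 (take (i - 1) w))
    | _ \<Rightarrow> 0)"

definition cup :: "nat \<Rightarrow> bool list \<Rightarrow> bool list" where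
  "cup i z = take (i - 1) z @ True # False # drop (i - 1) z"

definition gen_act :: "(nat \<Rightarrow> 'r::comm_ring_1) \<Rightarrow> nat \<Rightarrow> (bool list \<Rightarrow> 'r) \<Rightarrow> bool list \<Rightarrow> 'r" where
  "gen_act d i f = cap d i (\<lambda>z. f (cup i z))"

lemma cap_simps:
  assumes "i = Suc (length x)"
  shows "cap d i g (x @ True # False # y) = d i * g (x @ y)"
    "cap d i g (x @ False # True # y) = g (x @ y)"
    "cap d i g (x @ True # True # y) = opt (\<lambda>y'. g (x @ y')) (flip_minus 0 y)"
    "cap d i g (x @ False # False # y) = opt (\<lambda>x'. g (x' @ y)) (flip_plus 0 x)"
  using assms by (simp_all add: cap_def)

lemma cup_append: "i = Suc (length x) \<Longrightarrow> cup i (x @ y) = x @ True # False # y"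
  by (simp add: cup_def)

lemma word_split:
  assumes "1 \<le> i" "i < length w"
  obtains x a b y where "w = x @ a # b # y" "i = Suc (length x)"
proof -
  have "w = take (i - 1) w @ w ! (i - 1) # w ! i # drop (Suc i) w"
    using assms by (metis Cons_nth_drop_Suc One_nat_def Suc_diff_1 append_take_drop_id
        less_eq_Suc_le less_imp_diff_less order_less_le_trans)
  with assms that[of "take (i - 1) w"] show thesis by simp
qed

lemma gen_act_simps:
  assumes "i = Suc (length x)"
  shows "gen_act d i f (x @ True # False # y) = d i * f (x @ True # False # y)"
    "gen_act d i f (x @ False # True # y) = f (x @ True # False # y)"
    "gen_act d i f (x @ True # True # y) = opt (\<lambda>y'. f (x @ True # False # y')) (flip_minus 0 y)"
    "gen_act d i f (x @ False # False # y) = opt (\<lambda>x'. f (x' @ True # False # y)) (flip_plus 0 x)"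
  using assms unfolding gen_act_def cap_simps[OF assms]
  by (auto simp: opt_def cup_def dest: flip_plus_length split: option.splits)

section \<open>Loop and zigzag relations\<close>

lemma gen_act_square:
  assumes "1 \<le> i" "i < length w"
  shows "gen_act d i (gen_act d i f) w = d i * gen_act d i f w"
proof -
  obtain x a b y where w: "w = x @ a # b # y" "i = Suc (length x)" using word_split[OF assms] .
  show ?thesis unfolding w(1)
    by (cases a; cases b) (auto simp: gen_act_simps w(2) opt_def dest: flip_plus_length split: option.splits)
qed

text \<open>Straightening of a snake: the cap joins sign \<open>i\<close> to one end of the new cup,
  and the other end takes over the value of that sign.\<close>

lemma cap_cup_Suc:
  assumes "1 \<le> i" "i \<le> length z"
  shows "cap d i g (cup (Suc i) z) = g z"
proof -
  obtain x b y where z: "z = x @ b # y" "i = Suc (length x)"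
    using id_take_nth_drop[of "i - 1" z] assms that[of "take (i - 1) z" "z ! (i - 1)" "drop i z"] by simp
  have "cup (Suc i) z = x @ b # True # False # y"
    using cup_append[of "Suc i" "x @ [b]" y] z by simp
  with z show ?thesis by (cases b) (simp_all add: cap_simps)
qed

lemma cap_Suc_cup:
  assumes "1 \<le> i" "i \<le> length z"
  shows "cap d (Suc i) g (cup i z) = g z"
proof -
  obtain x b y where z: "z = x @ b # y" "i = Suc (length x)"
    using id_take_nth_drop[of "i - 1" z] assms that[of "take (i - 1) z" "z ! (i - 1)" "drop i z"] by simp
  have "cap d (Suc i) g (x @ True # False # b # y) = g (x @ b # y)"
    using z(2) cap_simps(2,4)[of "Suc i" "x @ [True]" d g y] by (cases b) simp_all
  then show ?thesis using z cup_append[of i x "b # y"] by simp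
qed

lemma length_cup [simp]: "length (cup i z) = length z + 2"
  by (simp add: cup_def)

text \<open>Every cap removes one plus and one minus in total: if it joins equal signs, the flip
  compensates for the second one. Adding a cup restores both, so the spaces \<open>M_k\<close> are
  stable.\<close>

lemma cap_cong:
  assumes "1 \<le> i" and "\<And>z. length z + 2 = length w \<Longrightarrow> minuses w = Suc (minuses z) \<Longrightarrow> g z = g' z"
  shows "cap d i g w = cap d i g' w"
proof -
  have *: "cap d i g w = cap d i g' w" if "i = Suc (length x)" "w = x @ a # b # y" for x a b y
  proof -
    have "opt (\<lambda>y'. g (x @ y')) (flip_minus 0 y) = opt (\<lambda>y'. g' (x @ y')) (flip_minus 0 y)"
      if "w = x @ True # True # y"
      by (cases "flip_minus 0 y") (auto intro!: assms(2) simp: that flip_minus_length flip_count(1))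
    moreover have "opt (\<lambda>x'. g (x' @ y)) (flip_plus 0 x) = opt (\<lambda>x'. g' (x' @ y)) (flip_plus 0 x)"
      if "w = x @ False # False # y"
      by (cases "flip_plus 0 x") (auto intro!: assms(2) simp: that flip_plus_length flip_count(2))
    moreover have "g (x @ y) = g' (x @ y)" if "a \<noteq> b"
      using assms(2)[of "x @ y"] that \<open>w = _\<close> by (cases a; cases b) auto
    ultimately show ?thesis using that by (cases a; cases b) (simp_all add: cap_simps)
  qed
  show ?thesis
  proof (cases "1 \<le> i \<and> i < length w")
    case True
    then obtain x a b y where "w = x @ a # b # y" "i = Suc (length x)"
      using word_split[of i w] by blast
    then show ?thesis by (intro *)
  next
    case False
    with assms(1) have len: "length w \<le> i" by linarith
    show ?thesis
    proof (cases "drop (i - 1) w")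
      case (Cons b l)
      have "Suc (length l) = length w - (i - 1)"
        using length_drop[of "i - 1" w] unfolding Cons by simp
      with len assms(1) have "length l = 0" by linarith
      then have "l = []" by simp
      with Cons show ?thesis by (cases b) (simp_all add: cap_def del: drop_eq_Nil)
    qed (simp add: cap_def del: drop_eq_Nil)
  qed
qed

lemma gen_act_zigzag:
  assumes "1 \<le> i" "Suc i < length w"
  shows "gen_act d i (gen_act d (Suc i) (gen_act d i f)) w = gen_act d i f w"
    and "gen_act d (Suc i) (gen_act d i (gen_act d (Suc i) f)) w = gen_act d (Suc i) f w"
proof -
  have 1: "gen_act d (Suc i) (gen_act d i f) (cup i z) = f (cup i z)" if "i \<le> length z" for z
    using cap_cup_Suc[OF assms(1) that, of d "\<lambda>z. f (cup i z)"]
      cap_Suc_cup[OF assms(1) that, of d "\<lambda>z. gen_act d i f (cup (Suc i) z)"]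
    by (simp only: gen_act_def)
  have 2: "gen_act d i (gen_act d (Suc i) f) (cup (Suc i) z) = f (cup (Suc i) z)" if "i \<le> length z" for z
    using cap_Suc_cup[OF assms(1) that, of d "\<lambda>z. f (cup (Suc i) z)"]
      cap_cup_Suc[OF assms(1) that, of d "\<lambda>z. gen_act d (Suc i) f (cup i z)"]
    by (simp only: gen_act_def)
  have "cap d i (\<lambda>z. gen_act d (Suc i) (gen_act d i f) (cup i z)) w = cap d i (\<lambda>z. f (cup i z)) w"
    by (rule cap_cong[OF assms(1)], rule 1) (use assms in linarith)
  then show "gen_act d i (gen_act d (Suc i) (gen_act d i f)) w = gen_act d i f w"
    by (simp only: gen_act_def)
  have "cap d (Suc i) (\<lambda>z. gen_act d i (gen_act d (Suc i) f) (cup (Suc i) z)) w =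
      cap d (Suc i) (\<lambda>z. f (cup (Suc i) z)) w"
    by (rule cap_cong, simp, rule 2) (use assms in linarith)
  then show "gen_act d (Suc i) (gen_act d i (gen_act d (Suc i) f)) w = gen_act d (Suc i) f w"
    by (simp only: gen_act_def)
qed

section \<open>Commutation of distant generators\<close>

lemma opt_cong: "x = y \<Longrightarrow> (\<And>z. y = Some z \<Longrightarrow> f z = g z) \<Longrightarrow> opt f x = opt g y"
  by (cases y) auto

lemma opt_bind: "opt f (Option.bind x g) = opt (\<lambda>y. opt f (g y)) x"
  by (cases x) auto

lemma opt_swap:
  "Option.bind x g = Option.bind y h \<Longrightarrow> opt (\<lambda>z. opt f (g z)) x = opt (\<lambda>z. opt f (h z)) y"
  by (metis opt_bind)

lemma flip_minus_split_fail:
  assumes "flip_minus 0 m = None" "height 0 m = Suc q"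
  obtains u v where "m = u @ True # v" "balanced v" "flip_minus 0 u = None" "height 0 u = q"
proof -
  have "flip_plus 0 m \<noteq> None"
  proof
    assume "flip_plus 0 m = None"
    then have "flip_minus 0 (mirror m) = None" by (simp add: flip_plus_def)
    from height_None[OF this] height_None[OF assms(1)] assms(2) show False by simp
  qed
  then obtain m' where "flip_plus 0 m = Some m'" by blast
  from flip_plus0_split[OF this] obtain u v where uv: "m = u @ True # v" "balanced v" by blast
  with assms have "flip_minus 0 u = None" by (auto simp: flip_minus_append split: option.splits)
  moreover from this uv assms have "height 0 u = q"
    by (auto simp: height_append balanced_height)
  ultimately show thesis using uv that by blast
qed

lemma balanced_of_fail:
  assumes "flip_minus 0 m = None" "flip_plus 0 m = None"
  shows "balanced m"
proof (cases "height 0 m")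
  case 0
  with assms show ?thesis by (simp add: balanced_def)
next
  case (Suc q)
  obtain u v where "m = u @ True # v" "balanced v" using flip_minus_split_fail[OF assms(1) Suc] .
  with assms(2) show ?thesis by (simp add: flip_plus_Cons_balanced)
qed

lemma flip_plus_split_fail:
  assumes "flip_plus 0 m = None" "height 0 (mirror m) = Suc q"
  obtains u v where "m = u @ False # v" "balanced u" "flip_plus 0 v = None" "height 0 (mirror v) = q"
proof -
  have "flip_minus 0 (mirror m) = None" using assms(1) by (simp add: flip_plus_def)
  from flip_minus_split_fail[OF this assms(2)] obtain u v where
    uv: "mirror m = u @ True # v" "balanced v" "flip_minus 0 u = None" "height 0 u = q" .
  from uv(1) have "m = mirror (u @ True # v)" by (metis mirror_mirror)
  with uv that[of "mirror v" "mirror u"] show thesis by (simp add: balanced_mirror flip_plus_def)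
qed

lemma flip_plus_snoc2:
  "flip_plus h (x @ [True, False]) = map_option (\<lambda>x'. x' @ [True, False]) (flip_plus h x)"
  "flip_plus h (x @ [False, False]) = map_option (\<lambda>x'. x' @ [False, False]) (flip_plus (Suc (Suc h)) x)"
  "flip_plus 0 (x @ [b, True]) = Some (x @ [b, False])"
  "flip_plus (Suc h) (x @ [False, True]) = map_option (\<lambda>x'. x' @ [False, True]) (flip_plus (Suc h) x)"
  "flip_plus (Suc 0) (x @ [True, True]) = Some (x @ [False, True])"
  "flip_plus (Suc (Suc h)) (x @ [True, True]) = map_option (\<lambda>x'. x' @ [True, True]) (flip_plus h x)"
  using flip_plus_snoc(2)[of h "x @ [True]"] flip_plus_snoc(2)[of h "x @ [False]"]
    flip_plus_snoc(3)[of "x @ [b]"] flip_plus_snoc(4)[of h "x @ [False]"]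
    flip_plus_snoc(4)[of 0 "x @ [True]"] flip_plus_snoc(4)[of "Suc h" "x @ [True]"]
  by (simp_all add: option.map_comp o_def)

lemma flip_plus_append2:
  "flip_plus h (x @ True # False # m) = (case flip_plus h m of Some m' \<Rightarrow> Some (x @ True # False # m')
     | None \<Rightarrow> map_option (\<lambda>x'. x' @ True # False # m) (flip_plus (height h (mirror m)) x))"
  "flip_plus h (x @ False # False # m) = (case flip_plus h m of Some m' \<Rightarrow> Some (x @ False # False # m')
     | None \<Rightarrow> map_option (\<lambda>x'. x' @ False # False # m) (flip_plus (Suc (Suc (height h (mirror m)))) x))"
  "flip_plus h (x @ False # True # m) = (case flip_plus h m of Some m' \<Rightarrow> Some (x @ False # True # m')
     | None \<Rightarrow> (case height h (mirror m) of 0 \<Rightarrow> Some (x @ False # False # m)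
        | Suc k \<Rightarrow> map_option (\<lambda>x'. x' @ False # True # m) (flip_plus (Suc k) x)))"
  "flip_plus h (x @ True # True # m) = (case flip_plus h m of Some m' \<Rightarrow> Some (x @ True # True # m')
     | None \<Rightarrow> (case height h (mirror m) of 0 \<Rightarrow> Some (x @ True # False # m)
        | Suc 0 \<Rightarrow> Some (x @ False # True # m)
        | Suc (Suc k) \<Rightarrow> map_option (\<lambda>x'. x' @ True # True # m) (flip_plus k x)))"
  using flip_plus_append[of h "x @ [True, False]" m] flip_plus_append[of h "x @ [False, False]" m]
    flip_plus_append[of h "x @ [False, True]" m] flip_plus_append[of h "x @ [True, True]" m]
  by (simp_all add: flip_plus_snoc2 option.map_comp o_def split: option.split nat.split)

text \<open>A cap on \<open>+ +\<close> looks for a sign on its right, a cap on \<open>- -\<close>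
  for one on its left; all other caps are local. The cases record which of the two generators looks
  towards the other one: neither, the left one only, the right one only, or both.\<close>

lemma gen_act_commute_aux:
  assumes d: "\<And>i. d (Suc (Suc i)) = d i" and ij: "i = Suc (length x)" "j = Suc (length x + 2 + length m)"
  shows "gen_act d i (gen_act d j f) (x @ a # b # m @ c # e # y) =
    gen_act d j (gen_act d i f) (x @ a # b # m @ c # e # y)"
proof -
  have j: "j = Suc (length (x @ p # q # m))" for p q using ij by simp
  have simp_j: "gen_act d j f (x' @ p # q # m' @ True # False # y) = d j * f (x' @ p # q # m' @ True # False # y)"
    "gen_act d j f (x' @ p # q # m' @ False # True # y) = f (x' @ p # q # m' @ True # False # y)"
    "gen_act d j f (x' @ p # q # m' @ True # True # y) =
       opt (\<lambda>y'. f (x' @ p # q # m' @ True # False # y')) (flip_minus 0 y)"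
    "gen_act d j f (x' @ p # q # m' @ False # False # y) =
       opt (\<lambda>x''. f (x'' @ True # False # y)) (flip_plus 0 (x' @ p # q # m'))"
    if "length x' = length x" "length m' = length m" for f x' p q m' y
    using gen_act_simps[where i=j and x="x' @ p # q # m'"] that ij by simp_all
  have simp_i: "gen_act d i f (x' @ True # False # y) = d i * f (x' @ True # False # y)"
    "gen_act d i f (x' @ False # True # y) = f (x' @ True # False # y)"
    "gen_act d i f (x' @ True # True # y) =
       opt (\<lambda>y'. f (x' @ True # False # y')) (flip_minus 0 y)"
    "gen_act d i f (x' @ False # False # y) =
       opt (\<lambda>x''. f (x'' @ True # False # y)) (flip_plus 0 x')"
    if "length x' = length x" for f x' p q y
    using gen_act_simps[where i=i and x="x'"] that ij by simp_all
  consider "(a, b) \<noteq> (True, True)" "(c, e) \<noteq> (False, False)"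
    | "a" "b" "(c, e) \<noteq> (False, False)" | "(a, b) \<noteq> (True, True)" "\<not> c" "\<not> e"
    | "a" "b" "\<not> c" "\<not> e" by auto
  then show ?thesis
  proof cases
    case 1
    then show ?thesis
      by (cases a; cases b; cases c; cases e)
        (auto simp: simp_i simp_j opt_def flip_plus_length split: option.splits)
  next
    case 2
    show ?thesis
    proof (cases "flip_minus 0 m")
      case None
      then show ?thesis using 2
        by (cases c; cases e; cases "height 0 m")
          (auto simp: simp_i simp_j flip_minus_append opt_mult
            intro!: opt_swap simp: flip_minus_flip_minus[of 0, simplified] intro: opt_cong)
    next
      case (Some m')
      then show ?thesis using 2
        by (cases c; cases e) (auto simp: simp_i simp_j flip_minus_append flip_minus_length)
    qed
  next
    case 3
    show ?thesis
    proof (cases "flip_plus 0 m")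
      case None
      from 3 consider "a" "\<not> b" | "\<not> a" "b" | "\<not> a" "\<not> b" by auto
      then show ?thesis
      proof cases
        case 1
        with 3 None show ?thesis
          by (auto simp: simp_i simp_j flip_plus_append2 opt_mult flip_plus_length intro!: opt_cong)
      next
        case 2
        with 3 None show ?thesis
          by (cases "height 0 (mirror m)")
            (auto simp: simp_i simp_j flip_plus_append2 flip_plus_length intro!: opt_cong)
      next
        case 3
        define P where "P = height 0 (mirror m)"
        have *: "opt (\<lambda>x'. gen_act d j f (x' @ True # False # m @ False # False # y)) (flip_plus 0 x) =
           opt (\<lambda>x'. opt (\<lambda>x''. f (x'' @ True # False # m @ True # False # y)) (flip_plus P x')) (flip_plus 0 x)"
          using None
          by (intro opt_cong) (simp_all add: simp_j flip_plus_append2 flip_plus_length P_def)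
        show ?thesis using 3 \<open>\<not> c\<close> \<open>\<not> e\<close> None
          using opt_swap[OF flip_plus_flip_plus[of 0 x P, simplified],
              of "\<lambda>x''. f (x'' @ True # False # m @ True # False # y)"]
          by (auto simp: simp_i * simp_j flip_plus_append2 P_def[symmetric] flip_plus_length intro!: opt_cong)
      qed
    next
      case (Some m')
      then show ?thesis using 3
        by (cases a; cases b)
          (auto simp: simp_i simp_j flip_plus_append2 flip_plus_length opt_def split: option.splits)
    qed
  next
    case 4
    note rules = simp_i simp_j flip_plus_append2 flip_minus_append height_append
      balanced_flip_plus balanced_flip_minus balanced_height balanced_mirror
    show ?thesis
    proof (cases "flip_minus 0 m")
      case fm: None
      show ?thesis
      proof (cases "flip_plus 0 m")
        case None
        with fm have m: "balanced m" by (rule balanced_of_fail)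
        \<comment> \<open>The two caps reach each other, and the two orders of composition close a
          loop at \<open>j\<close> and at \<open>i\<close> respectively. The colours agree because
          the completely matched word \<open>m\<close> between them has even length.\<close>
        have "d (n + 2 * k) = d n" for n k
          by (induction k) (simp_all add: d)
        from this[of i "Suc (length m div 2)"] have "d j = d i"
          using ij balanced_even[OF m] by (auto elim!: evenE simp: algebra_simps)
        with 4 m show ?thesis by (simp add: rules)
      next
        case (Some m'')
        then obtain u v where uv: "m = u @ True # v" "m'' = u @ False # v" "balanced v"
          using flip_plus0_split by blast
        with fm have u: "flip_minus 0 u = None" by (auto simp: flip_minus_append split: option.splits)
        have len: "length m'' = length m" using Some flip_plus_length by blast
        have hm: "height 0 m = Suc (height 0 u)" "height 0 m'' = height 0 u - 1"
          unfolding uv(1,2) by (simp_all add: height_append balanced_height uv(3))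
        have fm'': "flip_minus 0 m'' = (if height 0 u = 0 then Some m else None)"
          unfolding uv(1,2) using u uv(3)
          by (cases "height 0 u") (simp_all add: flip_minus_append balanced_flip_minus)
        show ?thesis using 4 fm Some hm fm'' len
          by (cases "height 0 u") (auto simp: rules opt_def split: option.splits)
      qed
    next
      case (Some m')
      have len: "length m' = length m" using Some flip_minus_length by blast
      show ?thesis
      proof (cases "flip_plus 0 m")
        case None
        show ?thesis
        proof (cases "height 0 (mirror m)")
          case 0
          with None have "balanced (mirror m)" by (simp add: balanced_def flip_plus_def)
          from balanced_mirror[OF this] Some show ?thesis by (simp add: balanced_def)
        next
          case (Suc p)
          then obtain u v where uv: "m = u @ False # v" "balanced u" "flip_plus 0 v = None"
            "height 0 (mirror v) = p" using flip_plus_split_fail[OF None] by blast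
          have m': "m' = u @ True # v" using Some uv
            by (simp add: flip_minus_append balanced_flip_minus balanced_height)
          have hm': "height 0 (mirror m') = p - 1"
            unfolding m' using uv by (simp add: height_append balanced_height balanced_mirror)
          have fm': "flip_plus 0 m' = (if p = 0 then Some m else None)"
            unfolding m' using uv flip_plus_append[of 0 "u @ [True]" v]
            by (cases p) (simp_all add: balanced_flip_plus)
          show ?thesis using 4 None Some Suc hm' fm' len
            by (cases p) (auto simp: rules opt_def flip_plus_length split: option.splits)
        qed
      next
        case fp: (Some m'')
        then obtain u v where uv: "m = u @ True # v" "m'' = u @ False # v" "balanced v"
          using flip_plus0_split by blast
        have len': "length m'' = length m" using fp flip_plus_length by blast
        obtain u' where u': "flip_minus 0 u = Some u'" "m' = u' @ True # v"
          using Some uv by (auto simp: flip_minus_append balanced_flip_minus split: option.splits)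
        have "flip_plus 0 m' = Some (u' @ False # v)" "flip_minus 0 m'' = Some (u' @ False # v)"
          using u' uv by (simp_all add: flip_plus_Cons_balanced flip_minus_append)
        with 4 fp Some len len' show ?thesis by (simp add: rules)
      qed
    qed
  qed
qed

lemma gen_act_commute:
  assumes "\<And>i. d (Suc (Suc i)) = d i" "1 \<le> i" "Suc i < j" "j < length w"
  shows "gen_act d i (gen_act d j f) w = gen_act d j (gen_act d i f) w"
proof -
  have "i < length w" using assms by simp
  then obtain x a b z where w: "w = x @ a # b # z" "i = Suc (length x)"
    using word_split[of i w] assms(2) by metis
  have "1 \<le> j - i - 1" "j - i - 1 < length z" using assms w by simp_all
  then obtain m c e y where z: "z = m @ c # e # y" "j - i - 1 = Suc (length m)"
    using word_split[of "j - i - 1" z] by metis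
  with w assms(3) have "j = Suc (length x + 2 + length m)" by simp
  from gen_act_commute_aux[of d, OF assms(1) w(2) this] show ?thesis unfolding w(1) z(1) .
qed


section \<open>Rewriting words\<close>

fun word_act :: "(nat \<Rightarrow> 'r::comm_ring_1) \<Rightarrow> nat list \<Rightarrow> (bool list \<Rightarrow> 'r) \<Rightarrow> bool list \<Rightarrow> 'r" where
  "word_act d [] f = f"
| "word_act d (i # u) f = word_act d u (gen_act d i f)"

lemma word_act_append: "word_act d (u @ v) f = word_act d v (word_act d u f)"
  by (induction u arbitrary: f) auto

lemma opt_linear:
  "opt (\<lambda>x. f x + g x) y = opt f y + opt g (y :: 'a option)" "opt (\<lambda>x. c * f x) y = c * opt f y"
  for f :: "'a \<Rightarrow> 'r::comm_ring_1"
  by (cases y; simp)+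

lemma cap_linear:
  "cap d i (\<lambda>x. f x + g x) w = cap d i f w + cap d i g w"
  "cap d i (\<lambda>x. c * f x) w = c * cap d i f w"
  by (auto simp: cap_def opt_linear algebra_simps split: list.splits bool.splits)

lemma gen_act_linear:
  "gen_act d i (\<lambda>x. f x + g x) w = gen_act d i f w + gen_act d i g w"
  "gen_act d i (\<lambda>x. c * f x) w = c * gen_act d i f w"
  by (simp_all add: gen_act_def cap_linear)

lemma word_act_linear:
  "word_act d u (\<lambda>x. f x + g x) w = word_act d u f w + word_act d u g w"
  "word_act d u (\<lambda>x. c * f x) w = c * word_act d u f w"
  by (induction u arbitrary: f g) (simp_all add: gen_act_linear[abs_def])

lemma word_act_zero [simp]: "word_act d u (\<lambda>x. 0) w = 0"
  using word_act_linear(2)[of d u 0 "\<lambda>x. 0" w] by simp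

lemma word_act_sum: "word_act d u (\<lambda>x. \<Sum>a\<in>A. f a x) w = (\<Sum>a\<in>A. word_act d u (f a) w)"
  by (induction A rule: infinite_finite_induct) (simp_all add: word_act_linear)

lemma count_cup [simp]: "minuses (cup i z) = Suc (minuses z)"
  using count_list_append[of "take (i - 1) z" "drop (i - 1) z" False] by (simp add: cup_def)

lemma gen_act_cong:
  assumes "1 \<le> i"
    and "\<And>z. length z = length w \<Longrightarrow> minuses z = minuses w \<Longrightarrow> f z = g z"
  shows "gen_act d i f w = gen_act d i g w"
  unfolding gen_act_def using assms by (intro cap_cong) auto

lemma word_act_cong:
  assumes "0 \<notin> set u"
    and "\<And>z. length z = length w \<Longrightarrow> minuses z = minuses w \<Longrightarrow> f z = g z"
  shows "word_act d u f w = word_act d u g w"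
  using assms
proof (induction u arbitrary: f g)
  case (Cons i u)
  show ?case unfolding word_act.simps
    using Cons.prems by (intro Cons.IH gen_act_cong) auto
qed auto

text \<open>\<open>red d n u c v\<close>: the word \<open>u\<close> equals \<open>c v\<close> modulo the relations.\<close>

inductive red :: "(nat \<Rightarrow> 'r::comm_ring_1) \<Rightarrow> nat \<Rightarrow> nat list \<Rightarrow> 'r \<Rightarrow> nat list \<Rightarrow> bool"
  for d n where
  self: "red d n u 1 u"
| chain: "red d n u c v \<Longrightarrow> red d n v c' w \<Longrightarrow> red d n u (c * c') w"
| squared: "set (x @ [i] @ y) \<subseteq> {1..<n} \<Longrightarrow> red d n (x @ [i, i] @ y) (d i) (x @ [i] @ y)"
| far: "set (x @ [i, j] @ y) \<subseteq> {1..<n} \<Longrightarrow> i + 1 < j \<or> j + 1 < i \<Longrightarrow>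
    red d n (x @ [i, j] @ y) 1 (x @ [j, i] @ y)"
| zig: "set (x @ [i, j] @ y) \<subseteq> {1..<n} \<Longrightarrow> j = i + 1 \<or> i = j + 1 \<Longrightarrow>
    red d n (x @ [i, j, i] @ y) 1 (x @ [i] @ y)"
| zag: "set (x @ [i, j] @ y) \<subseteq> {1..<n} \<Longrightarrow> j = i + 1 \<or> i = j + 1 \<Longrightarrow>
    red d n (x @ [i] @ y) 1 (x @ [i, j, i] @ y)"

lemma red_context:
  assumes "red d n u c v" "set x \<subseteq> {1..<n}" "set y \<subseteq> {1..<n}"
  shows "red d n (x @ u @ y) c (x @ v @ y)"
  using assms(1)
proof induction
  case (squared x' i y')
  then show ?case using red.squared[of "x @ x'" i "y' @ y" n d] assms(2,3) by simp
next
  case (far x' i j y')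
  then show ?case using red.far[of "x @ x'" i j "y' @ y" n d] assms(2,3) by simp
next
  case (zig x' i j y')
  then show ?case using red.zig[of "x @ x'" i j "y' @ y" n d] assms(2,3) by simp
next
  case (zag x' i j y')
  then show ?case using red.zag[of "x @ x'" i j "y' @ y" n d] assms(2,3) by simp
qed (auto intro: red.self red.chain)

lemma red_rev: "red d n u c v \<Longrightarrow> red d n (rev u) c (rev v)"
proof (induction rule: red.induct)
  case (squared x i y)
  then show ?case using red.squared[of "rev y" i "rev x" n d] by simp
next
  case (far x i j y)
  then show ?case using red.far[of "rev y" j i "rev x" n d] by auto
next
  case (zig x i j y)
  then show ?case using red.zig[of "rev y" i j "rev x" n d] by simp
next
  case (zag x i j y)
  then show ?case using red.zag[of "rev y" i j "rev x" n d] by simp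
qed (auto intro: red.self red.chain)

text \<open>The relations involve nonempty words only, which makes the coefficient of the empty word
  a function on the quotient algebra.\<close>

lemma red_Nil: "red d n u c v \<Longrightarrow> (u = [] \<longleftrightarrow> v = []) \<and> (u = [] \<longrightarrow> c = 1)"
  by (induction rule: red.induct) auto

lemma red_set: "red d n u c v \<Longrightarrow> set u \<subseteq> {1..<n} \<Longrightarrow> set v \<subseteq> {1..<n}"
  by (induction rule: red.induct) auto

lemma gen_act_zigzag_sym:
  assumes "1 \<le> i" "i < length w" "1 \<le> j" "j < length w" "j = i + 1 \<or> i = j + 1"
  shows "gen_act d i (gen_act d j (gen_act d i f)) w = gen_act d i f w"
  using assms(5)
proof
  assume "j = i + 1" then show ?thesis using gen_act_zigzag(1)[of i w d f] assms by simp
next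
  assume "i = j + 1" then show ?thesis using gen_act_zigzag(2)[of j w d f] assms by simp
qed

lemma word_act_red:
  assumes d: "\<And>i. d (Suc (Suc i)) = d i"
  shows "red d n u c v \<Longrightarrow> length w = n \<Longrightarrow> word_act d u f w = c * word_act d v f w"
proof (induction rule: red.induct)
  case (squared x i y)
  have "word_act d y (gen_act d i (gen_act d i g)) w = word_act d y (\<lambda>w. d i * gen_act d i g w) w" for g
    using squared by (intro word_act_cong) (auto simp: gen_act_square)
  then show ?case by (simp add: word_act_append word_act_linear)
next
  case (far x i j y)
  have "word_act d y (gen_act d j (gen_act d i g)) w = word_act d y (gen_act d i (gen_act d j g)) w" for g
    using far(2)
  proof
    assume "i + 1 < j"
    then show ?thesis
      using far gen_act_commute[of d i j, OF d] by (intro word_act_cong) (auto simp: eq_commute)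
  next
    assume "j + 1 < i"
    then show ?thesis
      using far gen_act_commute[of d j i, OF d] by (intro word_act_cong) (auto simp: eq_commute)
  qed
  then show ?case by (simp add: word_act_append)
next
  case (zig x i j y)
  have "word_act d y (gen_act d i (gen_act d j (gen_act d i g))) w = word_act d y (gen_act d i g) w" for g
    using zig by (intro word_act_cong gen_act_zigzag_sym) auto
  then show ?case by (simp add: word_act_append)
next
  case (zag x i j y)
  have "word_act d y (gen_act d i (gen_act d j (gen_act d i g))) w = word_act d y (gen_act d i g) w" for g
    using zag by (intro word_act_cong gen_act_zigzag_sym) auto
  then show ?case by (simp add: word_act_append)
qed auto


section \<open>Normal words\<close>

text \<open>
  A cup diagram is encoded by the positions \<open>cs\<close> of its cups, removed one after the other from the left,
  each position being counted in the remaining word. The word \<open>slide 0 cs\<close> moves the cups from the positions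
  \<open>1, 3, 5, \<dots>\<close> to their places, so that \<open>normal_word cs cs'\<close> is the diagram with top \<open>cs\<close> and bottom \<open>cs'\<close>.
\<close>

fun admissible :: "nat \<Rightarrow> nat list \<Rightarrow> bool" where
  "admissible L [] \<longleftrightarrow> True"
| "admissible L (c # cs) \<longleftrightarrow> 1 \<le> c \<and> c < L \<and> admissible (L - 2) cs \<and> (cs \<noteq> [] \<longrightarrow> c \<le> Suc (hd cs))"

fun slide :: "nat \<Rightarrow> nat list \<Rightarrow> nat list" where
  "slide s [] = []"
| "slide s (c # cs) = rev [s + 2..<Suc (s + c)] @ slide (s + 2) cs"

fun cup_gens :: "nat \<Rightarrow> nat \<Rightarrow> nat list" where
  "cup_gens s 0 = []"
| "cup_gens s (Suc k) = Suc s # cup_gens (s + 2) k"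

definition normal_word :: "nat list \<Rightarrow> nat list \<Rightarrow> nat list" where
  "normal_word cs cs' = slide 0 cs @ cup_gens 0 (length cs) @ rev (slide 0 cs')"

section \<open>Reduction to normal words\<close>

lemma red_trans1 [trans]: "red d n u 1 v \<Longrightarrow> red d n v c w \<Longrightarrow> red d n u c w"
  using red.chain[of d n u 1 v c w] by simp

lemma red_trans2: "red d n u c v \<Longrightarrow> red d n v 1 w \<Longrightarrow> red d n u c w"
  using red.chain[of d n u c v 1 w] by simp

lemma red_step1: "red d n u 1 v \<Longrightarrow> red d n v' c w' \<Longrightarrow> v = v' \<Longrightarrow> w' = w \<Longrightarrow> red d n u c w"
  using red_trans1 by blast

lemma red_step2: "red d n u c v \<Longrightarrow> red d n v' 1 w' \<Longrightarrow> v = v' \<Longrightarrow> w' = w \<Longrightarrow> red d n u c w"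
  using red_trans2 by blast

lemma red_swap1:
  assumes "\<forall>j\<in>set v. i + 1 < j \<or> j + 1 < i" "set (x @ i # v @ y) \<subseteq> {1..<n}"
  shows "red d n (x @ i # v @ y) 1 (x @ v @ i # y)"
  using assms
proof (induction v arbitrary: x)
  case (Cons j v)
  have "red d n (x @ [i, j] @ v @ y) 1 (x @ [j, i] @ v @ y)"
    using Cons.prems by (intro red.far) auto
  moreover have "red d n ((x @ [j]) @ i # v @ y) 1 ((x @ [j]) @ v @ i # y)"
    using Cons.prems by (intro Cons.IH) auto
  ultimately have "red d n (x @ [i, j] @ v @ y) 1 (x @ (j # v) @ i # y)"
    by (rule red_step1) simp_all
  then show ?case by simp
qed (simp add: red.self)

lemma red_swap:
  assumes "\<forall>i\<in>set u. \<forall>j\<in>set v. i + 1 < j \<or> j + 1 < i" "set (x @ u @ v @ y) \<subseteq> {1..<n}"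
  shows "red d n (x @ u @ v @ y) 1 (x @ v @ u @ y)"
  using assms
proof (induction u arbitrary: y rule: rev_induct)
  case (snoc i u)
  have "red d n ((x @ u) @ i # v @ y) 1 ((x @ u) @ v @ i # y)"
    using snoc.prems by (intro red_swap1) auto
  moreover have "red d n (x @ u @ v @ i # y) 1 (x @ v @ u @ i # y)"
    using snoc.prems by (intro snoc.IH) auto
  ultimately have "red d n ((x @ u) @ i # v @ y) 1 (x @ v @ (u @ [i]) @ y)"
    by (rule red_step1) simp_all
  then show ?case by simp
qed (simp add: red.self)

text \<open>The letter \<open>i\<close> moves right past all letters above \<open>i + 1\<close> and
  meets \<open>i + 1, i\<close>; the zigzag relation then removes two letters and splits the
  descending run.\<close>

lemma red_absorb:
  assumes "1 \<le> a" "a \<le> i" "Suc i < b" "b \<le> n"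
  shows "red d n (i # rev [a..<b]) 1 (rev [i + 2..<b] @ rev [a..<Suc i])"
proof -
  have "[a..<b] = [a..<i] @ [i, Suc i] @ [i + 2..<b]"
    using assms upt_add_eq_append[of a i "b - i"] upt_conv_Cons[of i b] upt_conv_Cons[of "Suc i" b] by simp
  then have eq: "rev [a..<b] = rev [i + 2..<b] @ [Suc i, i] @ rev [a..<i]" by simp
  have "red d n ([] @ i # rev [i + 2..<b] @ ([Suc i, i] @ rev [a..<i])) 1
      ([] @ rev [i + 2..<b] @ i # ([Suc i, i] @ rev [a..<i]))"
    using assms by (intro red_swap1) auto
  moreover have "red d n (rev [i + 2..<b] @ [i, Suc i, i] @ rev [a..<i]) 1 (rev [i + 2..<b] @ [i] @ rev [a..<i])"
    using assms by (intro red.zig) auto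
  ultimately have "red d n ([] @ i # rev [i + 2..<b] @ ([Suc i, i] @ rev [a..<i])) 1
      (rev [i + 2..<b] @ rev [a..<Suc i])"
    using assms(2) by (elim red_step1) simp_all
  then show ?thesis unfolding eq by simp
qed

text \<open>Backward use of the zigzag relation: the middle letter descends to \<open>s\<close>
  while the word grows. This brings a new pair to its standard place, so that the number of cups
  shows in \<open>cup_gens\<close>.\<close>

lemma red_new_cup:
  assumes "1 \<le> s" "s \<le> i" "i < n"
  shows "red d n [i] 1 (rev [Suc s..<Suc i] @ [s] @ [Suc s..<Suc i])"
  using assms(2,3)
proof (induction i rule: dec_induct)
  case (step i)
  have "red d n ([] @ [Suc i] @ []) 1 ([] @ [Suc i, i, Suc i] @ [])"
    using step assms by (intro red.zag) auto
  moreover have "red d n ([Suc i] @ [i] @ [Suc i]) 1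
     ([Suc i] @ (rev [Suc s..<Suc i] @ [s] @ [Suc s..<Suc i]) @ [Suc i])"
    using step assms by (intro red_context) auto
  ultimately have "red d n ([] @ [Suc i] @ []) 1 (rev [Suc s..<Suc (Suc i)] @ [s] @ [Suc s..<Suc (Suc i)])"
    using step by (elim red_step1) simp_all
  then show ?case by simp
qed (simp add: red.self)

lemma set_slide: "admissible L cs \<Longrightarrow> set (slide s cs) \<subseteq> {s + 2..<s + L}"
proof (induction cs arbitrary: L s)
  case (Cons c cs)
  from Cons.prems have "set (slide (s + 2) cs) \<subseteq> {s + 2 + 2..<s + 2 + (L - 2)}" by (intro Cons.IH) simp
  also have "\<dots> \<subseteq> {s + 2..<s + L}" using Cons.prems by auto
  finally show ?case using Cons.prems by auto
qed simp

lemma set_cup_gens: "admissible L cs \<Longrightarrow> set (cup_gens s (length cs)) \<subseteq> {s + 1..<s + L}"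
proof (induction cs arbitrary: L s)
  case (Cons c cs)
  from Cons.prems have "set (cup_gens (s + 2) (length cs)) \<subseteq> {s + 2 + 1..<s + 2 + (L - 2)}" by (intro Cons.IH) simp
  also have "\<dots> \<subseteq> {s + 1..<s + L}" using Cons.prems by auto
  finally show ?case using Cons.prems by auto
qed simp

lemma set_cup_gens': "set (cup_gens s k) \<subseteq> {s + 1..<s + 2 * k}"
proof (induction k arbitrary: s)
  case (Suc k)
  have "{s + 2 + 1..<s + 2 + 2 * k} \<subseteq> {s + 1..<s + 2 * Suc k}" by auto
  with Suc[of "s + 2"] show ?case by auto
qed simp

text \<open>The three outcomes of one more generator in front of a half diagram with
  \<open>k\<close> cups: again such a half diagram, the same cups behind fewer letters, or one cup
  more. In the first outcome the positions may only grow, because a cup in front of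
  \<open>cs\<close> stays admissible only if its successor does not move too far left.\<close>

definition same_rank where
  "same_rank d n s cs k u \<longleftrightarrow> (\<exists>c cs'. red d n u c (slide s cs' @ cup_gens s k) \<and> admissible (n - s) cs' \<and>
     list_all2 (\<le>) cs cs' \<and> length (slide s cs') \<le> Suc (length (slide s cs)))"

definition shorter where
  "shorter d n s cs k u \<longleftrightarrow> (\<exists>v. red d n u 1 (v @ cup_gens s k) \<and> set v \<subseteq> {s + 1..<n} \<and>
     length v < length (slide s cs))"

definition higher_rank where
  "higher_rank d n s k u \<longleftrightarrow> (\<exists>x y. red d n u 1 (x @ cup_gens s (Suc k) @ y) \<and>
     set (x @ cup_gens s (Suc k) @ y) \<subseteq> {s + 1..<n})"

lemma slide_step:
  assumes "admissible L cs" "1 \<le> i" "i < L" "s + L = n"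
  shows "same_rank d n s cs (length cs) ((s + i) # slide s cs @ cup_gens s (length cs)) \<or>
    shorter d n s cs (length cs) ((s + i) # slide s cs @ cup_gens s (length cs)) \<or>
    higher_rank d n s (length cs) ((s + i) # slide s cs @ cup_gens s (length cs))"
  using assms
proof (induction cs arbitrary: L i s)
  case Nil
  then have "red d n [s + i] 1 (rev [s + 2..<Suc (s + i)] @ [Suc s] @ [s + 2..<Suc (s + i)])"
    using red_new_cup[of "Suc s" "s + i" n d] by simp
  then have "higher_rank d n s 0 [s + i]"
    unfolding higher_rank_def using Nil
    by (intro exI[of _ "rev [s + 2..<Suc (s + i)]"] exI[of _ "[s + 2..<Suc (s + i)]"]) auto
  then show ?case by simp
next
  case (Cons c cs)
  let ?k = "length cs"
  let ?N = "slide (s + 2) cs" and ?E = "cup_gens (s + 2) ?k"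
  let ?R = "rev [s + 2..<Suc (s + c)]"
  let ?w = "(s + i) # slide s (c # cs) @ cup_gens s (length (c # cs))"
  from Cons.prems have v: "1 \<le> c" "c < L" "admissible (L - 2) cs" "cs \<noteq> [] \<Longrightarrow> c \<le> Suc (hd cs)" by auto
  have sets: "set ?N \<subseteq> {s + 4..<n}" "set ?E \<subseteq> {s + 3..<n}" "set ?R \<subseteq> {s + 2..<n}"
  proof -
    have e: "s + 2 + (L - 2) = n" "s + 2 + 2 = s + 4" "s + 2 + 1 = s + 3" using Cons.prems v by auto
    show "set ?N \<subseteq> {s + 4..<n}" using set_slide[OF v(3), of "s + 2"] unfolding e .
    show "set ?E \<subseteq> {s + 3..<n}" using set_cup_gens[OF v(3), of "s + 2"] unfolding e .
    show "set ?R \<subseteq> {s + 2..<n}" using Cons.prems v by auto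
  qed
  have G: "{s + 4..<n} \<subseteq> {1..<n}" "{s + 3..<n} \<subseteq> {1..<n}" "{s + 2..<n} \<subseteq> {1..<n}" by auto
  from sets G have sets1: "set ?N \<subseteq> {1..<n}" "set ?E \<subseteq> {1..<n}" "set ?R \<subseteq> {1..<n}" by blast+
  have s1: "Suc s < n" "s + c < n" "s + i < n" using Cons.prems v by auto
  have R1: "?R @ [Suc s] = rev [Suc s..<Suc (s + c)]"
    using v(1) by (simp add: upt_conv_Cons[of "Suc s"])
  have w: "?w = (s + i) # ?R @ ?N @ Suc s # ?E" by simp
  \<comment> \<open>The generator \<open>Suc s\<close> is far from all letters of the later cups. It
    may stand at the end of the first run, making that run longer by one, or at its place in
    \<open>cup_gens\<close>.\<close>
  have pull: "red d n (x @ y @ Suc s # ?E) 1 (x @ Suc s # y @ ?E)"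
    "red d n (x @ Suc s # y @ ?E) 1 (x @ y @ Suc s # ?E)"
    if "set x \<subseteq> {1..<n}" "set y \<subseteq> {s + 3..<n}" for x y
  proof -
    have y: "set y \<subseteq> {1..<n}" using that G by blast
    have "red d n (x @ y @ [Suc s] @ ?E) 1 (x @ [Suc s] @ y @ ?E)"
      "red d n (x @ [Suc s] @ y @ ?E) 1 (x @ y @ [Suc s] @ ?E)"
      using that y s1 sets1 by (intro red_swap; auto)+
    then show "red d n (x @ y @ Suc s # ?E) 1 (x @ Suc s # y @ ?E)"
      "red d n (x @ Suc s # y @ ?E) 1 (x @ y @ Suc s # ?E)" by simp_all
  qed
  have w1: "red d n ?w 1 ((s + i) # rev [Suc s..<Suc (s + c)] @ ?N @ ?E)"
  proof -
    have "set ((s + i) # ?R) \<subseteq> {1..<n}" using sets1(3) s1 Cons.prems by auto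
    moreover have "set ?N \<subseteq> {s + 3..<n}" using sets(1) by (auto simp: subset_iff)
    ultimately show ?thesis using pull(1)[of "(s + i) # ?R" ?N] unfolding w R1[symmetric] by simp
  qed
  \<comment> \<open>Relative to the first cup, the generator lies to the left, closes a loop on it,
    shifts it by one, joins it to the cup enclosing it, or passes it and acts on the rest.\<close>
  consider "i < c" | "i = c" | "i = Suc c" "cs = [] \<or> c \<le> hd cs" | "i = Suc c" "cs \<noteq> []" "c = Suc (hd cs)"
    | "Suc c < i" using v(4) by fastforce
  then show ?case
  proof cases
    case 1
    have "red d n ((s + i) # rev [Suc s..<Suc (s + c)]) 1
       (rev [s + i + 2..<Suc (s + c)] @ rev [Suc s..<Suc (s + i)])"
      using 1 s1 Cons.prems by (intro red_absorb) auto
    from red_context[OF this, of "[]" "?N @ ?E"] sets1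
    have "red d n ((s + i) # rev [Suc s..<Suc (s + c)] @ ?N @ ?E) 1
       (rev [s + i + 2..<Suc (s + c)] @ rev [Suc s..<Suc (s + i)] @ ?N @ ?E)" by simp
    note red_trans1[OF w1 this]
    moreover have "rev [Suc s..<Suc (s + i)] = rev [s + 2..<Suc (s + i)] @ [Suc s]"
      using Cons.prems by (simp add: upt_conv_Cons[of "Suc s"])
    moreover have "red d n ((rev [s + i + 2..<Suc (s + c)] @ rev [s + 2..<Suc (s + i)]) @ Suc s # ?N @ ?E) 1
       ((rev [s + i + 2..<Suc (s + c)] @ rev [s + 2..<Suc (s + i)]) @ ?N @ Suc s # ?E)"
      using s1 sets 1 by (intro pull) (auto simp: subset_iff)
    ultimately have "red d n ?w 1 ((rev [s + i + 2..<Suc (s + c)] @ rev [s + 2..<Suc (s + i)] @ ?N) @ cup_gens s (Suc ?k))"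
      by (elim red_step1) simp_all
    then have "shorter d n s (c # cs) (Suc ?k) ?w"
      unfolding shorter_def using 1 s1 sets Cons.prems
      by (intro exI[of _ "rev [s + i + 2..<Suc (s + c)] @ rev [s + 2..<Suc (s + i)] @ ?N"]) auto
    then show ?thesis by simp
  next
    case 2
    have eq: "rev [Suc s..<Suc (s + c)] = (s + c) # rev [Suc s..<s + c]" using v by simp
    have "red d n ([] @ [s + c, s + c] @ (rev [Suc s..<s + c] @ ?N @ ?E)) (d (s + c))
       ([] @ [s + c] @ (rev [Suc s..<s + c] @ ?N @ ?E))"
      using s1 sets1 v by (intro red.squared) auto
    with w1 have "red d n ?w (d (s + c)) (rev [Suc s..<Suc (s + c)] @ ?N @ ?E)"
      using v(1) by (elim red_step1) (simp_all add: eq 2)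
    moreover have "red d n (rev [Suc s..<Suc (s + c)] @ ?N @ ?E) 1 (?R @ ?N @ Suc s # ?E)"
    proof -
      have "set ?N \<subseteq> {s + 3..<n}" using sets(1) by (auto simp: subset_iff)
      then show ?thesis using pull(2)[of ?R ?N] sets1(3) unfolding R1[symmetric] by simp
    qed
    ultimately have "red d n ?w (d (s + c)) (slide s (c # cs) @ cup_gens s (Suc ?k))"
      by (rule red_step2) simp_all
    then have "same_rank d n s (c # cs) (Suc ?k) ?w"
      unfolding same_rank_def using Cons.prems
      by (intro exI[of _ "d (s + c)"] exI[of _ "c # cs"]) (auto intro: list_all2_refl)
    then show ?thesis by simp
  next
    case 3
    have eq: "?w = slide s (Suc c # cs) @ cup_gens s (Suc ?k)" using 3 v by simp
    have "red d n ?w 1 (slide s (Suc c # cs) @ cup_gens s (Suc ?k))"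
      by (subst eq[symmetric]) (rule red.self)
    moreover have "admissible L (Suc c # cs)" using 3 v Cons.prems by auto
    ultimately have "same_rank d n s (c # cs) (Suc ?k) ?w"
      unfolding same_rank_def using Cons.prems v(1)
      by (intro exI[of _ 1] exI[of _ "Suc c # cs"]) (auto intro: list_all2_refl)
    then show ?thesis by simp
  next
    case 4
    \<comment> \<open>The first two cups are nested. The first letter \<open>?t + 1\<close> of the
      second run, which for \<open>c = 2\<close> is the cup generator \<open>s + 3\<close> itself,
      moves left until the zigzag \<open>?t + 1, ?t, ?t + 1\<close> appears.\<close>
    then obtain c2 cs2 where cs: "cs = c2 # cs2" "c = Suc c2" by (cases cs) auto
    let ?t = "s + c" and ?N2 = "slide (s + 4) cs2" and ?E2 = "cup_gens (s + 4) (length cs2)"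
    let ?A' = "rev [s + 2..<s + c]"
    have c2: "2 \<le> c" using v(3) cs by simp
    have N: "?N = rev [s + 4..<Suc (Suc ?t)] @ ?N2" and E: "?E = (s + 3) # ?E2"
      using cs by (simp_all add: eval_nat_numeral)
    have "set ?N2 \<subseteq> {s + 4 + 2..<s + 4 + (L - 4)}"
      using v(3) cs by (intro set_slide) (auto simp: diff_diff_left)
    then have N2: "set ?N2 \<subseteq> {s + 6..<n}" using Cons.prems v cs by (auto simp: subset_iff)
    have sets2: "set ?N2 \<subseteq> {1..<n}" "set ?E2 \<subseteq> {1..<n}" "Suc ?t < n"
      using sets1 s1 4 unfolding N E by auto
    have A: "rev [Suc s..<Suc (Suc ?t)] = [Suc ?t, ?t] @ rev [Suc s..<?t]"
      and A': "rev [Suc s..<?t] = ?A' @ [Suc s]"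
      and B: "rev [s + 4..<Suc (Suc ?t)] @ [s + 3] = Suc ?t # rev [s + 3..<Suc ?t]"
      using c2 by (simp_all add: upt_conv_Cons[of "Suc s"] upt_conv_Cons[of "s + 3"] ac_simps)
    have "(s + i) # rev [Suc s..<Suc (s + c)] @ ?N @ ?E =
      (rev [Suc s..<Suc (Suc ?t)] @ rev [s + 4..<Suc (Suc ?t)]) @ ?N2 @ [s + 3] @ ?E2"
      unfolding N E using 4 by simp
    note w1[unfolded this]
    also have "red d n ((rev [Suc s..<Suc (Suc ?t)] @ rev [s + 4..<Suc (Suc ?t)]) @ ?N2 @ [s + 3] @ ?E2) 1
      ((rev [Suc s..<Suc (Suc ?t)] @ rev [s + 4..<Suc (Suc ?t)]) @ [s + 3] @ ?N2 @ ?E2)"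
      using sets2 N2 s1 c2 by (intro red_swap) (auto simp: subset_iff)
    also have "(rev [Suc s..<Suc (Suc ?t)] @ rev [s + 4..<Suc (Suc ?t)]) @ [s + 3] @ ?N2 @ ?E2 =
      [Suc ?t, ?t] @ rev [Suc s..<?t] @ [Suc ?t] @ rev [s + 3..<Suc ?t] @ ?N2 @ ?E2"
      unfolding A using B by simp
    also have "red d n \<dots> 1 ([Suc ?t, ?t] @ [Suc ?t] @ rev [Suc s..<?t] @ rev [s + 3..<Suc ?t] @ ?N2 @ ?E2)"
      using sets2 c2 by (intro red_swap) auto
    also have "red d n ([Suc ?t, ?t] @ [Suc ?t] @ rev [Suc s..<?t] @ rev [s + 3..<Suc ?t] @ ?N2 @ ?E2) 1
      ([] @ [Suc ?t] @ (rev [Suc s..<?t] @ rev [s + 3..<Suc ?t] @ ?N2 @ ?E2))"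
    proof -
      have "set (rev [Suc s..<?t] @ rev [s + 3..<Suc ?t] @ ?N2 @ ?E2) \<subseteq> {1..<n}"
        using sets2 by (intro subsetI) auto
      then have "red d n ([] @ [Suc ?t, ?t, Suc ?t] @ rev [Suc s..<?t] @ rev [s + 3..<Suc ?t] @ ?N2 @ ?E2) 1
          ([] @ [Suc ?t] @ rev [Suc s..<?t] @ rev [s + 3..<Suc ?t] @ ?N2 @ ?E2)"
        using sets2(3) c2 by (intro red.zig) simp_all
      then show ?thesis by (simp only: append_Cons append_Nil)
    qed
    also have "[] @ [Suc ?t] @ (rev [Suc s..<?t] @ rev [s + 3..<Suc ?t] @ ?N2 @ ?E2) =
      (Suc ?t # ?A') @ [Suc s] @ rev [s + 3..<Suc ?t] @ ?N2 @ ?E2"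
      unfolding A' by simp
    finally have w4: "red d n ?w 1 ((Suc ?t # ?A') @ [Suc s] @ rev [s + 3..<Suc ?t] @ ?N2 @ ?E2)" .
    have "\<exists>v. red d n ?w 1 (v @ ?N2 @ [Suc s, s + 3] @ ?E2) \<and> set v \<subseteq> {s + 1..<n} \<and> length v + 3 < 2 * c"
    proof (cases "c = 2")
      case True
      have "red d n ([s + 3, Suc s] @ ?N2 @ ?E2) 1 ([Suc s, s + 3] @ ?N2 @ ?E2)"
        using red.far[of "[]" "s + 3" "Suc s" "?N2 @ ?E2" n d] sets2 True by simp
      moreover have "red d n ([] @ [Suc s, s + 3] @ ?N2 @ ?E2) 1 ([] @ ?N2 @ [Suc s, s + 3] @ ?E2)"
        using sets2 N2 True by (intro red_swap) (auto simp: subset_iff)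
      ultimately have "red d n ([s + 3, Suc s] @ ?N2 @ ?E2) 1 ([] @ ?N2 @ [Suc s, s + 3] @ ?E2)"
        by (elim red_step1) simp_all
      with w4 have "red d n ?w 1 ([] @ ?N2 @ [Suc s, s + 3] @ ?E2)"
        using True by (elim red_step1) (simp_all add: numeral_3_eq_3)
      then show ?thesis using True by (intro exI[of _ "[]"]) simp
    next
      case False
      then have B': "rev [s + 3..<Suc ?t] = rev [s + 4..<Suc ?t] @ [s + 3]"
        using c2 by (simp add: upt_conv_Cons[of "s + 3"] ac_simps)
      have "red d n ((Suc ?t # ?A') @ [Suc s] @ rev [s + 4..<Suc ?t] @ ([s + 3] @ ?N2 @ ?E2)) 1
         ((Suc ?t # ?A') @ rev [s + 4..<Suc ?t] @ [Suc s] @ ([s + 3] @ ?N2 @ ?E2))"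
        using sets2 c2 False by (intro red_swap) auto
      note w4[unfolded B' append_assoc, THEN red_trans1, OF this[unfolded append_assoc]]
      moreover have "red d n ((Suc ?t # ?A' @ rev [s + 4..<Suc ?t]) @ [Suc s, s + 3] @ ?N2 @ ?E2) 1
         ((Suc ?t # ?A' @ rev [s + 4..<Suc ?t]) @ ?N2 @ [Suc s, s + 3] @ ?E2)"
        using sets2 N2 c2 False by (intro red_swap) (auto simp: subset_iff)
      ultimately have "red d n ?w 1 ((Suc ?t # ?A' @ rev [s + 4..<Suc ?t]) @ ?N2 @ [Suc s, s + 3] @ ?E2)"
        by (elim red_step1) simp_all
      then show ?thesis using sets2 c2 False
        by (intro exI[of _ "Suc ?t # ?A' @ rev [s + 4..<Suc ?t]"]) auto
    qed
    then obtain v where "red d n ?w 1 ((v @ ?N2) @ cup_gens s (Suc ?k))" "set v \<subseteq> {s + 1..<n}" "length v + 3 < 2 * c"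
      unfolding cs by (auto simp: eval_nat_numeral)
    moreover have "length (slide s (c # cs)) = (c - 1) + length ?N" using c2 by simp
    moreover have "length ?N = (c - 2) + length ?N2" unfolding N length_append length_rev length_upt by simp
    ultimately have "shorter d n s (c # cs) (Suc ?k) ?w"
      unfolding shorter_def using N2 c2
      by (intro exI[of _ "v @ ?N2"] conjI) (auto simp del: slide.simps cup_gens.simps)
    then show ?thesis by simp
  next
    case 5
    \<comment> \<open>The generator commutes with the whole first run and its cup generator. For the
      remaining cups, which start two places later, its index is \<open>i - 2\<close>.\<close>
    then have i2: "1 \<le> i - 2" "i - 2 < L - 2" "(s + 2) + (L - 2) = n" "s + 2 + (i - 2) = s + i"
      using Cons.prems v by auto
    have "red d n ([] @ (s + i) # ?R @ ?N @ Suc s # ?E) 1 ([] @ ?R @ (s + i) # (?N @ Suc s # ?E))"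
      using 5 s1 sets1 by (intro red_swap1) auto
    moreover have "red d n (?R @ ((s + i) # ?N) @ Suc s # ?E) 1 (?R @ Suc s # ((s + i) # ?N) @ ?E)"
      using 5 s1 sets sets1 v by (intro pull) (auto simp: subset_iff)
    ultimately have "red d n ([] @ (s + i) # ?R @ ?N @ Suc s # ?E) 1 ((?R @ [Suc s]) @ ((s + i) # ?N @ ?E) @ [])"
      by (rule red_step1) simp_all
    then have w5: "red d n ?w 1 ((?R @ [Suc s]) @ ((s + i) # ?N @ ?E) @ [])"
      unfolding w by simp
    have R2: "set (?R @ [Suc s]) \<subseteq> {1..<n}" using sets1 s1 by auto
    from Cons.IH[OF v(3) i2(1-3)] consider
        (same) "same_rank d n (s + 2) cs ?k ((s + i) # ?N @ ?E)"
      | (short) "shorter d n (s + 2) cs ?k ((s + i) # ?N @ ?E)"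
      | (high) "higher_rank d n (s + 2) ?k ((s + i) # ?N @ ?E)"
      unfolding i2(4) by blast
    then show ?thesis
    proof cases
      case same
      then obtain e cs' where e: "red d n ((s + i) # ?N @ ?E) e (slide (s + 2) cs' @ ?E)"
        "admissible (n - (s + 2)) cs'" "list_all2 (\<le>) cs cs'"
        "length (slide (s + 2) cs') \<le> Suc (length ?N)" unfolding same_rank_def by blast
      have "red d n ?w e ((?R @ [Suc s]) @ (slide (s + 2) cs' @ ?E) @ [])"
        using red_trans1[OF w5] red_context[OF e(1) R2, of "[]"] by simp
      moreover have "set (slide (s + 2) cs') \<subseteq> {s + 3..<n}"
        by (rule order.trans[OF set_slide[OF e(2)]]) (use i2 in auto)
      then have "red d n (?R @ Suc s # slide (s + 2) cs' @ ?E) 1 (?R @ slide (s + 2) cs' @ Suc s # ?E)"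
        using sets1 by (intro pull) auto
      ultimately have "red d n ?w e (slide s (c # cs') @ cup_gens s (Suc ?k))"
        by (elim red_step2) simp_all
      moreover have "admissible L (c # cs')"
        using v e(2,3) Cons.prems by (cases cs; cases cs') (auto simp: diff_diff_left)
      ultimately have "same_rank d n s (c # cs) (Suc ?k) ?w"
        unfolding same_rank_def using Cons.prems e
        by (intro exI[of _ e] exI[of _ "c # cs'"]) auto
      then show ?thesis by simp
    next
      case short
      then obtain v where e: "red d n ((s + i) # ?N @ ?E) 1 (v @ ?E)"
        "set v \<subseteq> {s + 3..<n}" "length v < length ?N" unfolding shorter_def by (auto simp: numeral_3_eq_3)
      have "red d n ?w 1 ((?R @ [Suc s]) @ (v @ ?E) @ [])"
        using red_trans1[OF w5] red_context[OF e(1) R2, of "[]"] by simp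
      moreover have "red d n (?R @ Suc s # v @ ?E) 1 (?R @ v @ Suc s # ?E)"
        using e sets1 by (intro pull) auto
      ultimately have "red d n ?w 1 ((?R @ v) @ cup_gens s (Suc ?k))"
        by (elim red_step2) simp_all
      then have "shorter d n s (c # cs) (Suc ?k) ?w"
        unfolding shorter_def using e sets by (intro exI[of _ "?R @ v"]) auto
      then show ?thesis by simp
    next
      case high
      then obtain x y where e: "red d n ((s + i) # ?N @ ?E) 1 (x @ cup_gens (s + 2) (Suc ?k) @ y)"
        "set (x @ cup_gens (s + 2) (Suc ?k) @ y) \<subseteq> {s + 3..<n}" unfolding higher_rank_def by (auto simp: numeral_3_eq_3)
      have "red d n ?w 1 ((?R @ [Suc s]) @ (x @ cup_gens (s + 2) (Suc ?k) @ y) @ [])"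
        using red_trans1[OF w5] red_context[OF e(1) R2, of "[]"] by simp
      moreover have "red d n (?R @ [Suc s] @ x @ cup_gens (s + 2) (Suc ?k) @ y) 1
          (?R @ x @ [Suc s] @ cup_gens (s + 2) (Suc ?k) @ y)"
        using e s1 sets1 by (intro red_swap) (auto simp: subset_iff)
      ultimately have "red d n ?w 1 ((?R @ x) @ cup_gens s (Suc (Suc ?k)) @ y)"
        by (elim red_step2) simp_all
      moreover have "set ((?R @ x) @ cup_gens s (Suc (Suc ?k)) @ y) \<subseteq> {s + 1..<n}"
        using e(2) sets(3) s1 by (auto simp: subset_iff)
      ultimately have "higher_rank d n s (Suc ?k) ?w" unfolding higher_rank_def by blast
      then show ?thesis by simp
    qed
  qed
qed

text \<open>The induction is on the length: after a \<open>shorter\<close> step the prefix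
  \<open>v\<close> is arbitrary, and the bound on \<open>slide 0 cs\<close> carried along shows that
  \<open>v\<close> is shorter than \<open>u\<close>.\<close>

lemma left_normal:
  assumes "2 * k \<le> n" "set u \<subseteq> {1..<n}"
  shows "(\<exists>c cs. red d n (u @ cup_gens 0 k) c (slide 0 cs @ cup_gens 0 k) \<and> admissible n cs \<and> length cs = k) \<or>
    (\<exists>c x y. red d n (u @ cup_gens 0 k) c (x @ cup_gens 0 (Suc k) @ y) \<and> set (x @ cup_gens 0 (Suc k) @ y) \<subseteq> {1..<n})"
proof -
  let ?normal = "\<lambda>u. \<exists>c cs. red d n (u @ cup_gens 0 k) c (slide 0 cs @ cup_gens 0 k) \<and> admissible n cs \<and> length cs = k
    \<and> length (slide 0 cs) \<le> length u"
  let ?high = "\<lambda>u. \<exists>c x y. red d n (u @ cup_gens 0 k) c (x @ cup_gens 0 (Suc k) @ y) \<and>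
    set (x @ cup_gens 0 (Suc k) @ y) \<subseteq> {1..<n}"
  have sl: "slide s (replicate j (Suc 0)) = []" for s j
    by (induction j arbitrary: s) auto
  have "?normal u \<or> ?high u" using assms(2)
  proof (induction u rule: length_induct)
    case (1 u)
    show ?case
    proof (cases u)
      case Nil
      have "admissible n (replicate k 1)" using assms(1)
        by (induction k arbitrary: n) auto
      with Nil have "?normal u"
        by (intro exI[of _ 1] exI[of _ "replicate k 1"]) (simp add: sl red.self)
      then show ?thesis ..
    next
      case (Cons i u')
      with 1 have i: "1 \<le> i" "i < n" and u': "set u' \<subseteq> {1..<n}" by auto
      with 1(1) Cons consider "?normal u'" | "?high u'" by fastforce
      then show ?thesis
      proof cases
        case 2
        then obtain c x y where "red d n (u' @ cup_gens 0 k) c (x @ cup_gens 0 (Suc k) @ y)"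
          "set (x @ cup_gens 0 (Suc k) @ y) \<subseteq> {1..<n}" by blast
        with red_context[OF this(1), of "[i]" "[]"] i have "?high u"
          unfolding Cons by (intro exI[of _ c] exI[of _ "i # x"] exI[of _ y]) auto
        then show ?thesis ..
      next
        case 1
        then obtain c cs where cs: "red d n (u' @ cup_gens 0 k) c (slide 0 cs @ cup_gens 0 k)" "admissible n cs"
          "length cs = k" "length (slide 0 cs) \<le> length u'" by blast
        from red_context[OF cs(1), of "[i]" "[]"] i
        have ui: "red d n (u @ cup_gens 0 k) c ((0 + i) # slide 0 cs @ cup_gens 0 k)"
          unfolding Cons by simp
        consider (same) "same_rank d n 0 cs k ((0 + i) # slide 0 cs @ cup_gens 0 k)"
          | (short) "shorter d n 0 cs k ((0 + i) # slide 0 cs @ cup_gens 0 k)"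
          | (high) "higher_rank d n 0 k ((0 + i) # slide 0 cs @ cup_gens 0 k)"
          using slide_step[OF cs(2) i add_0, of d] unfolding cs(3) by blast
        then show ?thesis
        proof cases
          case same
          then obtain e cs' where "red d n ((0 + i) # slide 0 cs @ cup_gens 0 k) e (slide 0 cs' @ cup_gens 0 k)"
            "admissible n cs'" "list_all2 (\<le>) cs cs'" "length (slide 0 cs') \<le> Suc (length (slide 0 cs))"
            unfolding same_rank_def by auto
          with red.chain[OF ui this(1)] cs(3,4) Cons have "?normal u"
            by (intro exI[of _ "c * e"] exI[of _ cs']) (auto dest: list_all2_lengthD)
          then show ?thesis ..
        next
          case short
          then obtain v where v: "red d n ((0 + i) # slide 0 cs @ cup_gens 0 k) 1 (v @ cup_gens 0 k)"
            "set v \<subseteq> {1..<n}" "length v < length (slide 0 cs)"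
            unfolding shorter_def by auto
          with cs(4) Cons have "length v < length u" by simp
          with 1 \<open>length v < length u\<close> v(2) "1.IH" have "?normal v \<or> ?high v" by blast
          then show ?thesis
          proof (elim disjE exE conjE)
            fix e cs' assume "red d n (v @ cup_gens 0 k) e (slide 0 cs' @ cup_gens 0 k)"
              "admissible n cs'" "length cs' = k" "length (slide 0 cs') \<le> length v"
            with red.chain[OF red_trans2[OF ui v(1)] this(1)] \<open>length v < length u\<close> have "?normal u"
              by (intro exI[of _ "c * e"] exI[of _ cs']) auto
            then show ?thesis ..
          next
            fix e x y assume "red d n (v @ cup_gens 0 k) e (x @ cup_gens 0 (Suc k) @ y)"
              "set (x @ cup_gens 0 (Suc k) @ y) \<subseteq> {1..<n}"
            with red.chain[OF red_trans2[OF ui v(1)] this(1)] have "?high u" by blast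
            then show ?thesis ..
          qed
        next
          case high
          then obtain x y where h: "red d n ((0 + i) # slide 0 cs @ cup_gens 0 k) 1 (x @ cup_gens 0 (Suc k) @ y)"
            "set (x @ cup_gens 0 (Suc k) @ y) \<subseteq> {1..<n}" unfolding higher_rank_def by auto
          with red_trans2[OF ui h(1)] have "?high u" by blast
          then show ?thesis ..
        qed
      qed
    qed
  qed
  then show ?thesis by blast
qed

lemma cup_gens_bound: "set (cup_gens s (Suc k)) \<subseteq> {1..<n} \<Longrightarrow> s + 2 * Suc k \<le> n"
proof (induction k arbitrary: s)
  case (Suc k)
  from Suc.IH[of "s + 2"] Suc.prems show ?case by simp
qed simp

lemma cup_gens_rev:
  assumes "2 * k \<le> n" shows "red d n (rev (cup_gens 0 k)) 1 (cup_gens 0 k) \<and> red d n (cup_gens 0 k) 1 (rev (cup_gens 0 k))"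
proof -
  have "red d n (rev (cup_gens s k)) 1 (cup_gens s k) \<and> red d n (cup_gens s k) 1 (rev (cup_gens s k))" if "s + 2 * k \<le> n" for s
    using that
  proof (induction k arbitrary: s)
    case (Suc k)
    have sub: "set (cup_gens (s + 2) k) \<subseteq> {s + 3..<n}"
      by (rule order.trans[OF set_cup_gens']) (use Suc.prems in auto)
    then have sub': "set (cup_gens (s + 2) k) \<subseteq> {1..<n}" "Suc s < n" using Suc.prems by auto
    have 1: "red d n ([] @ rev (cup_gens (s + 2) k) @ [Suc s] @ []) 1 ([] @ [Suc s] @ rev (cup_gens (s + 2) k) @ [])"
      "red d n ([] @ [Suc s] @ rev (cup_gens (s + 2) k) @ []) 1 ([] @ rev (cup_gens (s + 2) k) @ [Suc s] @ [])"
      using sub sub' by (intro red_swap; auto)+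
    have 2: "red d n ([Suc s] @ rev (cup_gens (s + 2) k) @ []) 1 ([Suc s] @ cup_gens (s + 2) k @ [])"
      "red d n ([Suc s] @ cup_gens (s + 2) k @ []) 1 ([Suc s] @ rev (cup_gens (s + 2) k) @ [])"
      using Suc.IH[of "s + 2"] Suc.prems sub' by (intro red_context; simp)+
    show ?case
    proof
      show "red d n (rev (cup_gens s (Suc k))) 1 (cup_gens s (Suc k))"
        using red_step1[OF 1(1) 2(1)] by simp
      show "red d n (cup_gens s (Suc k)) 1 (rev (cup_gens s (Suc k)))"
        using red_step1[OF 2(2) 1(2)] by simp
    qed
  qed (simp add: red.self)
  from this[of 0] assms show ?thesis by simp
qed

text \<open>The halves are normalised one after the other, the right one through the reversed word,
  since reversal preserves the relations and the letters of \<open>cup_gens\<close> commute. Every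
  new cup raises \<open>k\<close>, which stays at most \<open>n div 2\<close>.\<close>

lemma red_normal_word_aux:
  assumes "set (x @ cup_gens 0 k @ y) \<subseteq> {1..<n}" "2 * k \<le> n"
  shows "\<exists>c cs cs'. red d n (x @ cup_gens 0 k @ y) c (normal_word cs cs') \<and> admissible n cs \<and> admissible n cs'
    \<and> length cs = length cs'"
  using assms
proof (induction "n - k" arbitrary: x k y rule: less_induct)
  case less
  have IH: ?case if h: "red d n (x @ cup_gens 0 k @ y) c (x' @ cup_gens 0 (Suc k) @ y')"
    "set (x' @ cup_gens 0 (Suc k) @ y') \<subseteq> {1..<n}" for c x' y'
  proof -
    have "2 * Suc k \<le> n" using h(2) cup_gens_bound[of 0 k n] by (simp del: cup_gens.simps)
    moreover from this have "n - Suc k < n - k" by simp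
    ultimately obtain e cs cs' where "red d n (x' @ cup_gens 0 (Suc k) @ y') e (normal_word cs cs')"
      "admissible n cs" "admissible n cs'" "length cs = length cs'"
      using less(1) h(2) by blast
    with red.chain[OF h(1) this(1)] show ?thesis by blast
  qed
  have sets: "set x \<subseteq> {1..<n}" "set y \<subseteq> {1..<n}" "set (cup_gens 0 k) \<subseteq> {1..<n}" using less by auto
  from left_normal[OF less(3) sets(1), of d] show ?case
  proof (elim disjE exE conjE)
    fix c x' y' assume h: "red d n (x @ cup_gens 0 k) c (x' @ cup_gens 0 (Suc k) @ y')"
      "set (x' @ cup_gens 0 (Suc k) @ y') \<subseteq> {1..<n}"
    with red_context[OF h(1), of "[]" y] sets IH[of c x' "y' @ y"] show ?case by auto
  next
    fix c cs assume cs: "red d n (x @ cup_gens 0 k) c (slide 0 cs @ cup_gens 0 k)" "admissible n cs" "length cs = k"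
    have sl: "set (slide 0 cs) \<subseteq> {1..<n}" using set_slide[OF cs(2), of 0] by auto
    from red_context[OF cs(1), of "[]" y] sets
    have 1: "red d n (x @ cup_gens 0 k @ y) c (slide 0 cs @ cup_gens 0 k @ y)" by simp
    have "set (rev y) \<subseteq> {1..<n}" using sets by simp
    from left_normal[OF less(3) this, of d] show ?case
    proof (elim disjE exE conjE)
      fix e x' y' assume h: "red d n (rev y @ cup_gens 0 k) e (x' @ cup_gens 0 (Suc k) @ y')"
        "set (x' @ cup_gens 0 (Suc k) @ y') \<subseteq> {1..<n}"
      have c2: "2 * Suc k \<le> n" using h(2) cup_gens_bound[of 0 k n] by (simp del: cup_gens.simps)
      have "red d n ([] @ cup_gens 0 k @ y) 1 ([] @ rev (cup_gens 0 k) @ y)"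
        using cup_gens_rev[OF less(3), of d] sets by (intro red_context) auto
      moreover have "red d n (rev (cup_gens 0 k) @ y) e (rev y' @ rev (cup_gens 0 (Suc k)) @ rev x')"
        using red_rev[OF h(1)] by (simp del: cup_gens.simps)
      moreover have "red d n (rev y' @ rev (cup_gens 0 (Suc k)) @ rev x') 1 (rev y' @ cup_gens 0 (Suc k) @ rev x')"
        using cup_gens_rev[OF c2, of d] h(2) by (intro red_context) auto
      ultimately have "red d n (cup_gens 0 k @ y) e (rev y' @ cup_gens 0 (Suc k) @ rev x')"
        using red_trans1 red_trans2 unfolding append_Nil by blast
      from red.chain[OF 1, of e "slide 0 cs @ rev y' @ cup_gens 0 (Suc k) @ rev x'"]
        red_context[OF this sl, of "[]"] IH[of "c * e" "slide 0 cs @ rev y'" "rev x'"] h(2) sl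
      show ?case by (simp del: cup_gens.simps)
    next
      fix e cs' assume cs': "red d n (rev y @ cup_gens 0 k) e (slide 0 cs' @ cup_gens 0 k)" "admissible n cs'" "length cs' = k"
      have sl': "set (slide 0 cs') \<subseteq> {1..<n}" using set_slide[OF cs'(2), of 0] by auto
      have "red d n ([] @ cup_gens 0 k @ y) 1 ([] @ rev (cup_gens 0 k) @ y)"
        using cup_gens_rev[OF less(3), of d] sets by (intro red_context) auto
      moreover have "red d n (rev (cup_gens 0 k) @ y) e (rev (cup_gens 0 k) @ rev (slide 0 cs'))"
        using red_rev[OF cs'(1)] by simp
      moreover have "red d n ([] @ rev (cup_gens 0 k) @ rev (slide 0 cs')) 1 ([] @ cup_gens 0 k @ rev (slide 0 cs'))"
        using cup_gens_rev[OF less(3), of d] sl' by (intro red_context) auto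
      ultimately have "red d n (cup_gens 0 k @ y) e (cup_gens 0 k @ rev (slide 0 cs'))"
        using red_trans1 red_trans2 unfolding append_Nil by blast
      from red.chain[OF 1, of e "slide 0 cs @ cup_gens 0 k @ rev (slide 0 cs')"] red_context[OF this sl, of "[]"] cs cs'
      show ?case unfolding normal_word_def
        by (intro exI[of _ "c * e"] exI[of _ cs] exI[of _ cs']) auto
    qed
  qed
qed

lemma red_normal_word:
  assumes "set u \<subseteq> {1..<n}"
  shows "\<exists>c cs cs'. red d n u c (normal_word cs cs') \<and> admissible n cs \<and> admissible n cs' \<and> length cs = length cs'"
  using red_normal_word_aux[of u 0 "[]" n d] assms by simp


section \<open>The action of normal words\<close>

fun caps :: "(nat \<Rightarrow> 'r::comm_ring_1) \<Rightarrow> nat list \<Rightarrow> (bool list \<Rightarrow> 'r) \<Rightarrow> bool list \<Rightarrow> 'r" where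
  "caps d [] g = g"
| "caps d (c # cs) g = cap d c (caps d cs g)"

text \<open>With \<open>b = True\<close> the pairs are cups \<open>+ -\<close>. With
  \<open>b = False\<close> they are pairs \<open>- +\<close>, on which a cap has value 1 instead of
  a loop value; these words are the points where the cap functionals are tested.\<close>

definition place1 :: "bool \<Rightarrow> nat \<Rightarrow> bool list \<Rightarrow> bool list" where
  "place1 b c w = take (c - 1) w @ b # (\<not> b) # drop (c - 1) w"

fun place :: "bool \<Rightarrow> nat list \<Rightarrow> bool list \<Rightarrow> bool list" where
  "place b [] z = z"
| "place b (c # cs) z = place1 b c (place b cs z)"

fun zigzag :: "nat \<Rightarrow> bool list" where
  "zigzag 0 = []"
| "zigzag (Suc j) = zigzag j @ [True, False]"

lemma cup_place1: "cup c w = place1 True c w"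
  by (simp add: cup_def place1_def)

lemma length_place1 [simp]: "length (place1 b c w) = length w + 2"
  by (simp add: place1_def)

lemma length_place [simp]: "length (place b cs z) = length z + 2 * length cs"
  by (induction cs) auto

lemma count_place1 [simp]: "minuses (place1 b c w) = Suc (minuses w)"
  using count_list_append[of "take (c - 1) w" "drop (c - 1) w" False] by (simp add: place1_def)

lemma count_place [simp]: "minuses (place b cs z) = minuses z + length cs"
  by (induction cs) auto

lemma length_zigzag [simp]: "length (zigzag j) = 2 * j"
  by (induction j) auto

lemma balanced_zigzag: "balanced (zigzag j)"
  by (induction j) (auto simp: balanced_def flip_minus_append height_append)

lemma flip_plus_zigzag:
  "flip_plus 0 (zigzag j @ x) = map_option (append (zigzag j)) (flip_plus 0 x)"
  by (auto simp: flip_plus_append balanced_flip_plus balanced_zigzag split: option.splits)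

lemma map_add_upt_shift: "map (\<lambda>i. i + k) [a..<b] = [a + k..<b + k]"
  by (induction b) auto

text \<open>A comparison of lattice paths: minuses further to the left make a word larger.\<close>

definition dominated :: "bool list \<Rightarrow> bool list \<Rightarrow> bool" where
  "dominated x y \<longleftrightarrow> (\<forall>t. minuses (take t x) \<le> minuses (take t y))"

lemma all_plus: "minuses z = 0 \<Longrightarrow> z = replicate (length z) True"
  by (induction z) (auto split: if_splits)

context
  fixes d :: "nat \<Rightarrow> 'r::comm_ring_1"
  assumes d: "\<And>i. d (Suc (Suc i)) = d i"
begin

lemma period2: "d (i + 2 * j) = d i"
  by (induction j) (auto simp: d)

lemma gen_act_shift:
  assumes "1 \<le> i" "i < length x"
  shows "gen_act d (i + 2 * j) f (zigzag j @ x) = gen_act d i (\<lambda>z. f (zigzag j @ z)) x"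
proof -
  obtain u a b y where x: "x = u @ a # b # y" "i = Suc (length u)" using word_split[OF assms] .
  have "i + 2 * j = Suc (length (zigzag j @ u))" using x by simp
  note rules = gen_act_simps[OF this, of d f y, unfolded append_assoc] gen_act_simps[OF x(2)]
  show ?thesis unfolding x(1)
    by (cases a; cases b) (simp_all add: rules period2 flip_plus_zigzag)
qed

lemma word_act_shift:
  assumes "set u \<subseteq> {1..<length x}"
  shows "word_act d (map (\<lambda>i. i + 2 * j) u) f (zigzag j @ x) = word_act d u (\<lambda>z. f (zigzag j @ z)) x"
  using assms
proof (induction u arbitrary: f)
  case (Cons i u)
  have "word_act d (map (\<lambda>i. i + 2 * j) (i # u)) f (zigzag j @ x) =
      word_act d u (\<lambda>z. gen_act d (i + 2 * j) f (zigzag j @ z)) x"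
    using Cons by simp
  also have "\<dots> = word_act d u (gen_act d i (\<lambda>z. f (zigzag j @ z))) x"
    using Cons.prems by (intro word_act_cong gen_act_shift) auto
  finally show ?case by simp
qed simp

text \<open>Neighbouring cups and caps straighten out; only the cap of the last letter and the cup
  of the first one remain.\<close>

lemma word_act_ascending:
  assumes "1 \<le> c" "c < length x"
  shows "word_act d [1..<Suc c] f x = cap d c (\<lambda>z. f (cup 1 z)) x"
  using assms
proof (induction c arbitrary: x rule: nat_induct_at_least)
  case base
  then show ?case by (simp add: gen_act_def)
next
  case (Suc c)
  have "word_act d [1..<Suc (Suc c)] f x = gen_act d (Suc c) (word_act d [1..<Suc c] f) x"
    by (simp add: word_act_append)
  also have "\<dots> = cap d (Suc c) (\<lambda>z. f (cup 1 z)) x"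
    unfolding gen_act_def using Suc
    by (intro cap_cong) (simp_all add: cap_cup_Suc)
  finally show ?case .
qed

lemma word_act_descending:
  assumes "1 \<le> c" "c \<le> Suc (length y)"
  shows "word_act d (rev [2..<Suc c]) f (cup 1 y) = f (cup c y)"
  using assms
proof (induction c arbitrary: f rule: nat_induct_at_least)
  case base
  then show ?case by simp
next
  case (Suc c)
  have "word_act d (rev [2..<Suc (Suc c)]) f (cup 1 y) = word_act d (rev [2..<Suc c]) (gen_act d (Suc c) f) (cup 1 y)"
    using Suc by simp
  also have "\<dots> = gen_act d (Suc c) f (cup c y)" using Suc by simp
  also have "\<dots> = f (cup (Suc c) y)"
    unfolding gen_act_def using Suc by (intro cap_Suc_cup) auto
  finally show ?case .
qed

text \<open>The runs of the later cups act first, so every cup is moved inside the word that already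
  contains the later ones. This matches the way in which the positions are counted.\<close>

lemma word_act_slide:
  assumes "admissible (length z + 2 * length cs) cs"
  shows "word_act d (slide (2 * j) cs) f (zigzag (j + length cs) @ z) = f (zigzag j @ place True cs z)"
  using assms
proof (induction cs arbitrary: j f)
  case (Cons c cs)
  let ?y = "place True cs z"
  have shift: "rev [2 * j + 2..<Suc (2 * j + c)] = map (\<lambda>i. i + 2 * j) (rev [2..<Suc c])"
    using map_add_upt_shift[of "2 * j" 2 "Suc c"]
    by (simp add: rev_map[symmetric] add.commute del: upt_Suc)
  have "word_act d (slide (2 * j) (c # cs)) f (zigzag (j + length (c # cs)) @ z) =
     word_act d (slide (2 * Suc j) cs) (word_act d (rev [2 * j + 2..<Suc (2 * j + c)]) f)
       (zigzag (Suc j + length cs) @ z)"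
    by (simp add: word_act_append)
  also have "\<dots> = word_act d (rev [2 * j + 2..<Suc (2 * j + c)]) f (zigzag (Suc j) @ ?y)"
    using Cons by (intro Cons.IH) simp
  also have "zigzag (Suc j) @ ?y = zigzag j @ cup 1 ?y" by (simp add: cup_def)
  also have "word_act d (rev [2 * j + 2..<Suc (2 * j + c)]) f (zigzag j @ cup 1 ?y) =
      word_act d (rev [2..<Suc c]) (\<lambda>z. f (zigzag j @ z)) (cup 1 ?y)"
    unfolding shift using Cons.prems by (intro word_act_shift) auto
  also have "\<dots> = f (zigzag j @ cup c ?y)"
    using Cons.prems by (intro word_act_descending) auto
  finally show ?case by (simp add: cup_place1)
qed simp

lemma caps_cong:
  assumes "admissible (length x) cs"
    and "\<And>z. length z + 2 * length cs = length x \<Longrightarrow>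
      minuses x = minuses z + length cs \<Longrightarrow> g z = g' z"
  shows "caps d cs g x = caps d cs g' x"
  using assms
proof (induction cs arbitrary: x)
  case (Cons c cs)
  show ?case unfolding caps.simps
  proof (rule cap_cong)
    fix z :: "bool list" assume z: "length z + 2 = length x" "minuses x = Suc (minuses z)"
    moreover from z have "length z = length x - 2" by simp
    ultimately show "caps d cs g z = caps d cs g' z" using Cons.prems by (intro Cons.IH) auto
  qed (use Cons.prems in simp)
qed simp

lemma caps_scale: "caps d cs (\<lambda>z. c * g z) x = c * caps d cs g x"
proof (induction cs arbitrary: x)
  case (Cons a cs)
  have "caps d cs (\<lambda>z. c * g z) = (\<lambda>x. c * caps d cs g x)" using Cons by auto
  then show ?case by (simp add: cap_linear)
qed simp

text \<open>The generator of the first cup is far from the letters of the later cups and moves next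
  to its own ascending run; together they act as a cap at \<open>c\<close> followed by a new pair in
  front.\<close>

lemma word_act_unslide:
  assumes "admissible (length x) cs"
  shows "word_act d (cup_gens (2 * j) (length cs) @ rev (slide (2 * j) cs)) f (zigzag j @ x) =
    caps d cs (\<lambda>z. f (zigzag (j + length cs) @ z)) x"
  using assms
proof (induction cs arbitrary: j x)
  case (Cons c cs)
  let ?W = "cup_gens (2 * Suc j) (length cs) @ rev (slide (2 * Suc j) cs)"
  define n where "n = length (zigzag j @ x)"
  have c: "1 \<le> c" "c < length x" "admissible (length x - 2) cs" using Cons.prems by auto
  have s: "2 * Suc j + (length x - 2) = n" "2 * Suc j = 2 * j + 2" using c unfolding n_def by auto
  have "set ?W \<subseteq> {2 * j + 3..<n}"
    using set_slide[OF c(3), of "2 * Suc j"] set_cup_gens[OF c(3), of "2 * Suc j"] unfolding s(1)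
    by (auto simp: subset_iff)
  then have W: "\<forall>i\<in>set ?W. 2 * j + 3 \<le> i \<and> i < n" by (auto simp: subset_iff)
  have ends: "Suc (2 * j) # [2 * j + 2..<Suc (2 * j + c)] = map (\<lambda>i. i + 2 * j) [1..<Suc c]"
    using map_add_upt_shift[of "2 * j" 1 "Suc c"] c
    by (simp add: add.commute upt_conv_Cons del: upt_Suc)
  have "red d n ([] @ Suc (2 * j) # ?W @ [2 * j + 2..<Suc (2 * j + c)]) 1
      ([] @ ?W @ Suc (2 * j) # [2 * j + 2..<Suc (2 * j + c)])"
  proof (rule red_swap1)
    show "\<forall>i\<in>set ?W. Suc (2 * j) + 1 < i \<or> i + 1 < Suc (2 * j)"
    proof
      fix i assume "i \<in> set ?W"
      with W have "2 * j + 3 \<le> i" by blast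
      then show "Suc (2 * j) + 1 < i \<or> i + 1 < Suc (2 * j)" by linarith
    qed
    have "set ?W \<subseteq> {1..<n}"
    proof
      fix i assume "i \<in> set ?W"
      with W have "2 * j + 3 \<le> i \<and> i < n" by blast
      then show "i \<in> {1..<n}" by simp
    qed
    moreover have "set (Suc (2 * j) # [2 * j + 2..<Suc (2 * j + c)]) \<subseteq> {1..<n}"
      using c by (auto simp: n_def)
    ultimately show "set ([] @ Suc (2 * j) # ?W @ [2 * j + 2..<Suc (2 * j + c)]) \<subseteq> {1..<n}"
      unfolding set_append set_simps by blast
  qed
  then have "red d n (cup_gens (2 * j) (length (c # cs)) @ rev (slide (2 * j) (c # cs))) 1
      (?W @ map (\<lambda>i. i + 2 * j) [1..<Suc c])"
    unfolding ends[symmetric] by simp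
  from word_act_red[OF d this, of "zigzag j @ x" f]
  have "word_act d (cup_gens (2 * j) (length (c # cs)) @ rev (slide (2 * j) (c # cs))) f (zigzag j @ x) =
      word_act d (map (\<lambda>i. i + 2 * j) [1..<Suc c]) (word_act d ?W f) (zigzag j @ x)"
    by (simp add: n_def word_act_append)
  also have "\<dots> = word_act d [1..<Suc c] (\<lambda>z. word_act d ?W f (zigzag j @ z)) x"
    using c by (intro word_act_shift) auto
  also have "\<dots> = cap d c (\<lambda>z. word_act d ?W f (zigzag j @ cup 1 z)) x"
    using c by (intro word_act_ascending) auto
  also have "\<dots> = cap d c (caps d cs (\<lambda>z. f (zigzag (Suc j + length cs) @ z))) x"
  proof (rule cap_cong[OF c(1)])
    fix z :: "bool list" assume "length z + 2 = length x"
    then have "length z = length x - 2" by simp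
    with c(3) have "word_act d ?W f (zigzag (Suc j) @ z) = caps d cs (\<lambda>z. f (zigzag (Suc j + length cs) @ z)) z"
      by (intro Cons.IH) simp
    then show "word_act d ?W f (zigzag j @ cup 1 z) = caps d cs (\<lambda>z. f (zigzag (Suc j + length cs) @ z)) z"
      by (simp add: cup_def)
  qed
  finally show ?case by simp
qed simp

lemma word_act_normal_word:
  assumes "admissible (length x) cs" "admissible (length x) cs'" "length cs = length cs'"
  shows "word_act d (normal_word cs cs') f x = caps d cs' (\<lambda>z. f (place True cs z)) x"
proof -
  have "word_act d (normal_word cs cs') f x =
     word_act d (cup_gens 0 (length cs') @ rev (slide 0 cs')) (word_act d (slide 0 cs) f) x"
    by (simp add: normal_word_def word_act_append assms(3))
  also have "\<dots> = caps d cs' (\<lambda>z. word_act d (slide 0 cs) f (zigzag (length cs') @ z)) x"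
    using word_act_unslide[OF assms(2), of 0] by simp
  also have "\<dots> = caps d cs' (\<lambda>z. f (place True cs z)) x"
  proof (rule caps_cong[OF assms(2)])
    fix z :: "bool list" assume "length z + 2 * length cs' = length x"
    with word_act_slide[of z cs 0 f] assms
    show "word_act d (slide 0 cs) f (zigzag (length cs') @ z) = f (place True cs z)" by simp
  qed
  finally show ?thesis .
qed

section \<open>Triangularity of the cap functionals\<close>

lemma caps_place_False:
  assumes "admissible (length z + 2 * length cs) cs"
  shows "caps d cs g (place False cs z) = g z"
  using assms
proof (induction cs)
  case (Cons c cs)
  have "cap d c h (place1 False c w) = h w" if "1 \<le> c" "c \<le> Suc (length w)" for h w
    using cap_simps(2)[of c "take (c - 1) w" d h "drop (c - 1) w"] that by (simp add: place1_def)
  with Cons show ?case by simp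
qed simp

lemma caps_few_minuses:
  assumes "admissible (length x) cs" "minuses x < length cs"
  shows "caps d cs g x = 0"
proof -
  have "caps d cs g x = caps d cs (\<lambda>z. 0 * g z) x"
    using assms by (intro caps_cong) auto
  then show ?thesis by (subst (asm) caps_scale) simp
qed

text \<open>With as many caps as minuses, only the all-plus word can remain, so \<open>g\<close>
  enters through a single value. The top and bottom halves of a normal word thus separate into a
  product.\<close>

lemma caps_exact:
  assumes "admissible (length x) cs" "minuses x = length cs"
  shows "caps d cs g x = g (replicate (length x - 2 * length cs) True) * caps d cs (\<lambda>_. 1) x"
proof -
  have "caps d cs g x = caps d cs (\<lambda>z. g (replicate (length x - 2 * length cs) True) * 1) x"
  proof (rule caps_cong[OF assms(1)])
    fix z :: "bool list" assume "length z + 2 * length cs = length x" "minuses x = minuses z + length cs"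
    with assms(2) have "z = replicate (length z) True" "length z = length x - 2 * length cs"
      by (auto intro: all_plus)
    then show "g z = g (replicate (length x - 2 * length cs) True) * 1" by simp
  qed
  then show ?thesis by (simp only: caps_scale)
qed

text \<open>Even with a flip, removing the pair loses no minus in a prefix before it and at most one
  in a prefix beyond it. Putting the pair back as \<open>- +\<close> restores that minus as early as
  possible.\<close>

lemma cap_nonzero:
  assumes "1 \<le> c" "c < length x" "cap d c g x \<noteq> 0"
  obtains x' where "g x' \<noteq> 0" "length x' + 2 = length x" "minuses x = Suc (minuses x')"
    "\<And>y. dominated x' y \<Longrightarrow> length y = length x' \<Longrightarrow> dominated x (place1 False c y)"
proof -
  obtain u a b v where x: "x = u @ a # b # v" "c = Suc (length u)" using word_split[OF assms(1,2)] .
  have dom: "dominated x (place1 False c y)"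
    if y: "dominated (u' @ v') y" "length y = length (u' @ v')" "length u' = length u" "length v' = length v"
      and less: "\<And>t. minuses (take t u) \<le> minuses (take t u')"
      and more: "\<And>t. minuses u + of_bool (\<not> a) + of_bool (\<not> b) + minuses (take t v)
        \<le> Suc (minuses u' + minuses (take t v'))"
    for u' v' y
    unfolding dominated_def
  proof
    fix t
    have D: "minuses (take t (u' @ v')) \<le> minuses (take t y)" for t
      using y(1) unfolding dominated_def by blast
    consider "t \<le> length u" | "t = Suc (length u)" | s where "t = length u + 2 + s"
      by (metis add_2_eq_Suc' le_Suc_ex not_less_eq_eq le_antisym add_Suc_right add_Suc)
    then show "minuses (take t x) \<le> minuses (take t (place1 False c y))"
    proof cases
      case 1
      with D[of t] less[of t] y x show ?thesis by (simp add: place1_def min_def)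
    next
      case 2
      then have "take t (place1 False c y) = take (length u) y @ [False]" "take t x = u @ [a]"
        using y x by (simp_all add: place1_def min_def)
      with D[of "length u"] less[of "length u"] y(3) show ?thesis by simp
    next
      case 3
      have "take s (drop (length u) y) = drop (length u) (take (length u + s) y)"
        by (simp add: drop_take)
      then have "minuses (take (length u) y) + minuses (take s (drop (length u) y))
          = minuses (take (length u + s) y)"
        by (metis count_list_append take_add)
      moreover have "take t (place1 False c y) = take (length u) y @ False # True # take s (drop (length u) y)"
        "take t x = u @ a # b # take s v"
        using y x 3 by (simp_all add: place1_def min_def)
      ultimately show ?thesis using D[of "length u + s"] more[of s] y(3) by (cases a; cases b) simp_all
    qed
  qed
  show thesis
  proof (cases a; cases b)
    assume ab: a b
    with assms(3) obtain v' where v': "flip_minus 0 v = Some v'" "g (u @ v') \<noteq> 0"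
      unfolding x(1) cap_simps(3)[OF x(2)] by (cases "flip_minus 0 v") (auto simp: cap_simps[OF x(2)])
    obtain p q where pq: "v = p @ False # q" "v' = p @ True # q" using flip_minus_split[OF v'(1)] by blast
    have "minuses (take t v) \<le> Suc (minuses (take t v'))" for t
      unfolding pq by (cases "t - length p") auto
    with that[OF v'(2)] dom[of u v'] ab pq x show thesis by auto
  next
    assume ab: a "\<not> b"
    with assms(3) x have "g (u @ v) \<noteq> 0" by (auto simp: cap_simps)
    with that[of "u @ v"] dom[of u v] ab x show thesis by auto
  next
    assume ab: "\<not> a" b
    with assms(3) x have "g (u @ v) \<noteq> 0" by (auto simp: cap_simps)
    with that[of "u @ v"] dom[of u v] ab x show thesis by auto
  next
    assume ab: "\<not> a" "\<not> b"
    with assms(3) obtain u' where u': "flip_plus 0 u = Some u'" "g (u' @ v) \<noteq> 0"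
      unfolding x(1) by (cases "flip_plus 0 u") (auto simp: cap_simps[OF x(2)])
    obtain p q where pq: "u = p @ True # q" "u' = p @ False # q" using flip_plus0_split[OF u'(1)] by blast
    have "minuses (take t u) \<le> minuses (take t u')" for t
      unfolding pq by (cases "t - length p") auto
    with that[OF u'(2)] dom[of u' v] ab pq x show thesis by auto
  qed
qed

lemma caps_nonzero_dominated:
  assumes "admissible (length x) cs" "minuses x = length cs" "caps d cs g x \<noteq> 0"
    "length x = length z + 2 * length cs"
  shows "dominated x (place False cs z)"
  using assms
proof (induction cs arbitrary: x)
  case Nil
  then have "minuses (take t x) = 0" for t
    by (metis append_take_drop_id add_is_0 count_list_append list.size(3))
  then show ?case by (simp add: dominated_def)
next
  case (Cons c cs)
  from Cons.prems have c: "1 \<le> c" "c < length x" and nz: "cap d c (caps d cs g) x \<noteq> 0" by auto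
  obtain x' where x': "caps d cs g x' \<noteq> 0" "length x' + 2 = length x"
    "minuses x = Suc (minuses x')"
    "\<And>y. dominated x' y \<Longrightarrow> length y = length x' \<Longrightarrow> dominated x (place1 False c y)"
    using cap_nonzero[OF c nz] by metis
  from x'(2) have "length x' = length x - 2" by simp
  with Cons x' have "dominated x' (place False cs z)" by (intro Cons.IH) auto
  with x'(2,4) Cons.prems show ?case by auto
qed

end

text \<open>The first cup is the leftmost factor \<open>b, \<not> b\<close> of the word, so the
  positions can be recovered one after the other.\<close>

lemma place_first:
  assumes "admissible L cs" "place b cs (replicate m True) = x @ b # (\<not> b) # y" "cs \<noteq> []"
    "L = m + 2 * length cs"
  shows "hd cs \<le> Suc (length x)"
  using assms
proof (induction cs arbitrary: L y)
  case (Cons c cs)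
  let ?w = "place b cs (replicate m True)"
  show ?case
  proof (rule ccontr)
    assume "\<not> hd (c # cs) \<le> Suc (length x)"
    then have c: "Suc (length x) < c" by simp
    have len: "c - 1 \<le> length ?w" using Cons.prems by auto
    have eq: "take (c - 1) ?w @ b # (\<not> b) # drop (c - 1) ?w = x @ b # (\<not> b) # y"
      using Cons.prems(2) by (simp add: place1_def)
    show False
    proof (cases "c = length x + 2")
      case True
      with arg_cong[OF eq, of "\<lambda>l. l ! (c - 1)"] len show False by (simp add: nth_append)
    next
      case False
      with c have c2: "length x + 2 \<le> c - 1" by simp
      from arg_cong[OF eq, of "take (length x + 2)"] c2 len
      have "take (length x + 2) ?w = x @ [b, \<not> b]" by (simp add: min_def)
      then have w: "?w = x @ b # (\<not> b) # drop (length x + 2) ?w"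
        by (metis append_take_drop_id append.assoc append_Cons append_Nil)
      show False
      proof (cases cs)
        case Nil
        then have "False \<in> set (replicate m True)" using w by (cases b) (auto simp: in_set_conv_decomp)
        then show False by simp
      next
        case (Cons c' cs')
        have "hd cs \<le> Suc (length x)"
          by (rule Cons.IH[of "L - 2"]) (use Cons Cons.prems w in auto)
        with Cons.prems c2 Cons show False by auto
      qed
    qed
  qed
qed simp

lemma place_inject:
  assumes "admissible L cs" "admissible L cs'" "length cs = length cs'" "L = m + 2 * length cs"
    "place b cs (replicate m True) = place b cs' (replicate m True)"
  shows "cs = cs'"
  using assms
proof (induction cs arbitrary: cs' L)
  case (Cons c cs)
  then obtain c' cs1 where cs': "cs' = c' # cs1" by (cases cs') auto
  let ?w = "place b cs (replicate m True)" and ?w' = "place b cs1 (replicate m True)"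
  have len: "c - 1 \<le> length ?w" "c' - 1 \<le> length ?w'" "length ?w = length ?w'"
    using Cons.prems cs' by auto
  have eq: "take (c - 1) ?w @ b # (\<not> b) # drop (c - 1) ?w = take (c' - 1) ?w' @ b # (\<not> b) # drop (c' - 1) ?w'"
    using Cons.prems(5) by (simp add: place1_def cs')
  have P: "place b (c # cs) (replicate m True) = take (c' - 1) ?w' @ b # (\<not> b) # drop (c' - 1) ?w'"
    "place b (c' # cs1) (replicate m True) = take (c - 1) ?w @ b # (\<not> b) # drop (c - 1) ?w"
    unfolding place.simps place1_def using eq by (blast intro: sym)+
  have "c \<le> Suc (length (take (c' - 1) ?w'))"
    using place_first[OF Cons.prems(1) P(1)] Cons.prems(4) by simp
  moreover have "c' \<le> Suc (length (take (c - 1) ?w))"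
    using place_first[OF Cons.prems(2)[unfolded cs'] P(2)] Cons.prems(3,4) cs' by simp
  ultimately have c: "c = c'" using len Cons.prems cs' by auto
  with eq len have "take (c - 1) ?w = take (c - 1) ?w'" "drop (c - 1) ?w = drop (c - 1) ?w'"
    by (auto simp: append_eq_append_conv)
  then have "?w = ?w'" by (metis append_take_drop_id)
  then have "cs = cs1" using Cons.prems cs' by (intro Cons.IH[of "L - 2"]) auto
  with c cs' show ?case by simp
qed simp

definition normal_forms :: "nat \<Rightarrow> (nat list \<times> nat list) set" where
  "normal_forms n = {(cs, cs'). admissible n cs \<and> admissible n cs' \<and> length cs = length cs'}"

lemma admissible_bounds: "admissible L cs \<Longrightarrow> 2 * length cs \<le> L \<and> set cs \<subseteq> {..<L}"
proof (induction cs arbitrary: L)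
  case (Cons c cs)
  from Cons.IH[of "L - 2"] Cons.prems show ?case by (cases cs) auto
qed simp

lemma finite_admissible: "finite {cs. admissible n cs}"
proof (rule finite_subset)
  show "{cs. admissible n cs} \<subseteq> {cs. set cs \<subseteq> {..<n} \<and> length cs \<le> n}"
    using admissible_bounds by fastforce
qed (simp add: finite_lists_length_le)

lemma finite_normal_forms: "finite (normal_forms n)"
  by (rule finite_subset[OF _ finite_cartesian_product[OF finite_admissible finite_admissible]])
    (auto simp: normal_forms_def)

text \<open>Strictly monotone for dominance between words of length \<open>n\<close>; inductions and
  maxima can use a number instead of a partial order.\<close>

definition weight :: "nat \<Rightarrow> bool list \<Rightarrow> nat" where
  "weight n x = (\<Sum>t\<le>n. minuses (take t x))"

lemma dominated_weight: "dominated x y \<Longrightarrow> weight n x \<le> weight n y"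
  unfolding weight_def dominated_def by (intro sum_mono) blast

lemma dominated_antisym:
  assumes "dominated x y" "weight n x = weight n y" "length x = n" "length y = n"
  shows "x = y"
proof (rule nth_equalityI)
  have eq: "minuses (take t x) = minuses (take t y)" if "t \<le> n" for t
    using sum_mono_inv[of "\<lambda>t. minuses (take t x)" "{..n}" "\<lambda>t. minuses (take t y)" t]
      assms(1,2) that unfolding weight_def dominated_def by simp
  fix i assume "i < length x"
  with assms have i: "i < length x" "i < length y" "Suc i \<le> n" "i \<le> n" by auto
  with eq[OF i(3)] eq[OF i(4)] show "x ! i = y ! i"
    by (auto simp: take_Suc_conv_app_nth split: if_splits)
qed (use assms in simp)

text \<open>The cap functionals form a unitriangular system on the words \<open>place False cs\<close>; hence the
  coefficients of a combination of normal words can be recovered integrally from its action.\<close>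

lemma normal_word_coeff_dvd:
  fixes q :: "nat list \<Rightarrow> nat list \<Rightarrow> 'r::comm_ring_1" and b :: "nat \<Rightarrow> 'r"
  assumes d: "\<And>i. d (Suc (Suc i)) = d i"
    and dvd: "\<And>x w. length x = n \<Longrightarrow> length w = n \<Longrightarrow> g dvd b (minuses x) *
      (\<Sum>(cs, cs')\<in>normal_forms n. q cs cs' * word_act d (normal_word cs cs') (\<lambda>z. of_bool (z = w)) x)"
    and mem: "(cs, cs') \<in> normal_forms n"
  shows "g dvd (\<Prod>j\<le>length cs. b j) * q cs cs'"
  using mem
proof (induction "length cs" arbitrary: cs cs' rule: less_induct)
  case less
  define k where "k = length cs"
  define P where "P = (\<Prod>j\<le>k. b j)"
  define T where "T = replicate (n - 2 * k) True"
  define act where "act a a' w x = word_act d (normal_word a a') (\<lambda>z. of_bool (z = w)) x" for a a' w x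
  define V where "V = {a. admissible n a \<and> length a = k}"
  have V: "finite V" unfolding V_def by (rule finite_subset[OF _ finite_admissible]) auto
  have cs: "cs \<in> V" "cs' \<in> V" using less.prems by (auto simp: V_def normal_forms_def k_def)
  have len: "length (place b' a T) = n" if "a \<in> V" for a b'
    using that admissible_bounds by (fastforce simp: V_def T_def)
  have cnt: "minuses (place b' a T) = k" if "a \<in> V" for a b'
    using that by (simp add: V_def T_def)
  \<comment> \<open>At a word with \<open>k\<close> minuses, normal words with more than
    \<open>k\<close> cups vanish, and those with fewer have coefficients that are divisible by
    induction. Among those with \<open>k\<close> cups, the coordinate at \<open>w\<close> selects
    the ones with top half \<open>cs\<close>.\<close>
  have row: "g dvd (\<Sum>a'\<in>V. P * q cs a' * caps d a' (\<lambda>_. 1) x)"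
    if x: "length x = n" "minuses x = k" for x
  proof -
    define w where "w = place True cs T"
    define contr where "contr = (\<lambda>(a, a'). P * q a a' * act a a' w x)"
    have "P = (\<Prod>j<k. b j) * b k" unfolding P_def by (simp add: lessThan_Suc_atMost[symmetric])
    then have "P * s = (\<Prod>j<k. b j) * (b k * s)" for s by (simp add: mult.assoc)
    moreover have "g dvd b k * (\<Sum>(a, a')\<in>normal_forms n. q a a' * act a a' w x)"
      unfolding act_def x(2)[symmetric] by (rule dvd) (use x len cs w_def in auto)
    ultimately have "g dvd P * (\<Sum>(a, a')\<in>normal_forms n. q a a' * act a a' w x)" by simp
    then have tot: "g dvd (\<Sum>p\<in>normal_forms n. contr p)"
      by (simp add: sum_distrib_left contr_def case_prod_unfold mult.assoc)
    have "normal_forms n = {p \<in> normal_forms n. length (fst p) \<noteq> k} \<union> V \<times> V"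
      by (auto simp: normal_forms_def V_def)
    then have "(\<Sum>p\<in>normal_forms n. contr p) =
        (\<Sum>p\<in>{p \<in> normal_forms n. length (fst p) \<noteq> k}. contr p) + (\<Sum>p\<in>V \<times> V. contr p)"
      using finite_normal_forms V
      by (subst sum.union_disjoint[symmetric]) (auto simp: V_def)
    moreover have "g dvd (\<Sum>p\<in>{p \<in> normal_forms n. length (fst p) \<noteq> k}. contr p)"
    proof (rule dvd_sum)
      fix p assume "p \<in> {p \<in> normal_forms n. length (fst p) \<noteq> k}"
      then obtain a a' where p: "p = (a, a')" "(a, a') \<in> normal_forms n" "length a \<noteq> k"
        by (cases p) auto
      then have va: "admissible n a" "admissible n a'" "length a = length a'" by (auto simp: normal_forms_def)
      show "g dvd contr p"
      proof (cases "length a < k")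
        case True
        have "P = (\<Prod>j\<le>length a. b j) * (\<Prod>j\<in>{..k} - {..length a}. b j)"
          unfolding P_def using True by (subst mult.commute, intro prod.subset_diff) auto
        moreover have "g dvd (\<Prod>j\<le>length a. b j) * q a a'"
          using less.hyps[of a a'] True p(2) by (simp add: k_def)
        ultimately show ?thesis unfolding contr_def p(1)
          by (auto simp: dvd_def) (metis mult.assoc mult.commute)
      next
        case False
        then have "act a a' w x = 0" unfolding act_def
          using va x p(3) False word_act_normal_word[where d=d, OF d, of x a a']
            caps_few_minuses[where d=d, OF d, of x a'] by auto
        then show ?thesis by (simp add: contr_def p(1))
      qed
    qed
    ultimately have "g dvd (\<Sum>p\<in>V \<times> V. contr p)"
      using tot by (simp add: dvd_add_right_iff)
    also have "(\<Sum>p\<in>V \<times> V. contr p) = (\<Sum>a\<in>V. \<Sum>a'\<in>V. contr (a, a'))"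
      by (simp add: sum.cartesian_product)
    also have "\<dots> = (\<Sum>a\<in>V. if a = cs then \<Sum>a'\<in>V. P * q cs a' * caps d a' (\<lambda>_. 1) x else 0)"
    proof (rule sum.cong[OF refl])
      fix a assume a: "a \<in> V"
      have "act a a' w x = of_bool (a = cs) * caps d a' (\<lambda>_. 1) x" if a': "a' \<in> V" for a'
      proof -
        have va: "admissible (length x) a" "admissible (length x) a'" "length a = length a'" "minuses x = length a'"
          using a a' x by (auto simp: V_def)
        have "act a a' w x = caps d a' (\<lambda>z. of_bool (place True a z = w)) x"
          unfolding act_def by (rule word_act_normal_word[where d=d, OF d va(1-3)])
        also have "\<dots> = of_bool (place True a (replicate (length x - 2 * length a') True) = w) * caps d a' (\<lambda>_. 1) x"
          by (rule caps_exact[where d=d, OF d va(2,4)])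
        also have "replicate (length x - 2 * length a') True = T"
          using a' x by (simp add: V_def T_def)
        finally have "act a a' w x = of_bool (place True a T = w) * caps d a' (\<lambda>_. 1) x" .
        moreover have "place True a T = w \<longleftrightarrow> a = cs"
          using place_inject[of n a cs "n - 2 * k" True] a cs admissible_bounds[of n a]
          unfolding w_def T_def by (auto simp: V_def)
        ultimately show ?thesis by simp
      qed
      then show "(\<Sum>a'\<in>V. contr (a, a')) = (if a = cs then \<Sum>a'\<in>V. P * q cs a' * caps d a' (\<lambda>_. 1) x else 0)"
        by (simp add: contr_def)
    qed
    finally show ?thesis using V cs by simp
  qed
  define bad where "bad = {a' \<in> V. \<not> g dvd P * q cs a'}"
  \<comment> \<open>Take \<open>a\<close> bad of maximal weight and evaluate at
    \<open>place False a T\<close>. Another bad \<open>a'\<close> with a nonzero value there would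
    give a word of larger weight. So modulo \<open>g\<close> only the term of \<open>a\<close>
    remains, and its functional has value 1.\<close>
  have "bad = {}"
  proof (rule ccontr)
    assume "bad \<noteq> {}"
    moreover have fin: "finite bad" unfolding bad_def using V by simp
    ultimately have "Max ((\<lambda>a. weight n (place False a T)) ` bad) \<in> (\<lambda>a. weight n (place False a T)) ` bad"
      by (intro Max_in) auto
    then obtain a where a: "a \<in> bad" "\<And>a'. a' \<in> bad \<Longrightarrow> weight n (place False a' T) \<le> weight n (place False a T)"
      using fin by (smt (verit) Max_ge finite_imageI image_iff)
    then have aV: "a \<in> V" by (simp add: bad_def)
    let ?x = "place False a T"
    have "g dvd P * q cs a' * caps d a' (\<lambda>_. 1) ?x" if a': "a' \<in> V" "a' \<noteq> a" for a'
    proof (cases "a' \<in> bad \<and> caps d a' (\<lambda>_. 1) ?x \<noteq> 0")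
      case True
      then have "dominated ?x (place False a' T)"
        using a' len[OF aV] cnt[OF aV] admissible_bounds[of n a']
        by (intro caps_nonzero_dominated[where d=d, OF d]) (auto simp: V_def T_def)
      moreover from this have "weight n ?x = weight n (place False a' T)"
        using dominated_weight a(2) True by (metis le_antisym)
      ultimately have "?x = place False a' T" using len aV a' by (intro dominated_antisym[of _ _ n]) auto
      then have "a = a'" using place_inject[of n a a' "n - 2 * k" False] aV a' admissible_bounds[of n a]
        unfolding T_def by (auto simp: V_def)
      with a' show ?thesis by simp
    qed (use a' in \<open>auto simp: bad_def\<close>)
    then have "g dvd (\<Sum>a'\<in>V - {a}. P * q cs a' * caps d a' (\<lambda>_. 1) ?x)" by (intro dvd_sum) auto
    moreover have "(\<Sum>a'\<in>V. P * q cs a' * caps d a' (\<lambda>_. 1) ?x) =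
        P * q cs a * caps d a (\<lambda>_. 1) ?x + (\<Sum>a'\<in>V - {a}. P * q cs a' * caps d a' (\<lambda>_. 1) ?x)"
      using V aV by (rule sum.remove)
    ultimately have "g dvd P * q cs a * caps d a (\<lambda>_. 1) ?x"
      using row[of ?x] len cnt aV by (simp add: dvd_add_left_iff)
    moreover have "caps d a (\<lambda>_. 1) ?x = 1"
      using caps_place_False[where d=d, OF d, of T a] aV admissible_bounds[of n a] by (simp add: V_def T_def)
    ultimately show False using a(1) by (simp add: bad_def)
  qed
  with cs show ?case unfolding bad_def P_def k_def by blast
qed


section \<open>Invariant vectors\<close>

definition words :: "nat \<Rightarrow> nat \<Rightarrow> bool list set" where
  "words n k = {w. length w = n \<and> minuses w = k}"

lemma finite_words: "finite (words n k)"
  by (rule finite_subset[OF _ finite_lists_length_eq[of UNIV n]]) (auto simp: words_def)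

abbreviation delta :: "bool list \<Rightarrow> bool list \<Rightarrow> 'r::comm_ring_1" where
  "delta w \<equiv> \<lambda>z. of_bool (z = w)"

lemma sum_delta:
  fixes f :: "bool list \<Rightarrow> 'r::comm_ring_1"
  assumes "z \<in> words n k"
  shows "f z = (\<Sum>w\<in>words n k. f w * delta w z)"
proof -
  have "(\<Sum>w\<in>words n k. f w * delta w z) = (\<Sum>w\<in>words n k. if w = z then f w else 0)"
    by (intro sum.cong) auto
  then show ?thesis using assms finite_words by simp
qed

lemma word_act_expand:
  assumes "x \<in> words n k" "0 \<notin> set u"
  shows "word_act d u f x = (\<Sum>w\<in>words n k. f w * word_act d u (delta w) x)"
proof -
  have "word_act d u f x = word_act d u (\<lambda>z. \<Sum>w\<in>words n k. f w * delta w z) x"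
    using assms by (intro word_act_cong sum_delta) (auto simp: words_def)
  then show ?thesis by (simp only: word_act_sum word_act_linear)
qed

text \<open>Multiply each run \<open>e_j ... e_(s+1)\<close> by \<open>e_i\<close> on the left. For
  \<open>j + 1 < i\<close> the letter \<open>e_i\<close> moves to the right end, for
  \<open>j > i + 1\<close> the letter \<open>e_(i+2)\<close> does; both are killed by
  \<open>\<Lambda>\<close>. The terms \<open>j = i - 1, i, i + 1\<close> are multiples of the same
  \<open>e_i ... e_(s+1)\<close>, and the recurrence cancels them. The value \<open>x n = 0\<close>
  stands for the missing term when \<open>i = n - 1\<close>. The functional is abstract because the
  argument serves both the invariant vectors and the generic projector.\<close>

lemma descent_annihilates:
  fixes x :: "nat \<Rightarrow> 'r::comm_ring_1"
  assumes d: "\<And>i. d (Suc (Suc i)) = d i"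
    and scale: "\<And>c f. \<Lambda> (\<lambda>z. c * f z) = c * \<Lambda> f"
    and cong: "\<And>f g. (\<And>z. length z = n \<Longrightarrow> f z = g z) \<Longrightarrow> \<Lambda> f = \<Lambda> g"
    and kill: "\<And>i f. s + 2 \<le> i \<Longrightarrow> i < n \<Longrightarrow> \<Lambda> (gen_act d i f) = 0"
    and x: "\<And>j. 1 \<le> j \<Longrightarrow> j < n \<Longrightarrow> x (j - 1) + d j * x j + x (Suc j) = 0" "x n = 0"
    and i: "s < i" "i < n"
  shows "(\<Sum>j\<in>{s..<n}. x j * \<Lambda> (word_act d (rev [Suc s..<Suc j]) (gen_act d i f))) = 0"
proof -
  define A where "A j = \<Lambda> (word_act d (i # rev [Suc s..<Suc j]) f)" for j
  define B where "B = \<Lambda> (word_act d (rev [Suc s..<Suc i]) f)"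
  have eq: "\<Lambda> (word_act d u f) = c * \<Lambda> (word_act d v f)" if "red d n u c v" for u c v
    using cong[of "word_act d u f" "\<lambda>z. c * word_act d v f z"] word_act_red[OF d that] scale by simp
  have zero: "\<Lambda> (word_act d (u @ [j]) f) = 0" if "s + 2 \<le> j" "j < n" for u j
    using kill[OF that] by (simp add: word_act_append)
  have A: "A j = (if j = i - 1 \<or> j = Suc i then 1 else if j = i then d i else 0) * B"
    if j: "s \<le> j" "j < n" for j
  proof -
    consider "Suc j < i" | "j = i - 1" | "j = i" | "j = Suc i" | "Suc i < j" using i by linarith
    then show ?thesis
    proof cases
      case 1
      have "red d n ([] @ i # rev [Suc s..<Suc j] @ []) 1 ([] @ rev [Suc s..<Suc j] @ i # [])"
        using 1 i j by (intro red_swap1) auto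
      then have "red d n (i # rev [Suc s..<Suc j]) 1 (rev [Suc s..<Suc j] @ [i])" by (simp del: upt_Suc)
      from eq[OF this] zero[of i "rev [Suc s..<Suc j]"] 1 i j have "A j = 0"
        unfolding A_def by (simp del: upt_Suc)
      with 1 show ?thesis by auto
    next
      case 2
      then have "i # rev [Suc s..<Suc j] = rev [Suc s..<Suc i]" using i by simp
      with 2 i show ?thesis unfolding A_def B_def by simp
    next
      case 3
      have "rev [Suc s..<Suc i] = i # rev [Suc s..<i]" using i by simp
      then have "red d n (i # rev [Suc s..<Suc i]) (d i) (rev [Suc s..<Suc i])"
        using red.squared[of "[]" i "rev [Suc s..<i]" n d] i by (simp del: upt_Suc)
      moreover have "i \<noteq> i - 1" using i by simp
      ultimately show ?thesis using eq[of "i # rev [Suc s..<Suc i]"] 3 unfolding A_def B_def by auto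
    next
      case 4
      have "red d n (i # rev [Suc s..<Suc (Suc i)]) 1 (rev [i + 2..<Suc (Suc i)] @ rev [Suc s..<Suc i])"
        using i j 4 by (intro red_absorb) auto
      from eq[OF this] 4 show ?thesis unfolding A_def B_def by simp
    next
      case 5
      have "red d n (i # rev [Suc s..<Suc j]) 1 (rev [i + 2..<Suc j] @ rev [Suc s..<Suc i])"
        using i j 5 by (intro red_absorb) auto
      moreover have "red d n ([] @ rev [i + 2..<Suc j] @ rev [Suc s..<Suc i] @ []) 1
          ([] @ rev [Suc s..<Suc i] @ rev [i + 2..<Suc j] @ [])"
        using i j 5 by (intro red_swap) auto
      moreover have "rev [i + 2..<Suc j] = rev [i + 3..<Suc j] @ [i + 2]"
        using 5 upt_conv_Cons[of "i + 2" "Suc j"] by (simp add: numeral_3_eq_3 del: upt_Suc)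
      ultimately have "red d n (i # rev [Suc s..<Suc j]) 1 ((rev [Suc s..<Suc i] @ rev [i + 3..<Suc j]) @ [i + 2])"
        by (elim red_step1) (simp_all del: upt_Suc)
      from eq[OF this] zero[of "i + 2" "rev [Suc s..<Suc i] @ rev [i + 3..<Suc j]"] i j 5
      show ?thesis unfolding A_def by auto
    qed
  qed
  have "(\<Sum>j\<in>{s..<n}. x j * A j) = (\<Sum>j\<in>{s..<n}. x j * ((if j = i - 1 \<or> j = Suc i then 1 else if j = i then d i else 0) * B))"
    using A by (intro sum.cong) auto
  also have "\<dots> = (\<Sum>j\<in>{s..n}. x j * ((if j = i - 1 \<or> j = Suc i then 1 else if j = i then d i else 0) * B))"
    using x(2) by (intro sum.mono_neutral_left) (auto simp: le_less)
  also have "\<dots> = (\<Sum>j\<in>{i - 1, i, Suc i}. x j * ((if j = i - 1 \<or> j = Suc i then 1 else if j = i then d i else 0) * B))"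
    using i by (intro sum.mono_neutral_right) auto
  also have "\<dots> = (x (i - 1) + d i * x i + x (Suc i)) * B"
    using i by (cases i) (simp_all add: algebra_simps)
  also have "\<dots> = 0" using x(1)[of i] i by simp
  finally show ?thesis by (simp add: A_def)
qed

definition pairing :: "nat \<Rightarrow> nat \<Rightarrow> (bool list \<Rightarrow> 'r::comm_ring_1) \<Rightarrow> (bool list \<Rightarrow> 'r) \<Rightarrow> 'r" where
  "pairing n k v f = (\<Sum>w\<in>words n k. v w * f w)"

text \<open>For the vector with coordinates \<open>v w\<close>, the pairing with
  \<open>delta u\<close> composed with \<open>e_i\<close> is the coordinate of the image under
  \<open>e_i\<close> at \<open>u\<close>.\<close>

definition invariant :: "(nat \<Rightarrow> 'r::comm_ring_1) \<Rightarrow> nat \<Rightarrow> nat \<Rightarrow> (bool list \<Rightarrow> 'r) \<Rightarrow> bool" where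
  "invariant d n k v \<longleftrightarrow> (\<forall>i\<in>{1..<n}. \<forall>u\<in>words n k. pairing n k v (gen_act d i (delta u)) = 0)"

lemma pairing_scale: "pairing n k v (\<lambda>z. c * f z) = c * pairing n k v f"
  by (simp add: pairing_def sum_distrib_left mult_ac)

lemma pairing_sum: "pairing n k v (\<lambda>z. \<Sum>a\<in>A. f a z) = (\<Sum>a\<in>A. pairing n k v (f a))"
  unfolding pairing_def by (subst sum.swap) (simp add: sum_distrib_left)

lemma pairing_cong: "(\<And>z. z \<in> words n k \<Longrightarrow> f z = g z) \<Longrightarrow> pairing n k v f = pairing n k v g"
  unfolding pairing_def by (intro sum.cong) auto

lemma pairing_delta: "u \<in> words n k \<Longrightarrow> pairing n k v (delta u) = v u"
  using sum_delta[of u n k v] by (simp add: pairing_def eq_commute)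

lemma gen_act_before_cup:
  assumes "i = Suc (length u)" "length w = length u + 2 + length y"
    "gen_act d i (delta (u @ True # False # y)) w \<noteq> 0"
  shows "w = u @ True # False # y \<or> w = u @ False # True # y \<or>
     (\<exists>y1. w = u @ True # True # y1 \<and> flip_minus 0 y1 = Some y) \<or>
     (\<exists>u1. w = u1 @ False # False # y \<and> flip_plus 0 u1 = Some u)"
proof -
  obtain p a b q where w: "w = p @ a # b # q" "i = Suc (length p)"
    using word_split[of i w] assms(1,2) by (metis One_nat_def Suc_eq_plus1 add_2_eq_Suc' add_Suc_right
        le_add2 less_add_Suc1 plus_1_eq_Suc add_Suc)
  with assms(1) have len: "length p = length u" by simp
  show ?thesis
  proof (cases "\<not> a \<and> \<not> b")
    case True
    then obtain u1 where u1: "flip_plus 0 p = Some u1" "u1 @ True # False # q = u @ True # False # y"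
      using assms(3) unfolding w(1) by (cases "flip_plus 0 p") (auto simp: gen_act_simps[OF w(2)])
    then have "length u1 = length u" using len flip_plus_length by metis
    with u1 True show ?thesis unfolding w(1) by auto
  next
    case False
    then show ?thesis using assms(3) len unfolding w(1)
      by (cases a; cases b) (auto simp: gen_act_simps[OF w(2)] opt_def split: option.splits)
  qed
qed

text \<open>Among the words whose image under \<open>e_i\<close> involves \<open>u + - y\<close>,
  the largest is the one with \<open>- +\<close> in place of the pair. This makes the equations of
  invariance triangular.\<close>

lemma gen_act_before_cup_dominated:
  assumes "i = Suc (length u)" "length w = length u + 2 + length y"
    "gen_act d i (delta (u @ True # False # y)) w \<noteq> 0"
  shows "dominated w (u @ False # True # y)"
proof -
  from gen_act_before_cup[OF assms] consider "w = u @ True # False # y" | "w = u @ False # True # y"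
    | y1 where "w = u @ True # True # y1" "flip_minus 0 y1 = Some y"
    | u1 where "w = u1 @ False # False # y" "flip_plus 0 u1 = Some u" by blast
  then show ?thesis
  proof cases
    case 1
    then show ?thesis unfolding dominated_def by (auto simp: take_Cons' )
  next
    case 2
    then show ?thesis by (simp add: dominated_def)
  next
    case 3
    obtain p q where pq: "y1 = p @ False # q" "y = p @ True # q" using flip_minus_split[OF 3(2)] by blast
    have "minuses (take t y1) \<le> Suc (minuses (take t y))" for t
      unfolding pq by (cases "t - length p") auto
    with 3 show ?thesis unfolding dominated_def by (auto simp: take_Cons')
  next
    case 4
    obtain p q where pq: "u1 = p @ True # q" "u = p @ False # q" using flip_plus0_split[OF 4(2)] by blast
    have "minuses (take t u1) \<le> minuses (take t u)" for t
      unfolding pq by (cases "t - length p") auto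
    moreover have "minuses u = Suc (minuses u1)" "length u = length u1"
      using 4(2) flip_count(2) flip_plus_length by blast+
    ultimately show ?thesis unfolding dominated_def 4(1)
      by (auto simp: take_Cons' le_SucI)
  qed
qed

lemma no_ascent:
  "(\<And>u y. w \<noteq> u @ False # True # y) \<Longrightarrow>
     w = replicate (count_list w True) True @ replicate (minuses w) False"
proof (induction w)
  case (Cons b w)
  have "w \<noteq> u @ False # True # y" for u y using Cons.prems[of "b # u" y] by auto
  note IH = Cons.IH[OF this]
  show ?case
  proof (cases b)
    case True
    with IH show ?thesis by simp
  next
    case False
    have "count_list w True = 0"
    proof (rule ccontr)
      assume "count_list w True \<noteq> 0"
      then obtain m where "count_list w True = Suc m" by (cases "count_list w True") auto
      with IH have "b # w = [] @ False # True # (replicate m True @ replicate (minuses w) False)"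
        using False by simp
      with Cons.prems show False by blast
    qed
    with IH False show ?thesis by simp
  qed
qed simp

definition sorted_word :: "nat \<Rightarrow> nat \<Rightarrow> bool list" where
  "sorted_word n k = replicate (n - k) True @ replicate k False"

definition antisorted_word :: "nat \<Rightarrow> nat \<Rightarrow> bool list" where
  "antisorted_word n k = replicate k False @ replicate (n - k) True"

text \<open>An invariant vector is determined by its coordinate at \<open>sorted_word\<close>: pairing with
  \<open>e\<^sub>i\<close> applied to the coordinate functional of \<open>u + - y\<close> expresses the coordinate at \<open>u - + y\<close>
  through coordinates at words with smaller weight.\<close>

lemma invariant_dvd:
  assumes inv: "invariant d n k v" and dvd: "g dvd v (sorted_word n k)" and w: "w \<in> words n k"
  shows "g dvd v w"
  using w
proof (induction "weight n w" arbitrary: w rule: less_induct)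
  case less
  show ?case
  proof (cases "\<exists>u y. w = u @ False # True # y")
    case False
    have "count_list w True + minuses w = length w" by (induction w) auto
    moreover have "length w = n" "minuses w = k" using less.prems by (auto simp: words_def)
    ultimately have "count_list w True = n - k" "minuses w = k" by auto
    moreover have "w = replicate (count_list w True) True @ replicate (minuses w) False"
      by (rule no_ascent) (use False in blast)
    ultimately have "w = sorted_word n k" by (simp add: sorted_word_def)
    with dvd show ?thesis by simp
  next
    case True
    then obtain u y where wuy: "w = u @ False # True # y" by blast
    define i where "i = Suc (length u)"
    let ?\<delta> = "gen_act d i (delta (u @ True # False # y))"
    have "u @ True # False # y \<in> words n k" "i \<in> {1..<n}"
      using less.prems wuy by (auto simp: words_def i_def)
    with inv have "(\<Sum>z\<in>words n k. v z * ?\<delta> z) = 0" unfolding invariant_def pairing_def by blast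
    moreover have "(\<Sum>z\<in>words n k. v z * ?\<delta> z) = v w * ?\<delta> w + (\<Sum>z\<in>words n k - {w}. v z * ?\<delta> z)"
      using less.prems finite_words by (intro sum.remove)
    moreover have "?\<delta> w = 1" unfolding wuy by (simp add: gen_act_simps(2)[OF i_def])
    ultimately have "v w = - (\<Sum>z\<in>words n k - {w}. v z * ?\<delta> z)" by (simp add: eq_neg_iff_add_eq_0)
    moreover have "g dvd v z * ?\<delta> z" if z: "z \<in> words n k - {w}" for z
    proof (cases "?\<delta> z = 0")
      case False
      have "dominated z w" unfolding wuy
        by (rule gen_act_before_cup_dominated[OF i_def _ False]) (use z less.prems wuy in \<open>auto simp: words_def\<close>)
      moreover from this z less.prems have "weight n z \<noteq> weight n w"
        using dominated_antisym[of z w n] by (auto simp: words_def)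
      ultimately have "weight n z < weight n w" using dominated_weight le_neq_implies_less by blast
      with less.hyps z show ?thesis by simp
    qed simp
    then have "g dvd (\<Sum>z\<in>words n k - {w}. v z * ?\<delta> z)" by (rule dvd_sum)
    ultimately show ?thesis by simp
  qed
qed

lemma pairing_invariant:
  assumes "invariant d n k v" "i \<in> {1..<n}"
  shows "pairing n k v (gen_act d i f) = 0"
proof -
  have "pairing n k v (gen_act d i f) =
      pairing n k v (\<lambda>z. \<Sum>w\<in>words n k. f w * gen_act d i (delta w) z)"
    using word_act_expand[of _ n k "[i]" d f] assms(2) by (intro pairing_cong) auto
  also have "\<dots> = 0"
    using assms by (simp add: pairing_sum pairing_scale invariant_def)
  finally show ?thesis .
qed

text \<open>A leading minus has no partner and is not a plus that could be flipped, so no cap at a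
  later place reaches it. The shift of the index exchanges the colours when \<open>d\<close> is
  \<open>loop\<close>.\<close>

lemma gen_act_Cons_False:
  assumes "1 \<le> i" "i < length w"
  shows "gen_act d (Suc i) f (False # w) = gen_act (\<lambda>i. d (Suc i)) i (\<lambda>z. f (False # z)) w"
proof -
  obtain u a b y where w: "w = u @ a # b # y" "i = Suc (length u)" using word_split[OF assms] .
  have "flip_plus 0 (False # u) = map_option (Cons False) (flip_plus 0 u)"
    using flip_plus_append[of 0 "[False]" u] flip_plus_snoc(2)[of "height 0 (mirror u)" "[]"]
    by (auto split: option.splits)
  moreover have "Suc i = Suc (length (False # u))" using w by simp
  note gen_act_simps[OF this, of d f y, unfolded append_Cons]
  ultimately show ?thesis unfolding w(1)
    by (cases a; cases b) (simp_all add: gen_act_simps[OF w(2)])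
qed


section \<open>Two-colored quantum numbers\<close>

definition qnum :: "bool \<Rightarrow> nat \<Rightarrow> zxy" where
  "qnum c m = (if c then qnum_s m else qnum_t m)"

definition qvar :: "bool \<Rightarrow> zxy" where
  "qvar c = (if c then x_s else x_t)"

definition qfact :: "bool \<Rightarrow> nat \<Rightarrow> zxy" where
  "qfact c n = (\<Prod>m = 1..n. qnum c m)"

text \<open>The sign is that of \<open>e_i^2 = -[2] e_i\<close>; \<open>c\<close> is the colour of
  the odd generators.\<close>

definition loop :: "bool \<Rightarrow> nat \<Rightarrow> zxy" where
  "loop c i = - qvar (odd i = c)"

lemma qnum_simps [simp]:
  "qnum c 0 = 0" "qnum c (Suc 0) = 1"
  "qnum c (Suc (Suc m)) = qvar c * qnum (\<not> c) (Suc m) - qnum c m"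
  by (simp_all add: qnum_def qvar_def)

text \<open>Exchanging the colours fixes the odd quantum numbers, while an even one is its own
  variable times a polynomial common to both colours. Multiplying crosswise avoids naming that
  polynomial.\<close>

lemma qnum_parity:
  "if even m then qvar (\<not> c) * qnum c m = qvar c * qnum (\<not> c) m else qnum c m = qnum (\<not> c) m"
proof (induction m arbitrary: c rule: induct_nat_012)
  case (ge2 m)
  from ge2.IH(1)[of c] ge2.IH(2)[of c] show ?case
    by (auto simp: algebra_simps split: if_splits)
qed auto

lemma qnum_even: "even m \<Longrightarrow> qvar (\<not> c) * qnum c m = qvar c * qnum (\<not> c) m"
  and qnum_odd: "odd m \<Longrightarrow> qnum c m = qnum (\<not> c) m"
  using qnum_parity[of m c] by auto

lemma qnum_Suc: "1 \<le> m \<Longrightarrow> qnum c (Suc m) = qvar (c = odd m) * qnum c m - qnum c (m - 1)"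
  using qnum_even[of m c] qnum_odd[of m c] by (cases m; cases "even m") auto

text \<open>At \<open>x_s = x_t = 2\<close> the recursion gives the integer
  \<open>m\<close>.\<close>

lemma qnum_nonzero: assumes "m \<ge> 1" shows "qnum c m \<noteq> 0"
proof -
  have "poly (poly (qnum c m) [:2:]) 2 = int m" for c m
  proof (induction m arbitrary: c rule: induct_nat_012)
    case (ge2 m)
    then show ?case by (auto simp: qvar_def x_s_def x_t_def)
  qed auto
  from this[of c m] assms show ?thesis by auto
qed

lemma qvar_nonzero: "qvar c \<noteq> 0"
  by (simp add: qvar_def x_s_def x_t_def)

lemma qfact_Suc: "qfact c (Suc n) = qnum c (Suc n) * qfact c n"
  by (simp add: qfact_def mult.commute)

lemma qfact_nonzero: "qfact c n \<noteq> 0"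
  using qnum_nonzero by (auto simp: qfact_def)

text \<open>Only the \<open>n div 2\<close> even factors depend on the colour, each in the ratio of
  the two variables.\<close>

lemma qfact_swap: "qvar (\<not> c) ^ (n div 2) * qfact c n = qvar c ^ (n div 2) * qfact (\<not> c) n"
proof (induction n)
  case (Suc n)
  show ?case
  proof (cases "even n")
    case True
    with qnum_odd[of "Suc n" c] Suc show ?thesis by (simp add: qfact_Suc mult.left_commute)
  next
    case False
    then have "Suc n div 2 = Suc (n div 2)" by (auto elim!: oddE)
    then have "qvar (\<not> c) ^ (Suc n div 2) * qfact c (Suc n) =
      (qvar (\<not> c) * qnum c (Suc n)) * (qvar (\<not> c) ^ (n div 2) * qfact c n)"
      by (simp only: qfact_Suc power_Suc mult_ac)
    also have "\<dots> = (qvar c * qnum (\<not> c) (Suc n)) * (qvar c ^ (n div 2) * qfact (\<not> c) n)"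
      using False qnum_even[of "Suc n" c] Suc by simp
    finally show ?thesis using \<open>Suc n div 2 = _\<close> by (simp only: qfact_Suc power_Suc mult_ac)
  qed
qed (simp add: qfact_def)

lemma loop_period: "loop c (Suc (Suc i)) = loop c i"
  by (simp add: loop_def)

lemma loop_Suc: "loop c (Suc i) = loop (\<not> c) i"
  by (auto simp: loop_def intro: arg_cong[where f=qvar])

text \<open>The coefficients of the one-strand symmetriser \<open>\<Sum>\<^sub>j [n - j] e\<^sub>j \<dots> e\<^sub>s\<^sub>+\<^sub>1\<close>; the colour is
  the one for which \<open>[2]\<close> belongs to \<open>e\<^sub>n\<^sub>-\<^sub>1\<close>.\<close>

definition sym_coeff :: "bool \<Rightarrow> nat \<Rightarrow> nat \<Rightarrow> zxy" where
  "sym_coeff c n j = qnum (c = even n) (n - j)"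

lemma sym_coeff_rec:
  assumes "1 \<le> j" "j < n"
  shows "sym_coeff c n (j - 1) + loop c j * sym_coeff c n j + sym_coeff c n (Suc j) = 0"
proof -
  have "n - (j - 1) = Suc (n - j)" "n - Suc j = n - j - 1" "1 \<le> n - j" using assms by auto
  moreover have "((c = even n) = odd (n - j)) = (odd j = c)" using assms by auto
  ultimately show ?thesis
    by (simp add: sym_coeff_def loop_def qnum_Suc)
qed

lemma sym_coeff_n: "sym_coeff c n n = 0"
  by (simp add: sym_coeff_def)

text \<open>\<open>E'\<close> belongs to the other colour. The powers that \<open>qfact_swap\<close>
  produces on the two sides cancel if the colour is changed before the new factor enters for even
  \<open>n\<close>, and afterwards for odd \<open>n\<close>; otherwise the numbers of even factors
  would differ.\<close>

lemma qbinom_recursion: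
  assumes n: "n = Suc (k + a)"
    and E: "E * qnum (c = even n) (Suc k) = qnum (c = even n) n * E'"
    and E': "E' * (qfact (\<not> c) k * qfact (\<not> c) a) = qfact (\<not> c) (k + a)"
  shows "E * (qfact c (Suc k) * qfact c a) = qfact c n"
proof (cases "even n")
  case True
  let ?N = "(k + a) div 2"
  have N: "?N = k div 2 + a div 2" using True n by (auto elim!: evenE oddE)
  have "qvar (\<not> c) ^ ?N * (E * (qfact c (Suc k) * qfact c a)) =
     (E * qnum c (Suc k)) * ((qvar (\<not> c) ^ (k div 2) * qfact c k) * (qvar (\<not> c) ^ (a div 2) * qfact c a))"
    by (simp add: N power_add qfact_Suc mult_ac)
  also have "\<dots> = qnum c n * (qvar c ^ ?N * (E' * (qfact (\<not> c) k * qfact (\<not> c) a)))"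
    using E True unfolding qfact_swap by (simp add: N power_add mult_ac)
  also have "\<dots> = qnum c n * (qvar (\<not> c) ^ ?N * qfact c (k + a))"
    unfolding E' qfact_swap ..
  also have "\<dots> = qvar (\<not> c) ^ ?N * qfact c n"
    by (simp add: n qfact_Suc mult_ac)
  finally show ?thesis using qvar_nonzero by simp
next
  case False
  let ?N = "n div 2"
  have N: "?N = Suc k div 2 + a div 2" using False n by presburger
  have e: "(c = even n) = (\<not> c)" using False by auto
  have E1: "E * (qfact (\<not> c) (Suc k) * qfact (\<not> c) a) = qfact (\<not> c) n"
  proof -
    have "E * (qfact (\<not> c) (Suc k) * qfact (\<not> c) a) =
        (E * qnum (\<not> c) (Suc k)) * (qfact (\<not> c) k * qfact (\<not> c) a)"
      by (simp only: qfact_Suc mult_ac)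
    also have "\<dots> = qnum (\<not> c) n * (E' * (qfact (\<not> c) k * qfact (\<not> c) a))"
      using E unfolding e by (simp only: mult_ac)
    also have "\<dots> = qfact (\<not> c) n" unfolding E' n qfact_Suc ..
    finally show ?thesis .
  qed
  have "qvar (\<not> c) ^ ?N * (E * (qfact c (Suc k) * qfact c a)) =
     E * ((qvar (\<not> c) ^ (Suc k div 2) * qfact c (Suc k)) * (qvar (\<not> c) ^ (a div 2) * qfact c a))"
    unfolding N by (simp only: power_add mult_ac)
  also have "\<dots> = qvar c ^ ?N * (E * (qfact (\<not> c) (Suc k) * qfact (\<not> c) a))"
    unfolding qfact_swap N by (simp only: power_add mult_ac)
  also have "\<dots> = qvar (\<not> c) ^ ?N * qfact c n" unfolding E1 qfact_swap ..
  finally show ?thesis using qvar_nonzero by simp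
qed

lemma count_replicate [simp]: "count_list (replicate k b) c = (if b = c then k else 0)"
  by (induction k) auto

lemma words_0: "words n 0 = {replicate n True}"
  using all_plus by (auto simp: words_def)

lemma cup_neq_antisorted:
  assumes "j - 1 \<le> length z" shows "cup j z \<noteq> antisorted_word n k"
proof
  assume eq: "cup j z = antisorted_word n k"
  with assms have "antisorted_word n k ! (j - 1)" "\<not> antisorted_word n k ! Suc (j - 1)"
    "Suc (j - 1) < length (antisorted_word n k)"
    unfolding eq[symmetric] by (simp_all add: cup_def nth_append)
  then show False by (auto simp: antisorted_word_def nth_append simp del: replicate_Suc split: if_splits)
qed

lemma ex_invariant:
  assumes "k \<le> n"
  shows "\<exists>v. invariant (loop c) n k v \<and> v (sorted_word n k) = 1 \<and>
    v (antisorted_word n k) * (qfact c k * qfact c (n - k)) = qfact c n"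
  using assms
proof (induction k arbitrary: n c)
  case 0
  have "invariant (loop c) n 0 (\<lambda>_. 1)"
    unfolding invariant_def
  proof (intro ballI)
    fix i u assume i: "i \<in> {1..<n}"
    have "n = (i - 1) + Suc (Suc (n - i - 1))" using i by auto
    then have split: "replicate n True = replicate (i - 1) True @ True # True # replicate (n - i - 1) True"
      by (metis replicate_Suc replicate_add)
    have "flip_minus h (replicate m True) = None" for h m
      by (induction m arbitrary: h) auto
    then have "gen_act (loop c) i f (replicate n True) = 0" for f
      unfolding split using i by (subst gen_act_simps(3)) auto
    then show "pairing n 0 (\<lambda>_. 1) (gen_act (loop c) i (delta u)) = 0"
      by (simp add: pairing_def words_0)
  qed
  then show ?case by (intro exI[of _ "\<lambda>_. 1"]) (simp add: qfact_def)
next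
  case (Suc k)
  define m where "m = n - 1"
  define a where "a = n - Suc k"
  have n: "n = Suc m" "n = Suc (k + a)" "m - k = a" "k \<le> m" using Suc.prems by (auto simp: m_def a_def)
  obtain v' where v': "invariant (loop (\<not> c)) m k v'" "v' (sorted_word m k) = 1"
    "v' (antisorted_word m k) * (qfact (\<not> c) k * qfact (\<not> c) a) = qfact (\<not> c) m"
    using Suc.IH[OF n(4), of "\<not> c"] unfolding n(3) by blast
  \<comment> \<open>\<open>\<Lambda>\<close> represents the vector \<open>v'\<close> with a minus in
    front, which is killed by \<open>e_2, ..., e_(n-1)\<close>; \<open>z\<close> is its image under
    the one-strand symmetriser.\<close>
  define \<Lambda> where "\<Lambda> f = pairing m k v' (\<lambda>w. f (False # w))" for f
  let ?run = "\<lambda>j. rev [Suc 0..<Suc j]"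
  define x where "x = sym_coeff c n"
  define z where "z u = (\<Sum>j\<in>{0..<n}. x j * \<Lambda> (word_act (loop c) (?run j) (delta u)))" for u
  define e where "e = qnum (c = even n) (Suc k)"
  have e: "e \<noteq> 0" unfolding e_def by (rule qnum_nonzero) simp
  have \<Lambda>_scale: "\<Lambda> (\<lambda>z. r * f z) = r * \<Lambda> f" for r f
    unfolding \<Lambda>_def by (rule pairing_scale)
  have \<Lambda>_cong: "\<Lambda> f = \<Lambda> g" if "\<And>z. length z = n \<Longrightarrow> f z = g z" for f g
    unfolding \<Lambda>_def using that n(1) by (intro pairing_cong) (auto simp: words_def)
  have \<Lambda>_kill: "\<Lambda> (gen_act (loop c) i f) = 0" if i: "0 + 2 \<le> i" "i < n" for i f
  proof -
    obtain i' where i': "i = Suc i'" "i' \<in> {1..<m}" using i n(1) by (cases i) auto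
    have "\<Lambda> (gen_act (loop c) i f) = pairing m k v' (gen_act (loop (\<not> c)) i' (\<lambda>z. f (False # z)))"
      unfolding \<Lambda>_def i'(1) using i'(2) gen_act_Cons_False[of i' _ "loop c" f]
      by (intro pairing_cong) (simp add: words_def loop_Suc)
    also have "\<dots> = 0" by (rule pairing_invariant[OF v'(1) i'(2)])
    finally show ?thesis .
  qed
  have \<Lambda>_delta: "\<Lambda> (delta (False # u)) = v' u" if "u \<in> words m k" for u
    using pairing_delta[OF that, of v'] by (simp add: \<Lambda>_def)
  have z_pairing: "pairing n (Suc k) z f = (\<Sum>j\<in>{0..<n}. x j * \<Lambda> (word_act (loop c) (?run j) f))" for f
  proof -
    have "\<Lambda> (word_act (loop c) (?run j) f) =
        (\<Sum>u\<in>words n (Suc k). f u * \<Lambda> (word_act (loop c) (?run j) (delta u)))" for j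
    proof -
      have "\<Lambda> (word_act (loop c) (?run j) f) =
          \<Lambda> (\<lambda>z. \<Sum>u\<in>words n (Suc k). f u * word_act (loop c) (?run j) (delta u) z)"
        unfolding \<Lambda>_def
        by (intro pairing_cong word_act_expand) (auto simp: words_def n(1))
      then show ?thesis by (simp add: \<Lambda>_def pairing_sum pairing_scale)
    qed
    then show ?thesis
      unfolding pairing_def z_def
      by (simp add: sum_distrib_left sum_distrib_right, subst sum.swap) (simp add: mult_ac)
  qed
  have z_inv: "invariant (loop c) n (Suc k) z"
    unfolding invariant_def
  proof (intro ballI)
    fix i u assume i: "i \<in> {1..<n}"
    show "pairing n (Suc k) z (gen_act (loop c) i (delta u)) = 0"
      unfolding z_pairing x_def
    proof (rule descent_annihilates)
      show "\<Lambda> (\<lambda>z. r * f z) = r * \<Lambda> f" for r f by (rule \<Lambda>_scale)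
      show "\<Lambda> f = \<Lambda> g" if "\<And>z. length z = n \<Longrightarrow> f z = g z" for f g using that by (rule \<Lambda>_cong)
      show "\<Lambda> (gen_act (loop c) i f) = 0" if "0 + 2 \<le> i" "i < n" for i f using that by (rule \<Lambda>_kill)
    qed (use loop_period sym_coeff_rec sym_coeff_n i in auto)
  qed
  \<comment> \<open>\<open>e_1\<close> sends \<open>- + y\<close> to \<open>+ - y\<close> and kills
    \<open>- - y\<close>, since no sign on the left can be flipped. The rest of the run moves the
    pair to place \<open>j\<close>.\<close>
  have run: "\<Lambda> (word_act (loop c) (?run j) f) = pairing m k v' (\<lambda>w. if w \<noteq> [] \<and> hd w then f (cup j (tl w)) else 0)"
    if j: "1 \<le> j" "j < n" for j f
    unfolding \<Lambda>_def
  proof (rule pairing_cong)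
    fix w assume w: "w \<in> words m k"
    have "?run j = rev [2..<Suc j] @ [1]" using j by (simp add: upt_conv_Cons[of "Suc 0"] numeral_2_eq_2 del: upt_Suc)
    then have "word_act (loop c) (?run j) f (False # w) =
        cap (loop c) 1 (\<lambda>z. word_act (loop c) (rev [2..<Suc j]) f (cup 1 z)) (False # w)"
      by (simp only: word_act_append word_act.simps gen_act_def)
    also have "\<dots> = cap (loop c) 1 (\<lambda>z. f (cup j z)) (False # w)"
      using j w n(1) word_act_descending[of "loop c", OF loop_period]
      by (intro cap_cong) (auto simp: words_def)
    also have "\<dots> = (if w \<noteq> [] \<and> hd w then f (cup j (tl w)) else 0)"
      by (cases w) (auto simp: cap_def opt_def)
    finally show "word_act (loop c) (?run j) f (False # w) =
        (if w \<noteq> [] \<and> hd w then f (cup j (tl w)) else 0)" .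
  qed
  \<comment> \<open>Every nonempty run creates a factor \<open>+ -\<close>, which this word lacks,
    so only the term \<open>j = 0\<close> with coefficient \<open>[n]\<close> contributes.\<close>
  have z_anti: "z (antisorted_word n (Suc k)) = x 0 * v' (antisorted_word m k)"
  proof -
    have "\<Lambda> (word_act (loop c) (?run j) (delta (antisorted_word n (Suc k)))) = 0" if "1 \<le> j" "j < n" for j
      unfolding run[OF that] pairing_def
      using that n(1) by (intro sum.neutral ballI) (auto simp: words_def cup_neq_antisorted)
    then have "z (antisorted_word n (Suc k)) = (\<Sum>j\<in>{0..<n}. if j = 0 then x 0 * \<Lambda> (delta (antisorted_word n (Suc k))) else 0)"
      unfolding z_def by (intro sum.cong) auto
    also have "\<dots> = x 0 * \<Lambda> (delta (antisorted_word n (Suc k)))" using n(1) by simp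
    also have "\<Lambda> (delta (antisorted_word n (Suc k))) = v' (antisorted_word m k)"
    proof -
      have "antisorted_word n (Suc k) = False # antisorted_word m k"
        using n by (simp add: antisorted_word_def)
      moreover have "antisorted_word m k \<in> words m k" using n by (simp add: antisorted_word_def words_def)
      ultimately show ?thesis using \<Lambda>_delta by simp
    qed
    finally show ?thesis .
  qed
  \<comment> \<open>The only possible factor \<open>+ -\<close> of this word is at place
    \<open>a\<close>, so the term \<open>j = a\<close> alone contributes, with coefficient
    \<open>[n - a]\<close>; for \<open>a = 0\<close> it is the term of the empty run.\<close>
  have z_sorted: "z (sorted_word n (Suc k)) = e"
  proof -
    have sw: "sorted_word n (Suc k) = replicate a True @ replicate (Suc k) False"
      unfolding sorted_word_def a_def ..
    have term0: "\<Lambda> (delta (sorted_word n (Suc k))) = of_bool (a = 0)"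
    proof (cases a)
      case 0
      then have "sorted_word n (Suc k) = False # sorted_word m k"
        using n sw by (simp add: sorted_word_def)
      moreover have "sorted_word m k \<in> words m k" using n by (simp add: sorted_word_def words_def)
      ultimately show ?thesis using \<Lambda>_delta v'(2) 0 by simp
    next
      case (Suc b)
      then show ?thesis unfolding \<Lambda>_def sw by (simp add: pairing_def)
    qed
    have termj: "\<Lambda> (word_act (loop c) (?run j) (delta (sorted_word n (Suc k)))) = of_bool (j = a)"
      if j: "1 \<le> j" "j < n" for j
    proof -
      have "(if w \<noteq> [] \<and> hd w then delta (sorted_word n (Suc k)) (cup j (tl w)) else 0) =
          of_bool (j = a) * delta (sorted_word m k) w" if w: "w \<in> words m k" for w
      proof (cases "w \<noteq> [] \<and> hd w")
        case True
        then obtain y where y: "w = True # y" by (cases w) auto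
        with w j n(1) have len: "j - 1 \<le> length y" by (auto simp: words_def)
        have "cup j y = sorted_word n (Suc k) \<longleftrightarrow> j = a \<and> w = sorted_word m k"
        proof
          assume eq: "cup j y = sorted_word n (Suc k)"
          then have "sorted_word n (Suc k) ! (j - 1)" "\<not> sorted_word n (Suc k) ! Suc (j - 1)"
            "Suc (j - 1) < length (sorted_word n (Suc k))"
            using len unfolding eq[symmetric] by (simp_all add: cup_def nth_append)
          then have ja: "j = a" using j unfolding sw by (auto simp: nth_append simp del: replicate_Suc split: if_splits)
          with j obtain b where b: "a = Suc b" by (cases a) auto
          have "take b y @ True # False # drop b y = replicate b True @ True # False # replicate k False"
            using eq unfolding sw cup_def ja b by (simp add: replicate_app_Cons_same)
          then have "take b y = replicate b True" "drop b y = replicate k False"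
            using len ja b by (auto simp: append_eq_append_conv min_def)
          then have "y = replicate b True @ replicate k False" by (metis append_take_drop_id)
          with y b n ja show "j = a \<and> w = sorted_word m k" by (simp add: sorted_word_def)
        next
          assume h: "j = a \<and> w = sorted_word m k"
          with j obtain b where b: "a = Suc b" by (cases a) auto
          with h y n have "y = replicate b True @ replicate k False" by (simp add: sorted_word_def)
          with h b sw show "cup j y = sorted_word n (Suc k)"
            by (simp add: cup_def replicate_app_Cons_same)
        qed
        with y show ?thesis by auto
      next
        case False
        have "w \<noteq> sorted_word m k" if "j = a"
          using False that j n by (cases a) (auto simp: sorted_word_def)
        with False show ?thesis by auto
      qed
      then have "\<Lambda> (word_act (loop c) (?run j) (delta (sorted_word n (Suc k)))) =
          pairing m k v' (\<lambda>w. of_bool (j = a) * delta (sorted_word m k) w)"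
        unfolding run[OF j] by (intro pairing_cong)
      also have "\<dots> = of_bool (j = a) * v' (sorted_word m k)"
        unfolding pairing_scale using n by (subst pairing_delta) (auto simp: words_def sorted_word_def)
      finally show ?thesis using v'(2) by simp
    qed
    have "z (sorted_word n (Suc k)) = (\<Sum>j\<in>{0..<n}. if j = a then x j else 0)"
      unfolding z_def
    proof (intro sum.cong refl)
      fix j assume "j \<in> {0..<n}"
      then show "x j * \<Lambda> (word_act (loop c) (?run j) (delta (sorted_word n (Suc k)))) = (if j = a then x j else 0)"
        using term0 termj[of j] by (cases "j = 0") auto
    qed
    also have "\<dots> = x a" using n(2) by simp
    also have "\<dots> = e"
    proof -
      have "n - a = Suc k" using n(2) by simp
      then show ?thesis unfolding x_def sym_coeff_def e_def by simp
    qed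
    finally show ?thesis .
  qed
  \<comment> \<open>Invariance spreads divisibility from the sorted coordinate, which is
    \<open>e\<close> itself, to all others, so \<open>z\<close> can be divided by \<open>e\<close>
    inside the polynomial ring.\<close>
  have dvd: "e dvd z w" if "w \<in> words n (Suc k)" for w
    using invariant_dvd[OF z_inv _ that, of e] z_sorted by simp
  define v where "v w = z w div e" for w
  have v: "v w * e = z w" if "w \<in> words n (Suc k)" for w
    using dvd[OF that] by (simp add: v_def)
  have "invariant (loop c) n (Suc k) v"
    unfolding invariant_def
  proof (intro ballI)
    fix i u assume i: "i \<in> {1..<n}"
    have "e * pairing n (Suc k) v (gen_act (loop c) i (delta u)) = pairing n (Suc k) z (gen_act (loop c) i (delta u))"
      unfolding pairing_def sum_distrib_left using v by (intro sum.cong) (auto simp: mult_ac)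
    also have "\<dots> = 0" using pairing_invariant[OF z_inv i] .
    finally show "pairing n (Suc k) v (gen_act (loop c) i (delta u)) = 0" using e by simp
  qed
  moreover have "v (sorted_word n (Suc k)) = 1" using z_sorted e by (simp add: v_def)
  moreover have "v (antisorted_word n (Suc k)) * (qfact c (Suc k) * qfact c a) = qfact c n"
  proof (rule qbinom_recursion[OF n(2), of _ _ "v' (antisorted_word m k)"])
    have "antisorted_word n (Suc k) \<in> words n (Suc k)" using n by (simp add: antisorted_word_def words_def)
    from v[OF this] show "v (antisorted_word n (Suc k)) * qnum (c = even n) (Suc k) =
        qnum (c = even n) n * v' (antisorted_word m k)"
      unfolding z_anti by (simp add: e_def x_def sym_coeff_def)
    show "v' (antisorted_word m k) * (qfact (\<not> c) k * qfact (\<not> c) a) = qfact (\<not> c) (k + a)"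
      using v'(3) n by simp
  qed
  ultimately show ?case unfolding a_def by blast
qed

lemma qbinom_eq: "k \<le> n \<Longrightarrow> E * (qfact True k * qfact True (n - k)) = qfact True n \<Longrightarrow> qbinom_s n k = E"
proof -
  have "qfact True m = qfact_s m" for m by (simp add: qfact_def qfact_s_def qnum_def)
  moreover have "qfact True m \<noteq> 0" for m by (rule qfact_nonzero)
  ultimately show "E * (qfact True k * qfact True (n - k)) = qfact True n \<Longrightarrow> qbinom_s n k = E"
    unfolding qbinom_s_def by (metis mult_eq_0_iff nonzero_mult_div_cancel_right)
qed


section \<open>The two-colored Temperley--Lieb algebra\<close>

abbreviation single :: "'a \<Rightarrow> 'b \<Rightarrow> 'a \<Rightarrow>\<^sub>0 'b::zero" where
  "single \<equiv> Poly_Mapping.single"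

abbreviation lookup :: "('a \<Rightarrow>\<^sub>0 'b::zero) \<Rightarrow> 'a \<Rightarrow> 'b" where
  "lookup \<equiv> Poly_Mapping.lookup"

abbreviation keys :: "('a \<Rightarrow>\<^sub>0 'b::zero) \<Rightarrow> 'a set" where
  "keys \<equiv> Poly_Mapping.keys"

section \<open>Linear extension of the action to the free algebra\<close>

definition eval_act :: "(nat \<Rightarrow> 'r::comm_ring_1) \<Rightarrow> (nat list \<Rightarrow>\<^sub>0 'r) \<Rightarrow> (bool list \<Rightarrow> 'r) \<Rightarrow> bool list \<Rightarrow> 'r" where
  "eval_act d y f x = (\<Sum>u\<in>keys y. lookup y u * word_act d u f x)"

lemma eval_act_superset:
  "finite A \<Longrightarrow> keys y \<subseteq> A \<Longrightarrow> eval_act d y f x = (\<Sum>u\<in>A. lookup y u * word_act d u f x)"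
  unfolding eval_act_def by (intro sum.mono_neutral_left) (auto simp: in_keys_iff)

lemma eval_act_add: "eval_act d (y + y') f x = eval_act d y f x + eval_act d y' f x"
proof -
  let ?A = "keys y \<union> keys y'"
  have "keys (y + y') \<subseteq> ?A" by (rule keys_add)
  then show ?thesis
    by (simp add: eval_act_superset[of ?A] lookup_add ring_distribs sum.distrib)
qed

lemma eval_act_zero [simp]: "eval_act d 0 f x = 0"
  by (simp add: eval_act_def)

lemma eval_act_uminus: "eval_act d (- y) f x = - eval_act d y f x"
  using eval_act_add[of d y "- y" f x] by (simp add: eq_neg_iff_add_eq_0 add.commute)

lemma eval_act_diff: "eval_act d (y - y') f x = eval_act d y f x - eval_act d y' f x"
  using eval_act_add[of d y "- y'" f x] by (simp add: eval_act_uminus)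

lemma eval_act_sum: "eval_act d (\<Sum>a\<in>A. y a) f x = (\<Sum>a\<in>A. eval_act d (y a) f x)"
  by (induction A rule: infinite_finite_induct) (simp_all add: eval_act_add)

lemma eval_act_single [simp]: "eval_act d (single u c) f x = c * word_act d u f x"
  using eval_act_superset[of "{u}" "single u c" d f x] by (auto split: if_splits)

lemma sum_single_lookup: "(\<Sum>u\<in>keys y. single u (lookup y u)) = y"
proof (rule poly_mapping_eqI)
  fix u
  have "(\<Sum>v\<in>keys y. (lookup y v when v = u)) =
      (\<Sum>v\<in>keys y. if v = u then lookup y u else 0)"
    by (intro sum.cong) (auto simp: when_def)
  then show "lookup (\<Sum>u\<in>keys y. single u (lookup y u)) u =
      lookup y u"
    by (simp add: lookup_sum lookup_single in_keys_iff)
qed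

lemma mult_eq_sum_single:
  fixes y y' :: "nat list \<Rightarrow>\<^sub>0 'r::comm_ring_1"
  shows "y * y' = (\<Sum>u\<in>keys y. \<Sum>v\<in>keys y'.
    single (u @ v) (lookup y u * lookup y' v))"
proof -
  have "y * y' = (\<Sum>u\<in>keys y. single u (lookup y u)) *
    (\<Sum>u\<in>keys y'. single u (lookup y' u))"
    unfolding sum_single_lookup ..
  then show ?thesis by (simp add: sum_product mult_single plus_list_def)
qed

lemma eval_act_mult: "eval_act d (y * y') f x = eval_act d y' (eval_act d y f) x"
proof -
  have "eval_act d (y * y') f x = (\<Sum>u\<in>keys y. \<Sum>v\<in>keys y'.
      lookup y u * lookup y' v * word_act d (u @ v) f x)"
    unfolding mult_eq_sum_single by (simp add: eval_act_sum)
  also have "\<dots> = eval_act d y' (eval_act d y f) x"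
    unfolding eval_act_def[abs_def] word_act_sum word_act_linear word_act_append
    by (subst sum.swap) (simp add: sum_distrib_left mult_ac)
  finally show ?thesis .
qed

lemma lookup_mult_Nil:
  fixes y y' :: "nat list \<Rightarrow>\<^sub>0 'r::comm_ring_1"
  shows "lookup (y * y') [] = lookup y [] * lookup y' []"
proof -
  have "lookup (y * y') [] = (\<Sum>u\<in>keys y. \<Sum>v\<in>keys y'.
      if u = [] then if v = [] then lookup y [] * lookup y' [] else 0 else 0)"
    unfolding mult_eq_sum_single lookup_sum
    by (intro sum.cong) (auto simp: lookup_single when_def)
  also have "\<dots> = (\<Sum>u\<in>keys y. if u = [] then
      (\<Sum>v\<in>keys y'. if v = [] then lookup y [] * lookup y' [] else 0) else 0)"
    by (intro sum.cong) auto
  also have "\<dots> = lookup y [] * lookup y' []"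
    by (simp add: in_keys_iff)
  finally show ?thesis .
qed

lemma eval_act_linear: "eval_act d y (\<lambda>z. c * f z) x = c * eval_act d y f x"
  by (simp add: eval_act_def word_act_linear sum_distrib_left mult_ac)

lemma eval_act_fun_sum: "eval_act d y (\<lambda>z. \<Sum>a\<in>A. f a z) x = (\<Sum>a\<in>A. eval_act d y (f a) x)"
  unfolding eval_act_def word_act_sum sum_distrib_left by (rule sum.swap)

section \<open>The ideal of relations and normal forms\<close>

definition tl_loop :: "'r::comm_ring_1 \<Rightarrow> 'r \<Rightarrow> nat \<Rightarrow> 'r" where
  "tl_loop a b i = (if odd i then - a else - b)"

lemma tl_loop_period: "tl_loop a b (Suc (Suc i)) = tl_loop a b i"
  by (simp add: tl_loop_def)

lemma carrier_free_alg: "p \<in> carrier (free_alg n) \<longleftrightarrow> keys p \<subseteq> lists {1..<n}"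
  by (simp add: free_alg_def)

lemma free_alg_simps [simp]:
  "x \<otimes>\<^bsub>free_alg n\<^esub> y = x * y" "x \<oplus>\<^bsub>free_alg n\<^esub> y = x + y"
  "\<one>\<^bsub>free_alg n\<^esub> = single [] 1" "\<zero>\<^bsub>free_alg n\<^esub> = 0"
  by (simp_all add: free_alg_def single_one[symmetric] zero_list_def)

lemma free_alg_closed:
  "p \<in> carrier (free_alg n) \<Longrightarrow> q \<in> carrier (free_alg n) \<Longrightarrow> p + q \<in> carrier (free_alg n)"
  "p \<in> carrier (free_alg n) \<Longrightarrow> q \<in> carrier (free_alg n) \<Longrightarrow> p * q \<in> carrier (free_alg n)"
  "p \<in> carrier (free_alg n) \<Longrightarrow> - p \<in> carrier (free_alg n)"
  "p \<in> carrier (free_alg n) \<Longrightarrow> q \<in> carrier (free_alg n) \<Longrightarrow> p - q \<in> carrier (free_alg n)"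
  "0 \<in> carrier (free_alg n)"
  "set u \<subseteq> {1..<n} \<Longrightarrow> single u c \<in> carrier (free_alg n)"
proof -
  interpret ring "free_alg n" by (rule ring_free_alg)
  show "p \<in> carrier (free_alg n) \<Longrightarrow> q \<in> carrier (free_alg n) \<Longrightarrow> p + q \<in> carrier (free_alg n)"
    using a_closed[of p q] by simp
  show "p \<in> carrier (free_alg n) \<Longrightarrow> q \<in> carrier (free_alg n) \<Longrightarrow> p * q \<in> carrier (free_alg n)"
    using m_closed[of p q] by simp
  show "p \<in> carrier (free_alg n) \<Longrightarrow> - p \<in> carrier (free_alg n)"
    by (simp add: carrier_free_alg)
  show "p \<in> carrier (free_alg n) \<Longrightarrow> q \<in> carrier (free_alg n) \<Longrightarrow> p - q \<in> carrier (free_alg n)"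
    using keys_diff[of p q] by (auto simp: carrier_free_alg)
  show "0 \<in> carrier (free_alg n)" by (simp add: carrier_free_alg)
  show "set u \<subseteq> {1..<n} \<Longrightarrow> single u c \<in> carrier (free_alg n)"
    by (auto simp: carrier_free_alg)
qed

lemma free_alg_sum:
  "(\<And>a. a \<in> A \<Longrightarrow> f a \<in> carrier (free_alg n)) \<Longrightarrow> (\<Sum>a\<in>A. f a) \<in> carrier (free_alg n)"
  by (induction A rule: infinite_finite_induct) (auto simp: free_alg_closed)

lemma free_alg_a_inv:
  assumes "p \<in> carrier (free_alg n)" shows "\<ominus>\<^bsub>free_alg n\<^esub> p = - p"
proof -
  interpret ring "free_alg n" by (rule ring_free_alg)
  show ?thesis using assms free_alg_closed(3)[OF assms] by (intro minus_equality) auto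
qed

lemma word_Nil: "word [] = 1"
  by (simp only: zero_list_def[symmetric] single_one)

lemma tl_ideal_closed:
  shows tl_ideal_add: "p \<in> tl_ideal a b n \<Longrightarrow> q \<in> tl_ideal a b n \<Longrightarrow> p + q \<in> tl_ideal a b n"
    and tl_ideal_uminus: "p \<in> tl_ideal a b n \<Longrightarrow> - p \<in> tl_ideal a b n"
    and tl_ideal_left: "p \<in> tl_ideal a b n \<Longrightarrow> x \<in> carrier (free_alg n) \<Longrightarrow> x * p \<in> tl_ideal a b n"
    and tl_ideal_right: "p \<in> tl_ideal a b n \<Longrightarrow> x \<in> carrier (free_alg n) \<Longrightarrow> p * x \<in> tl_ideal a b n"
    and tl_ideal_zero: "0 \<in> tl_ideal a b n"
    and tl_ideal_carrier: "p \<in> tl_ideal a b n \<Longrightarrow> p \<in> carrier (free_alg n)"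
proof -
  interpret ideal "tl_ideal a b n" "free_alg n" by (rule ideal_tl_ideal)
  show carr: "p \<in> carrier (free_alg n)" if "p \<in> tl_ideal a b n" for p using Icarr that .
  show "p \<in> tl_ideal a b n \<Longrightarrow> q \<in> tl_ideal a b n \<Longrightarrow> p + q \<in> tl_ideal a b n"
    using additive_subgroup.a_closed[OF is_additive_subgroup, of p q] by simp
  show "p \<in> tl_ideal a b n \<Longrightarrow> - p \<in> tl_ideal a b n"
    using additive_subgroup.a_inv_closed[OF is_additive_subgroup, of p] free_alg_a_inv[OF carr] by simp
  show "p \<in> tl_ideal a b n \<Longrightarrow> x \<in> carrier (free_alg n) \<Longrightarrow> x * p \<in> tl_ideal a b n"
    using I_l_closed[of p x] by simp
  show "p \<in> tl_ideal a b n \<Longrightarrow> x \<in> carrier (free_alg n) \<Longrightarrow> p * x \<in> tl_ideal a b n"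
    using I_r_closed[of p x] by simp
  show "0 \<in> tl_ideal a b n" using additive_subgroup.zero_closed[OF is_additive_subgroup] by simp
qed

lemma tl_ideal_sum: "(\<And>x. x \<in> A \<Longrightarrow> f x \<in> tl_ideal a b n) \<Longrightarrow> (\<Sum>x\<in>A. f x) \<in> tl_ideal a b n"
  by (induction A rule: infinite_finite_induct) (auto simp: tl_ideal_zero tl_ideal_add)

lemma tl_relator_red:
  assumes "r \<in> tl_relators a b n"
  shows "\<exists>u c v. r = word u - single v c \<and> red (tl_loop a b) n u c v \<and> u \<noteq> [] \<and> set u \<subseteq> {1..<n}"
  using assms unfolding tl_relators_def
proof (elim UnE CollectE exE conjE)
  fix i assume "r = word [i, i] - single [i] (- a)" "i \<in> {1..<n}" "odd i"
  with red.squared[of "[]" i "[]" n "tl_loop a b"] show ?thesis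
    by (intro exI[of _ "[i, i]"] exI[of _ "- a"] exI[of _ "[i]"]) (simp add: tl_loop_def)
next
  fix i assume "r = word [i, i] - single [i] (- b)" "i \<in> {1..<n}" "even i"
  with red.squared[of "[]" i "[]" n "tl_loop a b"] show ?thesis
    by (intro exI[of _ "[i, i]"] exI[of _ "- b"] exI[of _ "[i]"]) (simp add: tl_loop_def)
next
  fix i j assume "r = word [i, j] - word [j, i]" "i \<in> {1..<n}" "j \<in> {1..<n}" "i + 1 < j \<or> j + 1 < i"
  with red.far[of "[]" i j "[]" n "tl_loop a b"] show ?thesis
    by (intro exI[of _ "[i, j]"] exI[of _ 1] exI[of _ "[j, i]"]) simp
next
  fix i j assume "r = word [i, j, i] - word [i]" "i \<in> {1..<n}" "j \<in> {1..<n}" "j = i + 1 \<or> i = j + 1"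
  with red.zig[of "[]" i j "[]" n "tl_loop a b"] show ?thesis
    by (intro exI[of _ "[i, j, i]"] exI[of _ 1] exI[of _ "[i]"]) auto
qed

text \<open>The common kernel \<open>K\<close> of the action and of the coefficient of the empty
  word is an ideal containing the relators. That coefficient is multiplicative because a
  concatenation is empty only if both parts are.\<close>

lemma tl_ideal_eval:
  fixes p :: "nat list \<Rightarrow>\<^sub>0 'r::comm_ring_1"
  assumes "p \<in> tl_ideal a b n"
  shows "lookup p [] = 0" and "length x = n \<Longrightarrow> eval_act (tl_loop a b) p f x = 0"
proof -
  let ?d = "tl_loop a b"
  define K where "K = {p \<in> carrier (free_alg n). lookup p [] = 0 \<and>
    (\<forall>f x. length x = n \<longrightarrow> eval_act ?d p f x = 0)}"
  have cong: "word_act ?d u f x = word_act ?d u (\<lambda>_. 0) x"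
    if "set u \<subseteq> {1..<n}" "length x = n" "\<And>z. length z = n \<Longrightarrow> f z = 0" for u f x
    using that by (intro word_act_cong) auto
  interpret ring "free_alg n :: (nat list \<Rightarrow>\<^sub>0 'r) ring" by (rule ring_free_alg)
  have "ideal K (free_alg n)"
  proof (rule idealI[OF ring_free_alg])
    show "subgroup K (add_monoid (free_alg n))"
    proof
      show "K \<subseteq> carrier (add_monoid (free_alg n))" by (auto simp: K_def)
      show "x \<otimes>\<^bsub>add_monoid (free_alg n)\<^esub> y \<in> K" if "x \<in> K" "y \<in> K" for x y
        using that by (auto simp: K_def free_alg_closed eval_act_add lookup_add)
      show "\<one>\<^bsub>add_monoid (free_alg n)\<^esub> \<in> K" by (auto simp: K_def free_alg_closed)
      show "inv\<^bsub>add_monoid (free_alg n)\<^esub> x \<in> K" if "x \<in> K" for x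
        using that free_alg_a_inv[of x n] unfolding a_inv_def[symmetric]
        by (auto simp: K_def free_alg_closed eval_act_uminus)
    qed
    fix p x :: "nat list \<Rightarrow>\<^sub>0 'r" assume px: "p \<in> K" "x \<in> carrier (free_alg n)"
    then show "x \<otimes>\<^bsub>free_alg n\<^esub> p \<in> K"
      by (auto simp: K_def free_alg_closed lookup_mult_Nil eval_act_mult)
    have "eval_act ?d x (eval_act ?d p f) z = 0" if "length z = n" for f z
      unfolding eval_act_def[of _ x]
    proof (rule sum.neutral, rule ballI)
      fix u assume "u \<in> keys x"
      with px have "set u \<subseteq> {1..<n}" by (auto simp: carrier_free_alg)
      from cong[OF this that, of "eval_act ?d p f"] px(1)
      show "lookup x u * word_act ?d u (eval_act ?d p f) z = 0" by (simp add: K_def)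
    qed
    with px show "p \<otimes>\<^bsub>free_alg n\<^esub> x \<in> K"
      by (auto simp: K_def free_alg_closed lookup_mult_Nil eval_act_mult)
  qed
  moreover have "tl_relators a b n \<subseteq> K"
  proof
    fix r :: "nat list \<Rightarrow>\<^sub>0 'r" assume r: "r \<in> tl_relators a b n"
    from tl_relator_red[OF r] obtain u c v where uv: "r = word u - single v c"
      "red ?d n u c v" "u \<noteq> []" by blast
    moreover from uv red_Nil have "v \<noteq> []" by blast
    moreover have "r \<in> carrier (free_alg n)" using r tl_relators_subset by blast
    ultimately show "r \<in> K"
      by (auto simp: K_def lookup_minus lookup_single eval_act_diff word_act_red[OF tl_loop_period uv(2)])
  qed
  ultimately have "tl_ideal a b n \<subseteq> K"
    unfolding tl_ideal_def by (rule genideal_minimal)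
  with assms show "lookup p [] = 0" "length x = n \<Longrightarrow> eval_act ?d p f x = 0"
    by (auto simp: K_def)
qed

lemma tl_ideal_red:
  fixes a b c :: "'r::comm_ring_1"
  shows "red (tl_loop a b) n u c v \<Longrightarrow> set u \<subseteq> {1..<n} \<Longrightarrow>
    word u - single v c \<in> tl_ideal a b n"
proof (induction rule: red.induct)
  case (self u)
  then show ?case by (simp add: tl_ideal_zero)
next
  case (chain u c v c' w)
  then have "word v - single w c' \<in> tl_ideal a b n" using red_set by blast
  then have "single [] c * (word v - single w c') \<in> tl_ideal a b n"
    by (intro tl_ideal_left free_alg_closed) auto
  with chain have "(word u - single v c) + single [] c * (word v - single w c')
      \<in> tl_ideal a b n" by (intro tl_ideal_add) auto
  then show ?case by (simp add: right_diff_distrib mult_single plus_list_def)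
next
  have rel: "word x * r * word y \<in> tl_ideal a b n"
    if "r \<in> tl_relators a b n" "set (x @ y) \<subseteq> {1..<n}" for x y r
  proof -
    interpret ring "free_alg n :: (nat list \<Rightarrow>\<^sub>0 'r) ring" by (rule ring_free_alg)
    have "r \<in> tl_ideal a b n" unfolding tl_ideal_def
      using genideal_self[OF tl_relators_subset, of a b] that by blast
    then show ?thesis using that by (intro tl_ideal_left tl_ideal_right free_alg_closed) auto
  qed
  note expand = right_diff_distrib left_diff_distrib mult_single plus_list_def
  {
    case (squared x i y)
    then have "word [i, i] - single [i] (tl_loop a b i) \<in> tl_relators a b n"
      by (auto simp: tl_relators_def tl_loop_def)
    from rel[OF this, of x y] squared show ?case by (simp add: expand)
  next
    case (far x i j y)
    then have "word [i, j] - word [j, i] \<in> tl_relators a b n"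
      unfolding tl_relators_def by auto
    from rel[OF this, of x y] far show ?case by (simp add: expand)
  next
    case (zig x i j y)
    then have "word [i, j, i] - word [i] \<in> tl_relators a b n"
      unfolding tl_relators_def by auto
    from rel[OF this, of x y] zig show ?case by (simp add: expand)
  next
    case (zag x i j y)
    then have "word [i, j, i] - word [i] \<in> tl_relators a b n"
      unfolding tl_relators_def by auto
    from tl_ideal_uminus[OF rel[OF this, of x y]] zag show ?case by (simp add: expand)
  }
qed

lemma single_sum: "single u (\<Sum>a\<in>A. f a) = (\<Sum>a\<in>A. single u (f a))"
  by (induction A rule: infinite_finite_induct) (simp_all add: single_add)

abbreviation normal_sum :: "nat \<Rightarrow> (nat list \<Rightarrow> nat list \<Rightarrow> 'r::comm_ring_1) \<Rightarrow> (nat list \<Rightarrow>\<^sub>0 'r)" where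
  "normal_sum n q \<equiv> (\<Sum>(cs, cs')\<in>normal_forms n. single (normal_word cs cs') (q cs cs'))"

lemma ex_normal_form:
  assumes "p \<in> carrier (free_alg n)"
  shows "\<exists>q. p - normal_sum n q \<in> tl_ideal a b n"
proof -
  have "\<forall>u\<in>keys p. \<exists>c D. D \<in> normal_forms n \<and>
      red (tl_loop a b) n u c (case D of (cs, cs') \<Rightarrow> normal_word cs cs')"
  proof
    fix u assume "u \<in> keys p"
    with assms have "set u \<subseteq> {1..<n}" by (auto simp: carrier_free_alg)
    from red_normal_word[OF this, of "tl_loop a b"]
    show "\<exists>c D. D \<in> normal_forms n \<and> red (tl_loop a b) n u c (case D of (cs, cs') \<Rightarrow> normal_word cs cs')"
      by (fastforce simp: normal_forms_def)
  qed
  then obtain c D where D: "\<And>u. u \<in> keys p \<Longrightarrow> D u \<in> normal_forms n \<and>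
      red (tl_loop a b) n u (c u) (case D u of (cs, cs') \<Rightarrow> normal_word cs cs')"
    by metis
  define nw where "nw = (\<lambda>(cs, cs'). normal_word cs cs')"
  define q where "q E = (\<Sum>u\<in>{u \<in> keys p. D u = E}. lookup p u * c u)" for E
  have "(\<Sum>E\<in>normal_forms n. single (nw E) (q E)) =
      (\<Sum>E\<in>normal_forms n. \<Sum>u\<in>{u \<in> keys p. D u = E}.
        single (nw (D u)) (lookup p u * c u))"
    unfolding q_def by (intro sum.cong refl) (simp add: single_sum)
  also have "\<dots> = (\<Sum>u\<in>keys p. single (nw (D u)) (lookup p u * c u))"
    using D by (intro sum.group finite_normal_forms) auto
  finally have eq: "p - (\<Sum>E\<in>normal_forms n. single (nw E) (q E)) =
      (\<Sum>u\<in>keys p. single [] (lookup p u) * (word u - single (nw (D u)) (c u)))"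
    using sum_single_lookup[of p]
    by (simp add: sum_subtractf right_diff_distrib mult_single plus_list_def)
  have "p - (\<Sum>E\<in>normal_forms n. single (nw E) (q E)) \<in> tl_ideal a b n"
    unfolding eq
  proof (intro tl_ideal_sum tl_ideal_left tl_ideal_red)
    fix u assume u: "u \<in> keys p"
    show "red (tl_loop a b) n u (c u) (nw (D u))" using D[OF u] by (simp add: nw_def)
    show "set u \<subseteq> {1..<n}" using u assms by (auto simp: carrier_free_alg)
  qed (simp add: free_alg_closed)
  then show ?thesis
    by (intro exI[of _ "\<lambda>cs cs'. q (cs, cs')"]) (simp add: nw_def case_prod_unfold)
qed

section \<open>Coefficients with respect to the reduced monomials\<close>

context
  fixes a b :: "'r::comm_ring_1" and n :: nat
begin

abbreviation tl_class :: "(nat list \<Rightarrow>\<^sub>0 'r) \<Rightarrow> (nat list \<Rightarrow>\<^sub>0 'r) set" where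
  "tl_class p \<equiv> tl_ideal a b n +>\<^bsub>free_alg n\<^esub> p"

lemma tl_class_eq_iff:
  assumes "p \<in> carrier (free_alg n)" "q \<in> carrier (free_alg n)"
  shows "tl_class p = tl_class q \<longleftrightarrow> p - q \<in> tl_ideal a b n"
proof -
  interpret ring "free_alg n :: (nat list \<Rightarrow>\<^sub>0 'r) ring" by (rule ring_free_alg)
  have "p \<ominus>\<^bsub>free_alg n\<^esub> q = p - q"
    using free_alg_a_inv[OF assms(2)] by (simp add: a_minus_def)
  with quotient_eq_iff_same_a_r_cos[OF ideal_tl_ideal assms, of a b] show ?thesis by simp
qed

lemma tl_class_simps:
  assumes "p \<in> carrier (free_alg n)" "q \<in> carrier (free_alg n)"
  shows "tl_class p \<otimes>\<^bsub>two_TL a b n\<^esub> tl_class q = tl_class (p * q)"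
    and "tl_class p \<oplus>\<^bsub>two_TL a b n\<^esub> tl_class q = tl_class (p + q)"
    and "tl_class p \<in> carrier (two_TL a b n)"
proof -
  interpret h: ring_hom_ring "free_alg n" "two_TL a b n" "(+>\<^bsub>free_alg n\<^esub>) (tl_ideal a b n)"
    unfolding two_TL_def by (rule ideal.rcos_ring_hom_ring[OF ideal_tl_ideal])
  show "tl_class p \<otimes>\<^bsub>two_TL a b n\<^esub> tl_class q = tl_class (p * q)"
    using h.hom_mult[OF assms] by simp
  show "tl_class p \<oplus>\<^bsub>two_TL a b n\<^esub> tl_class q = tl_class (p + q)"
    using h.hom_add[OF assms] by simp
  show "tl_class p \<in> carrier (two_TL a b n)" using h.hom_closed[OF assms(1)] .
qed

lemma tl_class_one: "\<one>\<^bsub>two_TL a b n\<^esub> = tl_class (word [])"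
  and tl_class_zero: "\<zero>\<^bsub>two_TL a b n\<^esub> = tl_class 0"
proof -
  interpret h: ring_hom_ring "free_alg n" "two_TL a b n" "(+>\<^bsub>free_alg n\<^esub>) (tl_ideal a b n)"
    unfolding two_TL_def by (rule ideal.rcos_ring_hom_ring[OF ideal_tl_ideal])
  show "\<one>\<^bsub>two_TL a b n\<^esub> = tl_class (word [])" using h.hom_one by simp
  show "\<zero>\<^bsub>two_TL a b n\<^esub> = tl_class 0" using h.hom_zero by simp
qed

lemma tl_class_zero_iff: "p \<in> carrier (free_alg n) \<Longrightarrow> tl_class p = \<zero>\<^bsub>two_TL a b n\<^esub> \<longleftrightarrow> p \<in> tl_ideal a b n"
  unfolding tl_class_zero by (simp add: tl_class_eq_iff free_alg_closed)

lemma carrier_two_TL: "X \<in> carrier (two_TL a b n) \<Longrightarrow> \<exists>p\<in>carrier (free_alg n). X = tl_class p"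
  by (auto simp: two_TL_def FactRing_def A_RCOSETS_def')

lemma tl_mon_eq: "tl_mon a b n c w = tl_class (single w c)"
  by (simp add: tl_mon_def)

lemma tl_scale_class:
  "p \<in> carrier (free_alg n) \<Longrightarrow> tl_scale a b n c (tl_class p) = tl_class (single [] c * p)"
  by (simp add: tl_scale_def tl_mon_eq tl_class_simps free_alg_closed)

text \<open>A basis element may have several reduced words; fixing one turns sums over the basis
  into elements of the free algebra.\<close>

definition basis_word :: "(nat list \<Rightarrow>\<^sub>0 'r) set \<Rightarrow> nat list" where
  "basis_word m = (SOME w. reduced a b n w \<and> tl_class (word w) = m)"

lemma basis_word:
  assumes "m \<in> tl_basis a b n"
  shows "set (basis_word m) \<subseteq> {1..<n}" "tl_class (word (basis_word m)) = m"
proof -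
  from assms have "\<exists>w. reduced a b n w \<and> tl_class (word w) = m"
    by (auto simp: tl_basis_def tl_mon_eq)
  then have "reduced a b n (basis_word m) \<and> tl_class (word (basis_word m)) = m"
    unfolding basis_word_def by (rule someI_ex)
  then show "set (basis_word m) \<subseteq> {1..<n}" "tl_class (word (basis_word m)) = m"
    by (auto simp: reduced_def)
qed

lemma tl_finsum:
  assumes "finite S" "S \<subseteq> tl_basis a b n"
  shows "(\<Oplus>\<^bsub>two_TL a b n\<^esub> m \<in> S. tl_scale a b n (c m) m) =
    tl_class (\<Sum>m\<in>S. single (basis_word m) (c m))"
  using assms
proof (induction S)
  case empty
  interpret ring "two_TL a b n" by (rule ring_two_TL)
  show ?case by (simp add: tl_class_zero)
next
  case (insert m S)
  interpret ring "two_TL a b n" by (rule ring_two_TL)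
  have scale: "tl_scale a b n (c m) m = tl_class (single (basis_word m) (c m))"
    if "m \<in> tl_basis a b n" for m
    using tl_scale_class[of "word (basis_word m)" "c m"] basis_word[OF that]
    by (simp add: free_alg_closed mult_single plus_list_def)
  have cl: "single (basis_word m) (c m) \<in> carrier (free_alg n)" if "m \<in> tl_basis a b n" for m
    using basis_word[OF that] by (intro free_alg_closed)
  have mem: "tl_scale a b n (c m) m \<in> carrier (two_TL a b n)" if "m \<in> tl_basis a b n" for m
    unfolding scale[OF that] by (rule tl_class_simps(3)[OF cl[OF that] cl[OF that]])
  have "(\<Oplus>\<^bsub>two_TL a b n\<^esub> m \<in> insert m S. tl_scale a b n (c m) m) =
      tl_scale a b n (c m) m \<oplus>\<^bsub>two_TL a b n\<^esub> (\<Oplus>\<^bsub>two_TL a b n\<^esub> m \<in> S. tl_scale a b n (c m) m)"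
    using insert.hyps insert.prems mem by (intro finsum_insert) auto
  with insert cl show ?case
    by (auto simp: scale tl_class_simps free_alg_sum subset_iff)
qed

lemma tl_coeffs_iff:
  assumes "p \<in> carrier (free_alg n)"
  shows "tl_coeffs a b n (tl_class p) c \<longleftrightarrow> {m. c m \<noteq> 0} \<subseteq> tl_basis a b n \<and> finite {m. c m \<noteq> 0} \<and>
    p - (\<Sum>m\<in>{m. c m \<noteq> 0}. single (basis_word m) (c m)) \<in> tl_ideal a b n"
proof -
  have "(\<Sum>m\<in>{m. c m \<noteq> 0}. single (basis_word m) (c m)) \<in> carrier (free_alg n)"
    if "{m. c m \<noteq> 0} \<subseteq> tl_basis a b n"
    using that basis_word by (intro free_alg_sum free_alg_closed) blast
  note carr = this
  show ?thesis
  proof (cases "{m. c m \<noteq> 0} \<subseteq> tl_basis a b n \<and> finite {m. c m \<noteq> 0}")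
    case True
    with tl_finsum[of "{m. c m \<noteq> 0}" c] tl_class_eq_iff[OF assms carr] show ?thesis
      unfolding tl_coeffs_def by simp
  qed (auto simp: tl_coeffs_def)
qed

text \<open>The coefficient of the empty word vanishes on the ideal, and the empty word represents
  no basis element but 1. So the coefficient of 1 can be read off any representative.\<close>

lemma tl_coeffs_one:
  assumes "p \<in> carrier (free_alg n)" "tl_coeffs a b n (tl_class p) c"
  shows "c \<one>\<^bsub>two_TL a b n\<^esub> = lookup p []"
proof -
  let ?S = "{m. c m \<noteq> 0}"
  from assms have S: "?S \<subseteq> tl_basis a b n" "finite ?S"
    "p - (\<Sum>m\<in>?S. single (basis_word m) (c m)) \<in> tl_ideal a b n"
    by (auto simp: tl_coeffs_iff)
  have one: "basis_word m = [] \<longleftrightarrow> m = \<one>\<^bsub>two_TL a b n\<^esub>" if "m \<in> tl_basis a b n" for m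
  proof
    assume "basis_word m = []"
    with basis_word(2)[OF that] show "m = \<one>\<^bsub>two_TL a b n\<^esub>" by (simp add: tl_class_one)
  next
    assume "m = \<one>\<^bsub>two_TL a b n\<^esub>"
    with basis_word[OF that] have "word (basis_word m) - word [] \<in> tl_ideal a b n"
      by (simp add: tl_class_one tl_class_eq_iff free_alg_closed)
    from tl_ideal_eval(1)[OF this] show "basis_word m = []"
      by (auto simp: lookup_minus lookup_single when_def split: if_splits)
  qed
  have "lookup p [] = lookup (\<Sum>m\<in>?S. single (basis_word m) (c m)) []"
    using tl_ideal_eval(1)[OF S(3)] by (simp add: lookup_minus)
  also have "\<dots> = (\<Sum>m\<in>?S. if m = \<one>\<^bsub>two_TL a b n\<^esub> then c m else 0)"
    unfolding lookup_sum using S(1) one by (intro sum.cong) (auto simp: lookup_single when_def)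
  also have "\<dots> = c \<one>\<^bsub>two_TL a b n\<^esub>" using S(2) by simp
  finally show ?thesis ..
qed

lemma reduced_expression:
  "set u \<subseteq> {1..<n} \<Longrightarrow> \<exists>m\<in>tl_basis a b n. \<exists>e. word u - single (basis_word m) e \<in> tl_ideal a b n"
proof (induction u rule: length_induct)
  case (1 u)
  show ?case
  proof (cases "reduced a b n u")
    case True
    then have m: "tl_class (word u) \<in> tl_basis a b n" by (auto simp: tl_basis_def tl_mon_eq)
    from basis_word[OF m] 1(2) have "word u - word (basis_word (tl_class (word u))) \<in> tl_ideal a b n"
      by (subst tl_class_eq_iff[symmetric]) (auto simp: free_alg_closed)
    with m show ?thesis by blast
  next
    case False
    then obtain v c where v: "set v \<subseteq> {1..<n}" "length v < length u"
      "tl_mon a b n 1 u = tl_scale a b n c (tl_mon a b n 1 v)"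
      using 1(2) by (auto simp: reduced_def)
    with 1(1) obtain m e where m: "m \<in> tl_basis a b n"
      "word v - single (basis_word m) e \<in> tl_ideal a b n" by blast
    have "word u - single v c \<in> tl_ideal a b n"
      using v 1(2) by (subst tl_class_eq_iff[symmetric])
        (auto simp: tl_mon_eq tl_scale_class free_alg_closed mult_single plus_list_def)
    moreover have "single [] c * (word v - single (basis_word m) e) \<in> tl_ideal a b n"
      using m(2) by (intro tl_ideal_left free_alg_closed) auto
    ultimately have "(word u - single v c) +
        single [] c * (word v - single (basis_word m) e) \<in> tl_ideal a b n"
      by (rule tl_ideal_add)
    then have "word u - single (basis_word m) (c * e) \<in> tl_ideal a b n"
      by (simp add: right_diff_distrib mult_single plus_list_def)
    with m(1) show ?thesis by blast
  qed
qed

lemma ex_tl_coeffs: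
  assumes p: "p \<in> carrier (free_alg n)"
  shows "\<exists>c. tl_coeffs a b n (tl_class p) c"
proof -
  let ?K = "keys p"
  have "\<forall>u\<in>?K. \<exists>m e. m \<in> tl_basis a b n \<and> word u - single (basis_word m) e \<in> tl_ideal a b n"
  proof
    fix u assume "u \<in> ?K"
    with p have "set u \<subseteq> {1..<n}" by (auto simp: carrier_free_alg)
    from reduced_expression[OF this]
    show "\<exists>m e. m \<in> tl_basis a b n \<and> word u - single (basis_word m) e \<in> tl_ideal a b n" by blast
  qed
  then obtain m e where me: "\<And>u. u \<in> ?K \<Longrightarrow> m u \<in> tl_basis a b n \<and>
      word u - single (basis_word (m u)) (e u) \<in> tl_ideal a b n" by metis
  define c where "c x = (\<Sum>u\<in>{u \<in> ?K. m u = x}. lookup p u * e u)" for x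
  have supp: "{x. c x \<noteq> 0} \<subseteq> m ` ?K"
    by (auto simp: c_def image_iff) (metis (mono_tags, lifting) mem_Collect_eq sum.neutral)
  then have "finite {x. c x \<noteq> 0}" by (rule finite_subset) simp
  moreover have "{x. c x \<noteq> 0} \<subseteq> tl_basis a b n" using supp me by auto
  moreover have "(\<Sum>x\<in>{x. c x \<noteq> 0}. single (basis_word x) (c x)) =
      (\<Sum>x\<in>m ` ?K. single (basis_word x) (c x))"
    using supp by (intro sum.mono_neutral_left) auto
  moreover have "(\<Sum>x\<in>m ` ?K. single (basis_word x) (c x)) =
      (\<Sum>x\<in>m ` ?K. \<Sum>u\<in>{u \<in> ?K. m u = x}. single (basis_word (m u)) (lookup p u * e u))"
    unfolding c_def by (intro sum.cong refl) (simp add: single_sum)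
  moreover have "\<dots> = (\<Sum>u\<in>?K. single (basis_word (m u)) (lookup p u * e u))"
    by (intro sum.group) auto
  moreover have "p - (\<Sum>u\<in>?K. single (basis_word (m u)) (lookup p u * e u)) =
      (\<Sum>u\<in>?K. single [] (lookup p u) * (word u - single (basis_word (m u)) (e u)))"
    using sum_single_lookup[of p]
    by (simp add: sum_subtractf right_diff_distrib mult_single plus_list_def)
  moreover have "\<dots> \<in> tl_ideal a b n"
    using me by (intro tl_ideal_sum tl_ideal_left free_alg_closed) auto
  ultimately have "tl_coeffs a b n (tl_class p) c" unfolding tl_coeffs_iff[OF p] by simp
  then show ?thesis by (rule exI[of _ c])
qed

lemma ex_JW_iff:
  "(\<exists>J. is_JW a b n J) \<longleftrightarrow> (\<exists>y\<in>carrier (free_alg n). lookup y [] = 1 \<and>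
     (\<forall>i\<in>{1..<n}. word [i] * y \<in> tl_ideal a b n))"
proof
  assume "\<exists>J. is_JW a b n J"
  then obtain J c where J: "J \<in> carrier (two_TL a b n)"
    "\<And>i. i \<in> {1..<n} \<Longrightarrow> tl_gen a b n i \<otimes>\<^bsub>two_TL a b n\<^esub> J = \<zero>\<^bsub>two_TL a b n\<^esub>"
    "tl_coeffs a b n J c" "c \<one>\<^bsub>two_TL a b n\<^esub> = 1" unfolding is_JW_def by blast
  then obtain y where y: "y \<in> carrier (free_alg n)" "J = tl_class y" using carrier_two_TL by blast
  have "word [i] * y \<in> tl_ideal a b n" if i: "i \<in> {1..<n}" for i
    using J(2)[OF i] i y
    by (simp add: tl_gen_def tl_mon_eq tl_class_simps free_alg_closed tl_class_zero_iff)
  with y J(3,4) tl_coeffs_one[of y c]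
  show "\<exists>y\<in>carrier (free_alg n). lookup y [] = 1 \<and>
     (\<forall>i\<in>{1..<n}. word [i] * y \<in> tl_ideal a b n)" by auto
next
  assume "\<exists>y\<in>carrier (free_alg n). lookup y [] = 1 \<and>
     (\<forall>i\<in>{1..<n}. word [i] * y \<in> tl_ideal a b n)"
  then obtain y where y: "y \<in> carrier (free_alg n)" "lookup y [] = 1"
    "\<And>i. i \<in> {1..<n} \<Longrightarrow> word [i] * y \<in> tl_ideal a b n" by blast
  \<comment> \<open>\<open>y - 1\<close> is a combination of nonempty words; each of them ends in
    some \<open>e_i\<close> and therefore kills \<open>y\<close>.\<close>
  have idem: "y * y - y \<in> tl_ideal a b n"
  proof -
    let ?p = "y - word []"
    have p: "?p \<in> carrier (free_alg n)" using y by (intro free_alg_closed) auto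
    have "?p * y = (\<Sum>u\<in>keys ?p. single u (lookup ?p u) * y)"
      by (subst sum_single_lookup[symmetric, of ?p]) (simp only: sum_distrib_right)
    also have "\<dots> \<in> tl_ideal a b n"
    proof (rule tl_ideal_sum)
      fix u assume u: "u \<in> keys ?p"
      then have "u \<noteq> []" using y(2) by (auto simp: in_keys_iff lookup_minus)
      then obtain v i where v: "u = v @ [i]" using rev_exhaust by blast
      have "set u \<subseteq> {1..<n}" using u p by (auto simp: carrier_free_alg)
      with v have "single v (lookup ?p u) * (word [i] * y) \<in> tl_ideal a b n"
        by (intro tl_ideal_left y free_alg_closed) auto
      then show "single u (lookup ?p u) * y \<in> tl_ideal a b n"
        by (simp add: mult.assoc[symmetric] mult_single plus_list_def v)
    qed
    finally show ?thesis by (simp add: left_diff_distrib word_Nil)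
  qed
  obtain c where c: "tl_coeffs a b n (tl_class y) c" using ex_tl_coeffs[OF y(1)] by blast
  have "is_JW a b n (tl_class y)"
    unfolding is_JW_def
  proof (intro conjI ballI)
    show "tl_class y \<in> carrier (two_TL a b n)" using tl_class_simps(3)[OF y(1,1)] .
    show "tl_class y \<noteq> \<zero>\<^bsub>two_TL a b n\<^esub>"
      using tl_class_zero_iff[OF y(1)] tl_ideal_eval(1)[of y a b n] y(2) by auto
    show "tl_class y \<otimes>\<^bsub>two_TL a b n\<^esub> tl_class y = tl_class y"
      using y(1) idem by (simp add: tl_class_simps tl_class_eq_iff free_alg_closed)
    show "tl_gen a b n i \<otimes>\<^bsub>two_TL a b n\<^esub> tl_class y = \<zero>\<^bsub>two_TL a b n\<^esub>" if i: "i \<in> {1..<n}" for i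
      using y i by (simp add: tl_gen_def tl_mon_eq tl_class_simps free_alg_closed tl_class_zero_iff)
    show "\<exists>c. tl_coeffs a b n (tl_class y) c \<and> c \<one>\<^bsub>two_TL a b n\<^esub> = 1"
      using c tl_coeffs_one[OF y(1) c] y(2) by auto
  qed
  then show "\<exists>J. is_JW a b n J" ..
qed

end


section \<open>Existence of the projector\<close>

lemma map_poly_hom:
  fixes h :: "'a::comm_ring_1 \<Rightarrow> 'b::comm_ring_1"
  assumes "h 0 = 0" "\<And>x y. h (x + y) = h x + h y" "\<And>x y. h (x * y) = h x * h y"
  shows "map_poly h (p + q) = map_poly h p + map_poly h q"
    and "map_poly h (p * q) = map_poly h p * map_poly h q"
proof -
  have hsum: "h (\<Sum>a\<in>A. f a) = (\<Sum>a\<in>A. h (f a))" for f :: "nat \<Rightarrow> 'a" and A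
    by (induction A rule: infinite_finite_induct) (simp_all add: assms)
  show "map_poly h (p + q) = map_poly h p + map_poly h q"
    by (rule poly_eqI) (simp add: coeff_map_poly assms)
  show "map_poly h (p * q) = map_poly h p * map_poly h q"
    by (rule poly_eqI) (simp add: coeff_map_poly assms coeff_mult hsum)
qed

locale specialization =
  fixes h :: "'a::comm_ring_1 \<Rightarrow> 'r::comm_ring_1"
  assumes add: "h (x + y) = h x + h y" and mult: "h (x * y) = h x * h y" and one: "h 1 = 1"
begin

lemma zero: "h 0 = 0"
  using add[of 0 0] by simp

lemma uminus: "h (- x) = - h x"
  using add[of x "- x"] zero by (simp add: eq_neg_iff_add_eq_0 add.commute)

lemma sum: "h (\<Sum>x\<in>A. f x) = (\<Sum>x\<in>A. h (f x))"
  by (induction A rule: infinite_finite_induct) (simp_all add: zero add)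

lemma prod: "h (\<Prod>x\<in>A. f x) = (\<Prod>x\<in>A. h (f x))"
  by (induction A rule: infinite_finite_induct) (simp_all add: one mult)

lemma gen_act: "h (gen_act d i f x) = gen_act (\<lambda>i. h (d i)) i (\<lambda>z. h (f z)) x"
  by (simp add: gen_act_def cap_def opt_def mult zero split: list.split bool.split option.split)

lemma word_act: "h (word_act d u f x) = word_act (\<lambda>i. h (d i)) u (\<lambda>z. h (f z)) x"
  by (induction u arbitrary: f) (simp_all add: gen_act)

lemma delta: "h (of_bool P) = of_bool P"
  by (simp add: zero one)

end

lemma specialize_hom:
  "specialize a b (p + q) = specialize a b p + specialize a b q"
  "specialize a b (p * q) = specialize a b p * specialize a b q"
  "specialize a b 1 = 1" "specialize a b x_s = a" "specialize a b x_t = b"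
proof -
  define ev where "ev q = poly (map_poly of_int q) a" for q :: "int poly"
  have ev: "ev 0 = 0" "ev 1 = 1" "ev (p + q) = ev p + ev q" "ev (p * q) = ev p * ev q" for p q
    by (simp_all add: ev_def map_poly_hom)
  have sp: "specialize a b p = poly (map_poly ev p) b" for p
    by (simp add: specialize_def ev_def[abs_def])
  show "specialize a b (p + q) = specialize a b p + specialize a b q"
    "specialize a b (p * q) = specialize a b p * specialize a b q"
    unfolding sp by (simp_all add: map_poly_hom[where h=ev] ev)
  show "specialize a b 1 = 1" unfolding sp by (simp add: map_poly_1 ev)
  show "specialize a b x_s = a" "specialize a b x_t = b"
    unfolding sp x_s_def x_t_def by (simp_all add: map_poly_pCons ev ev_def)
qed

lemma specialization_specialize: "specialization (specialize a b)"
  by unfold_locales (simp_all add: specialize_hom)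

lemma loop_True: "loop True = tl_loop x_s x_t"
  by (auto simp: loop_def tl_loop_def qvar_def)

lemma specialize_tl_loop: "specialize a b (tl_loop x_s x_t i) = tl_loop a b i"
proof -
  interpret specialization "specialize a b" by (rule specialization_specialize)
  show ?thesis by (simp add: tl_loop_def uminus specialize_hom)
qed

section \<open>Columns of annihilated elements\<close>

lemma sorted_words: "k \<le> n \<Longrightarrow> sorted_word n k \<in> words n k" "k \<le> n \<Longrightarrow> antisorted_word n k \<in> words n k"
  by (auto simp: words_def sorted_word_def antisorted_word_def)

text \<open>The image of \<open>e_i\<close> is spanned by words with a factor \<open>+ -\<close>,
  and this word has none. Its row in the matrix of an element therefore sees only the coefficient of
  1.\<close>

lemma gen_act_antisorted:
  assumes "i \<in> {1..<n}" "length x = n" "k \<le> n"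
  shows "gen_act d i (delta (antisorted_word n k)) x = 0"
proof -
  have "gen_act d i (delta (antisorted_word n k)) x = cap d i (\<lambda>_. 0) x"
    unfolding gen_act_def
  proof (rule cap_cong)
    fix z :: "bool list" assume "length z + 2 = length x"
    with assms have "i - 1 \<le> length z" by auto
    from cup_neq_antisorted[OF this, of n k]
    show "(delta (antisorted_word n k) (cup i z) :: 'a) = 0" by simp
  qed (use assms in auto)
  also have "\<dots> = 0" using cap_linear(2)[of d i 0 "\<lambda>_. 0" x] by simp
  finally show ?thesis .
qed

lemma eval_act_antisorted:
  assumes "y \<in> carrier (free_alg n)" "length x = n" "k \<le> n"
  shows "eval_act d y (delta (antisorted_word n k)) x = lookup y [] * delta (antisorted_word n k) x"
proof -
  have "word_act d u (delta (antisorted_word n k)) x = (if u = [] then delta (antisorted_word n k) x else 0)"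
    if "u \<in> keys y" for u
  proof (cases u)
    case (Cons i v)
    have u: "set u \<subseteq> {1..<n}" using assms(1) that by (auto simp: carrier_free_alg)
    have "word_act d v (gen_act d i (delta (antisorted_word n k))) x = word_act d v (\<lambda>_. 0) x"
      using u Cons assms by (intro word_act_cong gen_act_antisorted) auto
    with Cons show ?thesis by simp
  qed simp
  then have "eval_act d y (delta (antisorted_word n k)) x =
      (\<Sum>u\<in>keys y. if u = [] then lookup y [] * delta (antisorted_word n k) x else 0)"
    unfolding eval_act_def by (intro sum.cong) auto
  then show ?thesis by (simp add: in_keys_iff)
qed

lemma eval_act_expand:
  assumes "y \<in> carrier (free_alg n)" "x \<in> words n k"
  shows "eval_act d y f x = (\<Sum>w\<in>words n k. f w * eval_act d y (delta w) x)"
proof -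
  have "eval_act d y f x = (\<Sum>u\<in>keys y. \<Sum>w\<in>words n k.
      f w * (lookup y u * word_act d u (delta w) x))"
    unfolding eval_act_def
  proof (intro sum.cong refl)
    fix u assume "u \<in> keys y"
    with assms(1) have "set u \<subseteq> {1..<n}" by (auto simp: carrier_free_alg)
    then have "0 \<notin> set u" by auto
    from word_act_expand[OF assms(2) this, of d f]
    show "lookup y u * word_act d u f x =
        (\<Sum>w\<in>words n k. f w * (lookup y u * word_act d u (delta w) x))"
      by (simp add: sum_distrib_left mult_ac)
  qed
  also have "\<dots> = (\<Sum>w\<in>words n k. f w * eval_act d y (delta w) x)"
    unfolding eval_act_def by (subst sum.swap) (simp add: sum_distrib_left)
  finally show ?thesis .
qed

lemma invariant_unique:
  assumes "invariant d n k t" "invariant d n k v" "v (sorted_word n k) = 1" "w \<in> words n k"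
  shows "t w = t (sorted_word n k) * v w"
proof -
  have "invariant d n k (\<lambda>w. t w - t (sorted_word n k) * v w)"
    using assms(1,2)
    by (simp add: invariant_def pairing_def left_diff_distrib sum_subtractf mult.assoc
        flip: sum_distrib_left)
  \<comment> \<open>The difference has sorted coordinate 0, and divisibility by 0 means
    vanishing.\<close>
  from invariant_dvd[OF this, of 0 w] assms show ?thesis by simp
qed

text \<open>If \<open>y\<close> is killed by all \<open>e\<^sub>i\<close>, then every column of its matrix is an invariant vector. Comparing
  the coordinates at \<open>antisorted_word\<close>, where only the coefficient of \<open>1\<close> contributes, with
  those of the normalised invariant vector brings in the quantum binomial coefficient.\<close>

lemma annihilated_column:
  assumes y: "y \<in> carrier (free_alg n)"
    and ann: "\<And>i f. i \<in> {1..<n} \<Longrightarrow> eval_act d y (gen_act d i f) x = 0"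
    and v: "invariant d n k v" "v (sorted_word n k) = 1"
    and x: "x \<in> words n k" and k: "k \<le> n" and w: "w \<in> words n k"
  shows "v (antisorted_word n k) * eval_act d y (delta w) x =
    lookup y [] * delta (antisorted_word n k) x * v w"
proof -
  define t where "t w = eval_act d y (delta w) x" for w
  have "invariant d n k t"
    unfolding invariant_def
  proof (intro ballI)
    fix i u assume i: "i \<in> {1..<n}"
    have "pairing n k t (gen_act d i (delta u)) = eval_act d y (gen_act d i (delta u)) x"
      unfolding pairing_def t_def eval_act_expand[OF y x, of d "gen_act d i (delta u)"]
      by (simp add: mult.commute)
    then show "pairing n k t (gen_act d i (delta u)) = 0" using ann[OF i] by simp
  qed
  from invariant_unique[OF this v] have t: "t u = t (sorted_word n k) * v u" if "u \<in> words n k" for u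
    using that by blast
  have "t (antisorted_word n k) = lookup y [] * delta (antisorted_word n k) x"
    unfolding t_def using eval_act_antisorted[OF y _ k] x by (simp add: words_def)
  moreover have "v (antisorted_word n k) * t w = (t (sorted_word n k) * v (antisorted_word n k)) * v w"
    by (subst t[OF w]) (simp only: mult_ac)
  ultimately show ?thesis
    using t[OF sorted_words(2)[OF k]] unfolding t_def[symmetric] by simp
qed

lemma normal_word_set:
  assumes "(cs, cs') \<in> normal_forms n" shows "set (normal_word cs cs') \<subseteq> {1..<n}"
  using assms set_slide[of n cs 0] set_slide[of n cs' 0] set_cup_gens[of n cs 0]
  by (auto simp: normal_forms_def normal_word_def subset_iff)

lemma normal_word_eq_Nil: "(cs, cs') \<in> normal_forms n \<Longrightarrow> normal_word cs cs' = [] \<longleftrightarrow> (cs, cs') = ([], [])"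
  by (cases cs; cases cs') (auto simp: normal_forms_def normal_word_def)

lemma lookup_normal_sum:
  "lookup (normal_sum n q) [] = q [] []"
proof -
  have "lookup (normal_sum n q) [] =
      (\<Sum>D\<in>normal_forms n. if D = ([], []) then q [] [] else 0)"
    unfolding lookup_sum
  proof (intro sum.cong refl)
    fix D assume D: "D \<in> normal_forms n"
    obtain cs cs' where "D = (cs, cs')" by (cases D)
    with D normal_word_eq_Nil[of cs cs' n]
    show "lookup (case D of (cs, cs') \<Rightarrow> single (normal_word cs cs') (q cs cs')) [] =
        (if D = ([], []) then q [] [] else 0)"
      by (auto simp: lookup_single when_def)
  qed
  then show ?thesis by (simp add: finite_normal_forms) (simp add: normal_forms_def)
qed

lemma ex_normal_form_eval:
  fixes a b :: "'r::comm_ring_1"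
  assumes "p \<in> carrier (free_alg n)"
  shows "\<exists>q. p - normal_sum n q \<in> tl_ideal a b n \<and>
    (\<forall>f x. length x = n \<longrightarrow> eval_act (tl_loop a b) p f x =
       (\<Sum>(cs, cs')\<in>normal_forms n. q cs cs' * word_act (tl_loop a b) (normal_word cs cs') f x)) \<and>
    q [] [] = lookup p []"
proof -
  obtain q where q: "p - normal_sum n q \<in> tl_ideal a b n"
    using ex_normal_form[OF assms] by blast
  have "eval_act (tl_loop a b) p f x =
       (\<Sum>(cs, cs')\<in>normal_forms n. q cs cs' * word_act (tl_loop a b) (normal_word cs cs') f x)"
    if "length x = n" for f x
    using tl_ideal_eval(2)[OF q that, of f] by (simp add: eval_act_diff eval_act_sum case_prod_unfold)
  moreover have "q [] [] = lookup p []"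
    using tl_ideal_eval(1)[OF q] lookup_normal_sum[of q n] by (simp add: lookup_minus)
  ultimately show ?thesis using q by blast
qed

text \<open>The unnormalised generic projector \<open>Y\<^sub>0 \<cdots> Y\<^sub>n\<^sub>-\<^sub>1\<close> with \<open>Y\<^sub>s = \<Sum>\<^sub>j [n - j] e\<^sub>j \<dots> e\<^sub>s\<^sub>+\<^sub>1\<close>.\<close>

fun generic_sym :: "nat \<Rightarrow> nat \<Rightarrow> (nat list \<Rightarrow>\<^sub>0 zxy)" where
  "generic_sym n 0 = word []"
| "generic_sym n (Suc m) = (let s = n - Suc m in
     (\<Sum>j\<in>{s..<n}. single (rev [Suc s..<Suc j]) (sym_coeff True n j)) * generic_sym n m)"

text \<open>By \<open>descent_annihilates\<close>, each factor \<open>Y_s\<close> adds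
  \<open>e_(s+1)\<close> to the generators that kill the product and keeps the later ones. Its
  coefficient at the empty word is \<open>[n - s]\<close>, and a product of these is nonzero in an
  integral domain.\<close>

lemma generic_sym:
  assumes "m \<le> n"
  shows "generic_sym n m \<in> carrier (free_alg n)" and "lookup (generic_sym n m) [] \<noteq> 0"
    and "\<And>i f x. n - m < i \<Longrightarrow> i < n \<Longrightarrow> length x = n \<Longrightarrow>
      eval_act (loop True) (generic_sym n m) (gen_act (loop True) i f) x = 0"
  using assms
proof (induction m)
  case 0
  {
    case 1
    then show ?case by (simp add: free_alg_closed)
  next
    case 2
    then show ?case by simp
  next
    case 3
    then show ?case by simp
  }
next
  case (Suc m)
  define s where "s = n - Suc m"
  have s: "s < n" "n - m = Suc s" if "Suc m \<le> n" using that by (auto simp: s_def)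
  let ?Y = "\<Sum>j\<in>{s..<n}. single (rev [Suc s..<Suc j]) (sym_coeff True n j)"
  have X: "generic_sym n (Suc m) = ?Y * generic_sym n m" by (simp add: s_def Let_def)
  {
    case 1
    then show ?case unfolding X using Suc.IH(1)
      by (intro free_alg_closed free_alg_sum) auto
  next
    case 2
    have "lookup ?Y [] = (\<Sum>j\<in>{s..<n}. if j = s then sym_coeff True n s else 0)"
      unfolding lookup_sum by (intro sum.cong) (auto simp: lookup_single when_def)
    then have "lookup ?Y [] = sym_coeff True n s" using s[OF 2] by simp
    also have "\<dots> \<noteq> 0" unfolding sym_coeff_def using s[OF 2] by (intro qnum_nonzero) simp
    finally show ?case unfolding X lookup_mult_Nil using Suc.IH(2) 2 by simp
  next
    case (3 i f x)
    define \<Lambda> where "\<Lambda> f = eval_act (loop True) (generic_sym n m) f x" for f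
    have "\<Lambda> (eval_act (loop True) ?Y g) = (\<Sum>j\<in>{s..<n}. sym_coeff True n j * \<Lambda> (word_act (loop True) (rev [Suc s..<Suc j]) g))" for g
      unfolding \<Lambda>_def by (simp add: eval_act_sum[abs_def] eval_act_fun_sum eval_act_linear del: upt_Suc)
    then have "eval_act (loop True) (generic_sym n (Suc m)) (gen_act (loop True) i f) x =
        (\<Sum>j\<in>{s..<n}. sym_coeff True n j * \<Lambda> (word_act (loop True) (rev [Suc s..<Suc j]) (gen_act (loop True) i f)))"
      unfolding X eval_act_mult by (simp add: \<Lambda>_def del: upt_Suc)
    also have "\<dots> = 0"
    proof (rule descent_annihilates)
      show "\<Lambda> (\<lambda>z. c * f z) = c * \<Lambda> f" for c f by (simp add: \<Lambda>_def eval_act_linear)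
      show "\<Lambda> f = \<Lambda> g" if "\<And>z. length z = n \<Longrightarrow> f z = g z" for f g
        unfolding \<Lambda>_def eval_act_def
      proof (intro sum.cong refl)
        fix u assume u: "u \<in> keys (generic_sym n m)"
        have "generic_sym n m \<in> carrier (free_alg n)" using Suc.IH(1) 3 by simp
        with u have "set u \<subseteq> {1..<n}" by (auto simp: carrier_free_alg)
        then have "0 \<notin> set u" by auto
        with that 3 have "word_act (loop True) u f x = word_act (loop True) u g x"
          by (intro word_act_cong) auto
        then show "lookup (generic_sym n m) u * word_act (loop True) u f x =
            lookup (generic_sym n m) u * word_act (loop True) u g x" by simp
      qed
      show "\<Lambda> (gen_act (loop True) i f) = 0" if "s + 2 \<le> i" "i < n" for i f
        unfolding \<Lambda>_def using that 3 s by (intro Suc.IH(3)) auto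
    qed (use loop_period sym_coeff_rec sym_coeff_n 3 s_def in auto)
    finally show ?case .
  }
qed

section \<open>The two directions of the equivalence\<close>

lemma binomials_invertible:
  fixes a b :: "'r::comm_ring_1"
  assumes "is_JW a b n J" "k \<le> n"
  shows "specialize a b (qbinom_s n k) dvd 1"
proof -
  interpret specialization "specialize a b" by (rule specialization_specialize)
  obtain y where y: "y \<in> carrier (free_alg n)" "lookup y [] = 1"
    "\<And>i. i \<in> {1..<n} \<Longrightarrow> word [i] * y \<in> tl_ideal a b n"
    using assms(1) ex_JW_iff[of a b n] by blast
  obtain v where v: "invariant (loop True) n k v" "v (sorted_word n k) = 1"
    "v (antisorted_word n k) * (qfact True k * qfact True (n - k)) = qfact True n"
    using ex_invariant[OF assms(2)] by blast
  let ?v = "\<lambda>w. specialize a b (v w)"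
  have inv: "invariant (tl_loop a b) n k ?v"
    unfolding invariant_def
  proof (intro ballI)
    fix i u assume "i \<in> {1..<n}" "u \<in> words n k"
    with v(1) have "pairing n k v (gen_act (loop True) i (delta u)) = 0" by (simp add: invariant_def)
    then have "specialize a b (pairing n k v (gen_act (loop True) i (delta u))) = 0" by (simp add: zero)
    then show "pairing n k ?v (gen_act (tl_loop a b) i (delta u)) = 0"
      by (simp only: pairing_def sum mult gen_act loop_True specialize_tl_loop delta)
  qed
  have ann: "eval_act (tl_loop a b) y (gen_act (tl_loop a b) i f) (antisorted_word n k) = 0" if "i \<in> {1..<n}" for i f
    using tl_ideal_eval(2)[OF y(3)[OF that], of "antisorted_word n k" f] sorted_words(2)[OF assms(2)]
    by (simp add: eval_act_mult words_def eval_act_single[abs_def])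
  \<comment> \<open>The column of the antisorted word is read at the sorted word, where the
    right-hand side of \<open>annihilated_column\<close> is a product of ones.\<close>
  have "?v (antisorted_word n k) * eval_act (tl_loop a b) y (delta (sorted_word n k)) (antisorted_word n k) = 1"
    using annihilated_column[OF y(1) ann inv _ sorted_words(2)[OF assms(2)] assms(2) sorted_words(1)[OF assms(2)]] v(2) y(2)
    by (simp add: one)
  then have "?v (antisorted_word n k) dvd 1" by (metis dvd_triv_left)
  then show ?thesis using qbinom_eq[OF assms(2) v(3)] by simp
qed

lemma ex_JW_of_invertible:
  fixes a b :: "'r::comm_ring_1"
  assumes "\<And>k. k \<le> n \<Longrightarrow> specialize a b (qbinom_s n k) dvd 1"
  shows "\<exists>J. is_JW a b n J"
proof -
  interpret specialization "specialize a b" by (rule specialization_specialize)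
  let ?A = "tl_loop x_s x_t" and ?R = "tl_loop a b" and ?NF = "normal_forms n"
  define X where "X = generic_sym n n"
  define g where "g = lookup X []"
  define B where "B = (\<Prod>k\<le>n. qbinom_s n k)"
  have X: "X \<in> carrier (free_alg n)" and g: "g \<noteq> 0"
    and ann: "\<And>i f x. i \<in> {1..<n} \<Longrightarrow> length x = n \<Longrightarrow> eval_act ?A X (gen_act ?A i f) x = 0"
    using generic_sym[of n n] by (auto simp: X_def g_def loop_True)
  obtain q where "X - normal_sum n q \<in> tl_ideal x_s x_t n"
    and q: "\<And>f x. length x = n \<Longrightarrow> eval_act ?A X f x =
      (\<Sum>(cs, cs')\<in>?NF. q cs cs' * word_act ?A (normal_word cs cs') f x)" "q [] [] = g"
    using ex_normal_form_eval[OF X, where a=x_s and b=x_t] unfolding g_def by blast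
  have g_dvd: "g dvd B * q cs cs'" if "(cs, cs') \<in> ?NF" for cs cs'
  proof -
    \<comment> \<open>For equal numbers of minuses, \<open>annihilated_column\<close> exhibits the
      product as a multiple of \<open>g\<close>. For different numbers the matrix entry is 0, since
      the action preserves the number of minuses.\<close>
    have "g dvd qbinom_s n (minuses x) * (\<Sum>(cs, cs')\<in>?NF. q cs cs' * word_act ?A (normal_word cs cs') (delta w) x)"
      if x: "length x = n" and w: "length w = n" for x w
    proof (cases "minuses w = minuses x")
      case True
      define k where "k = minuses x"
      have k: "x \<in> words n k" "w \<in> words n k" "k \<le> n"
        using x w True count_le_length[of x False] by (auto simp: words_def k_def)
      obtain v where v: "invariant ?A n k v" "v (sorted_word n k) = 1"
        "v (antisorted_word n k) * (qfact True k * qfact True (n - k)) = qfact True n"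
        using ex_invariant[OF k(3), of True] unfolding loop_True by blast
      have "qbinom_s n k * eval_act ?A X (delta w) x = g * delta (antisorted_word n k) x * v w"
        using annihilated_column[OF X ann v(1,2) k(1,3,2)] x qbinom_eq[OF k(3) v(3)] by (simp add: g_def)
      then show ?thesis unfolding q(1)[OF x, symmetric] k_def[symmetric] by (simp add: mult.assoc)
    next
      case False
      have "word_act ?A (normal_word cs cs') (delta w) x = 0" if "(cs, cs') \<in> ?NF" for cs cs'
      proof -
        have "word_act ?A (normal_word cs cs') (delta w) x = word_act ?A (normal_word cs cs') (\<lambda>_. 0) x"
          using False normal_word_set[OF that] by (intro word_act_cong) auto
        then show ?thesis by simp
      qed
      then show ?thesis by (simp add: case_prod_unfold)
    qed
    from normal_word_coeff_dvd[of ?A n g "qbinom_s n" q, OF tl_loop_period this that]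
    have "g dvd (\<Prod>j\<le>length cs. qbinom_s n j) * q cs cs'" .
    moreover have "(\<Prod>j\<le>length cs. qbinom_s n j) dvd B"
      unfolding B_def using that admissible_bounds[of n cs] by (intro prod_dvd_prod_subset) (auto simp: normal_forms_def)
    ultimately show ?thesis by (meson dvd_refl dvd_trans mult_dvd_mono)
  qed
  \<comment> \<open>The quotient is taken over the polynomial ring, where \<open>g\<close> is
    nonzero; in \<open>R\<close> it may vanish. The coefficient of 1 becomes \<open>B\<close>, which
    specializes to a unit.\<close>
  define r where "r cs cs' = B * q cs cs' div g" for cs cs'
  have r: "g * r cs cs' = B * q cs cs'" if "(cs, cs') \<in> ?NF" for cs cs'
    using g_dvd[OF that] by (simp add: r_def)
  have r1: "r [] [] = B" using g q(2) by (simp add: r_def)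
  have r_ann: "(\<Sum>(cs, cs')\<in>?NF. r cs cs' * word_act ?A (normal_word cs cs') (gen_act ?A i f) x) = 0"
    if i: "i \<in> {1..<n}" and x: "length x = n" for i f x
  proof -
    have "g * (\<Sum>(cs, cs')\<in>?NF. r cs cs' * word_act ?A (normal_word cs cs') (gen_act ?A i f) x) =
        B * (\<Sum>(cs, cs')\<in>?NF. q cs cs' * word_act ?A (normal_word cs cs') (gen_act ?A i f) x)"
      unfolding sum_distrib_left
    proof (intro sum.cong refl)
      fix D assume "D \<in> ?NF"
      with r[of "fst D" "snd D"] show "g * (case D of (cs, cs') \<Rightarrow> r cs cs' * word_act ?A (normal_word cs cs') (gen_act ?A i f) x) =
          B * (case D of (cs, cs') \<Rightarrow> q cs cs' * word_act ?A (normal_word cs cs') (gen_act ?A i f) x)"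
        by (simp add: case_prod_unfold mult.assoc[symmetric])
    qed
    also have "\<dots> = 0" using q(1)[OF x, symmetric] ann[OF i x] by simp
    finally show ?thesis using g by simp
  qed
  define y where "y = (\<Sum>(cs, cs')\<in>?NF. single (normal_word cs cs') (specialize a b (r cs cs')))"
  have y: "y \<in> carrier (free_alg n)"
    unfolding y_def
  proof (rule free_alg_sum)
    fix D assume "D \<in> ?NF"
    then show "(case D of (cs, cs') \<Rightarrow> single (normal_word cs cs') (specialize a b (r cs cs')))
        \<in> carrier (free_alg n)"
      by (cases D) (simp add: free_alg_closed(6)[OF normal_word_set])
  qed
  have y_ann: "word [i] * y \<in> tl_ideal a b n" if i: "i \<in> {1..<n}" for i
  proof -
    have iy: "word [i] * y \<in> carrier (free_alg n)" using i y by (intro free_alg_closed) auto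
    obtain q' where q': "word [i] * y - normal_sum n q' \<in> tl_ideal a b n"
      "\<And>f x. length x = n \<Longrightarrow> eval_act ?R (word [i] * y) f x =
        (\<Sum>(cs, cs')\<in>?NF. q' cs cs' * word_act ?R (normal_word cs cs') f x)"
      "q' [] [] = lookup (word [i] * y) []"
      using ex_normal_form_eval[OF iy, where a=a and b=b] by blast
    have "(\<Sum>(cs, cs')\<in>?NF. q' cs cs' * word_act ?R (normal_word cs cs') (delta w) x) = 0"
      if x: "length x = n" for x w
    proof -
      have "eval_act ?R (word [i] * y) (delta w) x =
          (\<Sum>(cs, cs')\<in>?NF. specialize a b (r cs cs') * word_act ?R (normal_word cs cs') (gen_act ?R i (delta w)) x)"
        by (simp add: eval_act_mult y_def eval_act_sum case_prod_unfold eval_act_single[abs_def])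
      also have "\<dots> = specialize a b (\<Sum>(cs, cs')\<in>?NF. r cs cs' * word_act ?A (normal_word cs cs') (gen_act ?A i (delta w)) x)"
        by (simp only: sum mult word_act gen_act specialize_tl_loop delta case_prod_unfold)
      also have "\<dots> = 0" unfolding r_ann[OF i x] by (rule zero)
      finally show ?thesis using q'(2)[OF x] by simp
    qed
    \<comment> \<open>Faithfulness: with modulus 0 and all factors equal to 1,
      \<open>normal_word_coeff_dvd\<close> says that a combination of normal words acting as 0 has
      zero coefficients.\<close>
    then have "0 dvd (\<Prod>j\<le>length cs. 1) * q' cs cs'" if "(cs, cs') \<in> ?NF" for cs cs'
      using that by (intro normal_word_coeff_dvd[of ?R n 0 "\<lambda>_. 1" q', OF tl_loop_period]) auto
    then have "normal_sum n q' = 0"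
      by (intro sum.neutral) auto
    with q'(1) show ?thesis by simp
  qed
  have "lookup y [] = specialize a b B"
    unfolding y_def lookup_normal_sum r1 ..
  moreover have "specialize a b B dvd 1"
    unfolding B_def prod using prod_dvd_prod[of "{..n}" "\<lambda>k. specialize a b (qbinom_s n k)" "\<lambda>_. 1"] assms by simp
  ultimately obtain e where e: "lookup y [] * e = 1" by (metis dvdE)
  let ?y = "single [] e * y"
  have "?y \<in> carrier (free_alg n)" using y by (intro free_alg_closed) auto
  moreover have "lookup ?y [] = 1" using e by (simp add: lookup_mult_Nil mult.commute)
  moreover have "word [i] * ?y \<in> tl_ideal a b n" if "i \<in> {1..<n}" for i
  proof -
    have "word [i] * ?y = single [] e * (word [i] * y)"
      by (simp add: mult.assoc[symmetric] mult_single plus_list_def)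
    then show ?thesis using y_ann[OF that] by (simp add: tl_ideal_left free_alg_closed)
  qed
  ultimately show ?thesis unfolding ex_JW_iff by blast
qed

theorem theorem1p1:
  fixes two_s two_t :: "'r::comm_ring_1" and n :: nat
  assumes "n \<ge> 1"
  shows "(\<exists>J. is_JW two_s two_t n J) \<longleftrightarrow>
    (\<forall>k \<in> {0..n}. specialize two_s two_t (qbinom_s n k) dvd 1)"
  using binomials_invertible ex_JW_of_invertible[of n two_s two_t] by auto

end
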